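(* Let $\mathbb{K}$ be a field. Suppose that $\Gamma$ and $H$ are $\mathbb{K}$-linear sofic groups, that $\Gamma\curvearrowright_{\alpha}X$ is a sofic action on the set $X$, and that $\Gamma\curvearrowright_{\beta}Y$ is a sofic action on the graph $Y$. Then: (a) the restricted permutational wreath product $H\wr_{\alpha}\Gamma$ is $\mathbb{K}$-linear sofic; (b) if it is true that for every field $\mathbb{L}$, every set $V$ and every family $\{\Gamma_v:v\in V\}$ of $\mathbb{L}$-linear sofic groups the free product $\ast_{v\in V}\Gamma_v$ is $\mathbb{L}$-linear sofic, then the free wreath product $H\wr_{\alpha}^{\ast}\Gamma$ is $\mathbb{K}$-linear sofic; (c) if it is true that for every field $\mathbb{L}$, every set $V$, every family $\{\Gamma_v:v\in V\}$ of $\mathbb{L}$-linear sofic groups and every graph with vertex set $V$, the graph product of the $\Gamma_v$ over this graph is $\mathbb{L}$-linear sofic, then the graph wreath product $\mathcal{W}(\Gamma,H,Y)$ is $\mathbb{K}$-linear sofic.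
   Context: Graph products. For a graph $X=(V,E)$ and groups $(\Gamma_v)_{v\in V}$, the graph product is $(\ast_{v\in V}\Gamma_v)/\langle\langle h^{-1}k^{-1}hk:(v,w)\in E,\ h\in\Gamma_v,\ k\in\Gamma_w\rangle\rangle$; it is denoted $P(H,X)$ when every $\Gamma_v$ is a copy $H_v$ of a single group $H$. An action $\Gamma\curvearrowright_\alpha X$ by graph automorphisms induces an action $\hat\alpha$ on $P(H,X)$ by automorphisms, where $g$ sends $H_v$ identically to $H_{\alpha(g)v}$; the graph wreath product is $\mathcal{W}(\Gamma,H,X)=P(H,X)\rtimes_{\hat\alpha}\Gamma$. For an action on a set $X$: $H\wr_\alpha\Gamma=(\bigoplus_XH)\rtimes\Gamma$ (the case of the complete graph on $X$) and $H\wr_\alpha^\ast\Gamma=(\ast_XH)\rtimes\Gamma$ (the case of the graph on $X$ with no edges), with $\Gamma$ permuting the copies of $H$. $\mathbb{K}$-linear sofic groups. A group $\Gamma$ is $\mathbb{K}$-linear sofic if there is $c>0$ such that for every finite $F\subseteq\Gamma$ and $\epsilon>0$ there are $n\in\mathbb{N}$ and a function $\varphi:\Gamma\to GL_n(\mathbb{K})$ with, for $d(M,N)=\frac1n\operatorname{rk}(M-N)$: $\varphi(e)=I_n$; $d(\varphi(gh),\varphi(g)\varphi(h))<\epsilon$ for all $g,h\in F$ with $gh\in F$; and $d(\varphi(g),I_n)>c$ for all $e\neq g\in F$. Sofic actions on sets and graphs. For a finite set $A$, $d_A(\sigma,\tau)=1-\frac{1}{|A|}|\{a\in A:\sigma(a)=\tau(a)\}|$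 on $\operatorname{Sym}(A)$. A function $\varphi:\Gamma\to\operatorname{Sym}(A)$ is unital if $\varphi(e)=e$ and $(F,\epsilon)$-multiplicative if $d_A(\varphi(gh),\varphi(g)\varphi(h))<\epsilon$ for all $g,h\in F$ with $gh\in F$. Given $\Gamma\curvearrowright_\alpha X$ on a set, finite $F\subseteq\Gamma$, $E\subseteq X$, and $\epsilon>0$, $\varphi$ is an $(F,E,\epsilon)$-orbit approximation of $\alpha$ if there exist a finite set $B$, $S\subseteq A$ with $|S|>(1-\epsilon)|A|$, and injective functions $(\pi_s:E\hookrightarrow B)_{s\in S}$ such that for all $g\in F$, $x\in E$, $s\in S$, if $\varphi(g)\cdot s\in S$ and $\alpha(g)^{-1}\cdot x\in E$ then $\pi_{\varphi(g)\cdot s}(x)=\pi_s(\alpha(g)^{-1}\cdot x)$. The action is sofic if for all such $F,E,\epsilon$ there exist a finite set $A$ and a unital $(F,\epsilon)$-multiplicative $(F,E,\epsilon)$-orbit approximation $\varphi:\Gamma\to\operatorname{Sym}(A)$. For actions on graphs by automorphisms the definition is the same, with $E$ a finite induced subgraph of $X$, $B$ a finite graph, and the $\pi_s$ inclusions of induced subgraphs (injective vertex maps preserving adjacency and non-adjacency). *)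

theory Defs
  imports
    "HOL-Algebra.Group_Action"
    "HOL-Algebra.Product_Groups"
    "HOL-Library.Infinite_Typeclass"
    "Jordan_Normal_Form.Matrix"
    "Jordan_Normal_Form.Missing_VectorSpace"
begin

section \<open>Linear sofic groups\<close>

text \<open>
  Fields are records in the style of \<^theory>\<open>HOL-Algebra.Ring\<close>, so that a statement can
  quantify over them. The arithmetic on \<^typ>\<open>'a mat\<close> in the library is that of a
  type class; the operations below are the same ones for the arithmetic of a record \<open>K\<close>.
\<close>

definition matrix_ring :: "nat \<Rightarrow> ('k, 'm) ring_scheme \<Rightarrow> 'k mat ring" where
  "matrix_ring n K =
    \<lparr>carrier = {M \<in> carrier_mat n n. elements_mat M \<subseteq> carrier K},
     monoid.mult = (\<lambda>M N. mat n n (\<lambda>(i, j). \<Oplus>\<^bsub>K\<^esub>k\<in>{..<n}. M $$ (i, k) \<otimes>\<^bsub>K\<^esub> N $$ (k, j))),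
     monoid.one = mat n n (\<lambda>(i, j). if i = j then \<one>\<^bsub>K\<^esub> else \<zero>\<^bsub>K\<^esub>),
     ring.zero = mat n n (\<lambda>_. \<zero>\<^bsub>K\<^esub>),
     ring.add = (\<lambda>M N. mat n n (\<lambda>(i, j). M $$ (i, j) \<oplus>\<^bsub>K\<^esub> N $$ (i, j)))\<rparr>"

text \<open>The dimension of the span of the columns inside \<open>K\<^sup>n\<close>.\<close>

definition matrix_rank :: "nat \<Rightarrow> ('k, 'm) ring_scheme \<Rightarrow> 'k mat \<Rightarrow> nat" where
  "matrix_rank n K M =
    (let V = ring.func_space K {..<n};
         C = {(\<lambda>i\<in>{..<n}. M $$ (i, j)) |j. j < n}
     in vectorspace.dim K (V\<lparr>carrier := LinearCombinations.module.span K V C\<rparr>))"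

definition rank_dist :: "nat \<Rightarrow> ('k, 'm) ring_scheme \<Rightarrow> 'k mat \<Rightarrow> 'k mat \<Rightarrow> real" where
  "rank_dist n K M N = real (matrix_rank n K (M \<ominus>\<^bsub>matrix_ring n K\<^esub> N)) / real n"

text \<open>\<^term>\<open>Units (matrix_ring n K)\<close> is the general linear group.\<close>

definition linear_sofic :: "('k, 'm) ring_scheme \<Rightarrow> ('g, 'n) monoid_scheme \<Rightarrow> bool" where
  "linear_sofic K G \<longleftrightarrow> group G \<and>
    (\<exists>c::real. c > 0 \<and>
      (\<forall>F \<epsilon>. finite F \<longrightarrow> F \<subseteq> carrier G \<longrightarrow> (\<epsilon>::real) > 0 \<longrightarrow>
        (\<exists>n>0. \<exists>\<phi> \<in> carrier G \<rightarrow> Units (matrix_ring n K).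
          \<phi> \<one>\<^bsub>G\<^esub> = \<one>\<^bsub>matrix_ring n K\<^esub> \<and>
          (\<forall>g\<in>F. \<forall>h\<in>F. g \<otimes>\<^bsub>G\<^esub> h \<in> F \<longrightarrow>
            rank_dist n K (\<phi> (g \<otimes>\<^bsub>G\<^esub> h)) (\<phi> g \<otimes>\<^bsub>matrix_ring n K\<^esub> \<phi> h) < \<epsilon>) \<and>
          (\<forall>g\<in>F. g \<noteq> \<one>\<^bsub>G\<^esub> \<longrightarrow> rank_dist n K (\<phi> g) \<one>\<^bsub>matrix_ring n K\<^esub> > c))))"

section \<open>Graphs and sofic actions\<close>

text \<open>
  A graph is a vertex set \<open>V\<close> with a symmetric set \<open>E\<close> of ordered pairs of distinct vertices.
\<close>

definition simple_graph :: "'v set \<Rightarrow> ('v \<times> 'v) set \<Rightarrow> bool" where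
  "simple_graph V E \<longleftrightarrow> E \<subseteq> V \<times> V \<and> sym E \<and> irrefl E"

definition graph_action ::
  "('g, 'n) monoid_scheme \<Rightarrow> 'v set \<Rightarrow> ('v \<times> 'v) set \<Rightarrow> ('g \<Rightarrow> 'v \<Rightarrow> 'v) \<Rightarrow> bool" where
  "graph_action G V E \<alpha> \<longleftrightarrow> simple_graph V E \<and> group_action G V \<alpha> \<and>
    (\<forall>g\<in>carrier G. \<forall>v\<in>V. \<forall>w\<in>V. (\<alpha> g v, \<alpha> g w) \<in> E \<longleftrightarrow> (v, w) \<in> E)"

definition hamming_dist :: "'a set \<Rightarrow> ('a \<Rightarrow> 'a) \<Rightarrow> ('a \<Rightarrow> 'a) \<Rightarrow> real" where
  "hamming_dist A \<sigma> \<tau> = 1 - real (card {a \<in> A. \<sigma> a = \<tau> a}) / real (card A)"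

definition unital :: "('g, 'n) monoid_scheme \<Rightarrow> 'a set \<Rightarrow> ('g \<Rightarrow> 'a \<Rightarrow> 'a) \<Rightarrow> bool" where
  "unital G A \<phi> \<longleftrightarrow> \<phi> \<one>\<^bsub>G\<^esub> = \<one>\<^bsub>BijGroup A\<^esub>"

definition approx_multiplicative ::
  "('g, 'n) monoid_scheme \<Rightarrow> 'g set \<Rightarrow> real \<Rightarrow> 'a set \<Rightarrow> ('g \<Rightarrow> 'a \<Rightarrow> 'a) \<Rightarrow> bool" where
  "approx_multiplicative G F \<epsilon> A \<phi> \<longleftrightarrow>
    (\<forall>g\<in>F. \<forall>h\<in>F. g \<otimes>\<^bsub>G\<^esub> h \<in> F \<longrightarrow>
      hamming_dist A (\<phi> (g \<otimes>\<^bsub>G\<^esub> h)) (\<phi> g \<otimes>\<^bsub>BijGroup A\<^esub> \<phi> h) < \<epsilon>)"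

text \<open>
  In what follows the finite sets and graphs whose existence is asserted have natural numbers
  as elements, which is no restriction up to bijection.
\<close>

definition orbit_approximation ::
  "('g, 'n) monoid_scheme \<Rightarrow> ('g \<Rightarrow> 'x \<Rightarrow> 'x) \<Rightarrow> 'g set \<Rightarrow> 'x set \<Rightarrow> real \<Rightarrow>
    'a set \<Rightarrow> ('g \<Rightarrow> 'a \<Rightarrow> 'a) \<Rightarrow> bool" where
  "orbit_approximation G \<alpha> F E \<epsilon> A \<phi> \<longleftrightarrow>
    (\<exists>(B::nat set) S \<pi>. finite B \<and> S \<subseteq> A \<and> real (card S) > (1 - \<epsilon>) * real (card A) \<and>
      (\<forall>s\<in>S. \<pi> s \<in> E \<rightarrow> B \<and> inj_on (\<pi> s) E) \<and>
      (\<forall>g\<in>F. \<forall>x\<in>E. \<forall>s\<in>S. \<phi> g s \<in> S \<longrightarrow> \<alpha> (inv\<^bsub>G\<^esub> g) x \<in> E \<longrightarrow>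
        \<pi> (\<phi> g s) x = \<pi> s (\<alpha> (inv\<^bsub>G\<^esub> g) x)))"

definition sofic_action ::
  "('g, 'n) monoid_scheme \<Rightarrow> 'x set \<Rightarrow> ('g \<Rightarrow> 'x \<Rightarrow> 'x) \<Rightarrow> bool" where
  "sofic_action G X \<alpha> \<longleftrightarrow> group_action G X \<alpha> \<and>
    (\<forall>F E \<epsilon>. finite F \<longrightarrow> F \<subseteq> carrier G \<longrightarrow> finite E \<longrightarrow> E \<subseteq> X \<longrightarrow> \<epsilon> > 0 \<longrightarrow>
      (\<exists>(A::nat set) \<phi>. finite A \<and> \<phi> \<in> carrier G \<rightarrow> carrier (BijGroup A) \<and>
        unital G A \<phi> \<and> approx_multiplicative G F \<epsilon> A \<phi> \<and> orbit_approximation G \<alpha> F E \<epsilon> A \<phi>))"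

text \<open>
  In the versions for graphs, \<open>D\<close> is the edge set of the ambient graph, and the finite induced
  subgraph of it is given by its vertex set \<open>E\<close>.
\<close>

definition graph_orbit_approximation ::
  "('g, 'n) monoid_scheme \<Rightarrow> ('x \<times> 'x) set \<Rightarrow> ('g \<Rightarrow> 'x \<Rightarrow> 'x) \<Rightarrow> 'g set \<Rightarrow> 'x set \<Rightarrow> real \<Rightarrow>
    'a set \<Rightarrow> ('g \<Rightarrow> 'a \<Rightarrow> 'a) \<Rightarrow> bool" where
  "graph_orbit_approximation G D \<alpha> F E \<epsilon> A \<phi> \<longleftrightarrow>
    (\<exists>(B::nat set) D' S \<pi>. finite B \<and> simple_graph B D' \<and>
      S \<subseteq> A \<and> real (card S) > (1 - \<epsilon>) * real (card A) \<and>
      (\<forall>s\<in>S. \<pi> s \<in> E \<rightarrow> B \<and> inj_on (\<pi> s) E \<and>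
        (\<forall>x\<in>E. \<forall>y\<in>E. (\<pi> s x, \<pi> s y) \<in> D' \<longleftrightarrow> (x, y) \<in> D)) \<and>
      (\<forall>g\<in>F. \<forall>x\<in>E. \<forall>s\<in>S. \<phi> g s \<in> S \<longrightarrow> \<alpha> (inv\<^bsub>G\<^esub> g) x \<in> E \<longrightarrow>
        \<pi> (\<phi> g s) x = \<pi> s (\<alpha> (inv\<^bsub>G\<^esub> g) x)))"

definition sofic_graph_action ::
  "('g, 'n) monoid_scheme \<Rightarrow> 'x set \<Rightarrow> ('x \<times> 'x) set \<Rightarrow> ('g \<Rightarrow> 'x \<Rightarrow> 'x) \<Rightarrow> bool" where
  "sofic_graph_action G X D \<alpha> \<longleftrightarrow> graph_action G X D \<alpha> \<and>
    (\<forall>F E \<epsilon>. finite F \<longrightarrow> F \<subseteq> carrier G \<longrightarrow> finite E \<longrightarrow> E \<subseteq> X \<longrightarrow> \<epsilon> > 0 \<longrightarrow>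
      (\<exists>(A::nat set) \<phi>. finite A \<and> \<phi> \<in> carrier G \<rightarrow> carrier (BijGroup A) \<and>
        unital G A \<phi> \<and> approx_multiplicative G F \<epsilon> A \<phi> \<and>
        graph_orbit_approximation G D \<alpha> F E \<epsilon> A \<phi>))"

section \<open>Free products and graph products\<close>

text \<open>
  The free product consists of the words in letters \<open>(v, g)\<close> with \<open>g\<close> in the \<open>v\<close>-th group, modulo
  multiplying adjacent letters with the same index and deleting identity letters.
\<close>

definition free_product_words ::
  "'v set \<Rightarrow> ('v \<Rightarrow> ('h, 'n) monoid_scheme) \<Rightarrow> ('v \<times> 'h) list set" where
  "free_product_words V G = lists (SIGMA v:V. carrier (G v))"

inductive_set free_product_step ::
  "'v set \<Rightarrow> ('v \<Rightarrow> ('h, 'n) monoid_scheme) \<Rightarrow> (('v \<times> 'h) list \<times> ('v \<times> 'h) list) set"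
  for V G where
  mult: "\<lbrakk>xs \<in> free_product_words V G; ys \<in> free_product_words V G;
      v \<in> V; g \<in> carrier (G v); h \<in> carrier (G v)\<rbrakk>
    \<Longrightarrow> (xs @ [(v, g), (v, h)] @ ys, xs @ [(v, g \<otimes>\<^bsub>G v\<^esub> h)] @ ys) \<in> free_product_step V G"
| one: "\<lbrakk>xs \<in> free_product_words V G; ys \<in> free_product_words V G; v \<in> V\<rbrakk>
    \<Longrightarrow> (xs @ [(v, \<one>\<^bsub>G v\<^esub>)] @ ys, xs @ ys) \<in> free_product_step V G"

definition free_product_rel ::
  "'v set \<Rightarrow> ('v \<Rightarrow> ('h, 'n) monoid_scheme) \<Rightarrow> (('v \<times> 'h) list \<times> ('v \<times> 'h) list) set" where
  "free_product_rel V G =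
    (free_product_step V G \<union> (free_product_step V G)\<inverse>)\<^sup>* \<inter>
      free_product_words V G \<times> free_product_words V G"

definition free_product ::
  "'v set \<Rightarrow> ('v \<Rightarrow> ('h, 'n) monoid_scheme) \<Rightarrow> ('v \<times> 'h) list set monoid" where
  "free_product V G =
    \<lparr>carrier = free_product_words V G // free_product_rel V G,
     monoid.mult = (\<lambda>A B. free_product_rel V G `` {a @ b |a b. a \<in> A \<and> b \<in> B}),
     monoid.one = free_product_rel V G `` {[]}\<rparr>"

definition free_product_inj ::
  "'v set \<Rightarrow> ('v \<Rightarrow> ('h, 'n) monoid_scheme) \<Rightarrow> 'v \<Rightarrow> 'h \<Rightarrow> ('v \<times> 'h) list set" where
  "free_product_inj V G v h = free_product_rel V G `` {[(v, h)]}"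

definition normal_closure :: "('g, 'n) monoid_scheme \<Rightarrow> 'g set \<Rightarrow> 'g set" where
  "normal_closure G R = \<Inter>{N. N \<lhd> G \<and> R \<subseteq> N}"

definition graph_product ::
  "'v set \<Rightarrow> ('v \<times> 'v) set \<Rightarrow> ('v \<Rightarrow> ('h, 'n) monoid_scheme) \<Rightarrow> ('v \<times> 'h) list set set monoid" where
  "graph_product V E G =
    (let P = free_product V G; \<iota> = free_product_inj V G
     in P Mod normal_closure P
          {inv\<^bsub>P\<^esub> \<iota> v h \<otimes>\<^bsub>P\<^esub> inv\<^bsub>P\<^esub> \<iota> w k \<otimes>\<^bsub>P\<^esub> \<iota> v h \<otimes>\<^bsub>P\<^esub> \<iota> w k |v w h k.
            (v, w) \<in> E \<and> h \<in> carrier (G v) \<and> k \<in> carrier (G w)})"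

section \<open>Wreath products\<close>

definition semidirect_product ::
  "('a, 'm) monoid_scheme \<Rightarrow> ('g, 'n) monoid_scheme \<Rightarrow> ('g \<Rightarrow> 'a \<Rightarrow> 'a) \<Rightarrow> ('a \<times> 'g) monoid" where
  "semidirect_product N G \<theta> =
    \<lparr>carrier = carrier N \<times> carrier G,
     monoid.mult = (\<lambda>(a, g) (b, h). (a \<otimes>\<^bsub>N\<^esub> \<theta> g b, g \<otimes>\<^bsub>G\<^esub> h)),
     monoid.one = (\<one>\<^bsub>N\<^esub>, \<one>\<^bsub>G\<^esub>)\<rparr>"

definition wreath_product ::
  "('h, 'm) monoid_scheme \<Rightarrow> ('g, 'n) monoid_scheme \<Rightarrow> 'x set \<Rightarrow> ('g \<Rightarrow> 'x \<Rightarrow> 'x) \<Rightarrow>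
    (('x \<Rightarrow> 'h) \<times> 'g) monoid" where
  "wreath_product H G X \<alpha> =
    semidirect_product (sum_group X (\<lambda>_. H)) G (\<lambda>g f. \<lambda>x\<in>X. f (\<alpha> (inv\<^bsub>G\<^esub> g) x))"

text \<open>
  \<open>g\<close> acts on words by replacing each letter \<open>(x, h)\<close> by \<open>(\<alpha> g x, h)\<close>. As \<open>\<alpha> g\<close> is a bijection
  (a graph automorphism in the case of graph products), this carries classes of words onto
  classes of words, and cosets of the normal closure onto such cosets; so the induced
  automorphisms are given by images of sets.
\<close>

definition relabel :: "('x \<Rightarrow> 'x) \<Rightarrow> ('x \<times> 'h) list \<Rightarrow> ('x \<times> 'h) list" where
  "relabel \<sigma> = map (\<lambda>(x, h). (\<sigma> x, h))"

definition free_wreath_product ::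
  "('h, 'm) monoid_scheme \<Rightarrow> ('g, 'n) monoid_scheme \<Rightarrow> 'x set \<Rightarrow> ('g \<Rightarrow> 'x \<Rightarrow> 'x) \<Rightarrow>
    (('x \<times> 'h) list set \<times> 'g) monoid" where
  "free_wreath_product H G X \<alpha> =
    semidirect_product (free_product X (\<lambda>_. H)) G (\<lambda>g. image (relabel (\<alpha> g)))"

definition graph_wreath_product ::
  "('g, 'n) monoid_scheme \<Rightarrow> ('h, 'm) monoid_scheme \<Rightarrow> 'x set \<Rightarrow> ('x \<times> 'x) set \<Rightarrow>
    ('g \<Rightarrow> 'x \<Rightarrow> 'x) \<Rightarrow> (('x \<times> 'h) list set set \<times> 'g) monoid" where
  "graph_wreath_product G H X E \<beta> =
    semidirect_product (graph_product X E (\<lambda>_. H)) G (\<lambda>g. image (image (relabel (\<beta> g))))"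

end

theory Submission
  imports Defs
begin

text \<open>
  Let \<open>N\<close> be the direct sum, free product or graph product of copies of \<open>H\<close>, so that the group in
  question is \<open>N \<rtimes> \<Gamma>\<close>. A sofic approximation \<open>\<phi> : \<Gamma> \<rightarrow> Sym(A)\<close> of the action comes with embeddings \<open>\<pi>\<^sub>s\<close>
  of a finite part of the index set, and each \<open>\<pi>\<^sub>s\<close> induces a homomorphism \<open>p\<^sub>s\<close> from \<open>N\<close> to a linear
  sofic group \<open>Q\<close>. If \<open>\<psi>\<close> is an approximate representation of \<open>Q\<close> and \<open>\<rho>\<close> one of \<open>\<Gamma>\<close>, then
  \<open>(x, g) \<mapsto> \<rho>(g) \<otimes> diag(\<psi>(p\<^sub>s(x)))\<^sub>s\<^sub>\<in>\<^sub>A \<cdot> perm(\<phi>(g))\<close> is one of \<open>N \<rtimes> \<Gamma>\<close>.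
  It separates elements with \<open>g \<noteq> 1\<close> through \<open>\<rho>\<close>, provided that \<open>\<rho>(g) \<otimes> C\<close> stays far from \<open>1\<close> for every
  invertible \<open>C\<close>; this is achieved by replacing \<open>\<rho>\<close> with \<open>\<rho> \<oplus> 1\<close>, which halves the constant.
  The constant of \<open>Q\<close> must not depend on the approximation. For free and graph products, \<open>Q\<close> is the
  product over one countable graph that contains all finite graphs; for direct sums, \<open>Q\<close> is a finite
  power of \<open>H\<close>, and tensor products preserve the stronger separation property.
\<close>

section \<open>Matrices over a field given by a record\<close>

text \<open>Tensor products are the obstacle. A scalar matrix lambda different from 1 lies at
  distance 1 from the identity, but its tensor product with 1/lambda is the identity; so one tensor
  factor can undo the separation achieved by another. Hence separation is required uniformly over
  all invertible tensor factors. In this form it survives tensoring on either side with its constant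
  unchanged, and extensions and arbitrarily large finite powers lose nothing.

  The block matrices multiply correctly because an orbit approximation makes the homomorphisms
  equivariant: at good points, \<open>p\<close> at \<phi>(g)s applied to the translate of x by g
  equals \<open>p\<close> at s applied to x. Only more than half of the points need be good, which
  costs a factor 2 in the constant.

  For words, an embedding known only on a finite set of indices still acts on the whole product:
  letters with other indices are deleted. Deletion respects all relations. The inverse of the
  embedding, again with deletion elsewhere, leads back and fixes the finitely many given elements,
  so nontrivial ones stay nontrivial. For this the embeddings must reflect edges as well as preserve
  them.\<close>

context field begin

text \<open>Matrices are total functions on arbitrary index types, with the index sets passed
  separately, so that blocks and tensor products are indexed by pairs without renumbering. Entries
  outside the index sets carry no meaning but stay in the carrier, which discharges the closure
  conditions of \<open>finsum\<close>.\<close>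

definition mtx :: "('i \<Rightarrow> 'j \<Rightarrow> 'a) \<Rightarrow> bool" where
  "mtx M \<longleftrightarrow> (\<forall>i j. M i j \<in> carrier R)"

definition mtx_mult :: "'j set \<Rightarrow> ('i \<Rightarrow> 'j \<Rightarrow> 'a) \<Rightarrow> ('j \<Rightarrow> 'l \<Rightarrow> 'a) \<Rightarrow> 'i \<Rightarrow> 'l \<Rightarrow> 'a" where
  "mtx_mult J M N = (\<lambda>i k. \<Oplus>j\<in>J. M i j \<otimes> N j k)"

definition mtx_one :: "'i \<Rightarrow> 'i \<Rightarrow> 'a" where
  "mtx_one = (\<lambda>i j. if i = j then \<one> else \<zero>)"

definition mtx_diff :: "('i \<Rightarrow> 'j \<Rightarrow> 'a) \<Rightarrow> ('i \<Rightarrow> 'j \<Rightarrow> 'a) \<Rightarrow> 'i \<Rightarrow> 'j \<Rightarrow> 'a" where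
  "mtx_diff M N = (\<lambda>i j. M i j \<ominus> N i j)"

definition mtx_tensor :: "('i \<Rightarrow> 'j \<Rightarrow> 'a) \<Rightarrow> ('k \<Rightarrow> 'l \<Rightarrow> 'a) \<Rightarrow> 'i \<times> 'k \<Rightarrow> 'j \<times> 'l \<Rightarrow> 'a" where
  "mtx_tensor M N = (\<lambda>p q. M (fst p) (fst q) \<otimes> N (snd p) (snd q))"

text \<open>A factorization of length \<open>r\<close> replaces the dimension of a subspace: upper
  bounds come from writing down two factors, and sums, column blocks and tensor products are handled
  by combining factorizations. Entries outside \<open>I\<close> and \<open>J\<close> are
  ignored.\<close>

definition rank_le :: "'i set \<Rightarrow> 'j set \<Rightarrow> nat \<Rightarrow> ('i \<Rightarrow> 'j \<Rightarrow> 'a) \<Rightarrow> bool" where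
  "rank_le I J r M \<longleftrightarrow> (\<exists>(U :: 'i \<Rightarrow> nat \<Rightarrow> 'a) V. mtx U \<and> mtx V \<and>
     (\<forall>i\<in>I. \<forall>j\<in>J. M i j = mtx_mult {..<r} U V i j))"

definition mtx_rank :: "'i set \<Rightarrow> 'j set \<Rightarrow> ('i \<Rightarrow> 'j \<Rightarrow> 'a) \<Rightarrow> nat" where
  "mtx_rank I J M = (LEAST r. rank_le I J r M)"

definition indep_columns :: "'i set \<Rightarrow> 'j set \<Rightarrow> ('i \<Rightarrow> 'j \<Rightarrow> 'a) \<Rightarrow> bool" where
  "indep_columns I J M \<longleftrightarrow> (\<forall>a. (\<forall>j. a j \<in> carrier R) \<longrightarrow>
     (\<forall>i\<in>I. (\<Oplus>j\<in>J. M i j \<otimes> a j) = \<zero>) \<longrightarrow> (\<forall>j\<in>J. a j = \<zero>))"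

lemma mtxD [simp]: "mtx M \<Longrightarrow> M i j \<in> carrier R"
  by (simp add: mtx_def)

lemma mtx_one_closed [simp]: "mtx mtx_one"
  by (simp add: mtx_def mtx_one_def)

lemma mtx_diff_closed [simp]: "mtx M \<Longrightarrow> mtx N \<Longrightarrow> mtx (mtx_diff M N)"
  by (simp add: mtx_def mtx_diff_def)

lemma mtx_mult_closed [simp]: "mtx M \<Longrightarrow> mtx N \<Longrightarrow> mtx (mtx_mult J M N)"
  by (auto simp: mtx_def mtx_mult_def intro!: finsum_closed)

lemma mtx_tensor_closed [simp]: "mtx M \<Longrightarrow> mtx N \<Longrightarrow> mtx (mtx_tensor M N)"
  by (auto simp: mtx_def mtx_tensor_def)

section \<open>Finite sums in a field\<close>

lemma finsum_delta:
  assumes "finite J" "i \<in> J" "\<And>j. j \<in> J \<Longrightarrow> f j \<in> carrier R"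
  shows "(\<Oplus>j\<in>J. if i = j then f j else \<zero>) = f i"
  using add.finprod_singleton[of i J f] assms by simp

lemma finsum_swap:
  assumes "finite I" "finite J" "\<And>i j. f i j \<in> carrier R"
  shows "(\<Oplus>i\<in>I. \<Oplus>j\<in>J. f i j) = (\<Oplus>j\<in>J. \<Oplus>i\<in>I. f i j)"
  using assms(1)
proof (induction I)
  case empty
  then show ?case by simp
next
  case (insert x I)
  then show ?case using assms
    by (simp add: Pi_def finsum_addf)
qed

lemma finsum_Sigma:
  assumes "finite I" "\<And>i. i \<in> I \<Longrightarrow> finite (J i)" "\<And>p. f p \<in> carrier R"
  shows "(\<Oplus>p\<in>Sigma I J. f p) = (\<Oplus>i\<in>I. \<Oplus>j\<in>J i. f (i, j))"
  using assms(1,2)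
proof (induction I)
  case empty
  then show ?case by simp
next
  case (insert x I)
  have eq: "Sigma (insert x I) J = Pair x ` J x \<union> Sigma I J" by auto
  have "(\<Oplus>p\<in>Sigma (insert x I) J. f p) = (\<Oplus>p\<in>Pair x ` J x. f p) \<oplus> (\<Oplus>p\<in>Sigma I J. f p)"
    unfolding eq using insert assms(3)
    by (intro finsum_Un_disjoint) auto
  also have "(\<Oplus>p\<in>Pair x ` J x. f p) = (\<Oplus>j\<in>J x. f (x, j))"
    using assms(3) by (intro finsum_reindex) (auto intro: inj_onI)
  finally show ?case
    using insert assms(3) by (simp add: Pi_def)
qed

lemma finsum_bij:
  assumes "bij_betw h A B" "\<And>x. f x \<in> carrier R"
  shows "(\<Oplus>x\<in>B. f x) = (\<Oplus>x\<in>A. f (h x))"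
  using finsum_reindex[of f h A] assms by (auto simp: bij_betw_def)

lemma finsum_mult_left:
  assumes "a \<in> carrier R" "\<And>x. f x \<in> carrier R"
  shows "a \<otimes> (\<Oplus>x\<in>A. f x) = (\<Oplus>x\<in>A. a \<otimes> f x)"
proof (cases "finite A")
  case True
  then show ?thesis using assms finsum_rdistr[of A a f] by auto
qed (use assms in auto)

lemma finsum_mult_right:
  assumes "a \<in> carrier R" "\<And>x. f x \<in> carrier R"
  shows "(\<Oplus>x\<in>A. f x) \<otimes> a = (\<Oplus>x\<in>A. f x \<otimes> a)"
proof (cases "finite A")
  case True
  then show ?thesis using assms finsum_ldistr[of A a f] by auto
qed (use assms in auto)

lemma finsum_diff:
  assumes "\<And>x. f x \<in> carrier R" "\<And>x. g x \<in> carrier R"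
  shows "(\<Oplus>x\<in>A. f x \<ominus> g x) = (\<Oplus>x\<in>A. f x) \<ominus> (\<Oplus>x\<in>A. g x)"
proof (induction A rule: infinite_finite_induct)
  case (insert x F)
  have [simp]: "finsum R f F \<in> carrier R" "finsum R g F \<in> carrier R"
    using assms by (auto intro!: finsum_closed)
  have "finsum R (\<lambda>x. f x \<ominus> g x) (insert x F) = (f x \<ominus> g x) \<oplus> (finsum R f F \<ominus> finsum R g F)"
    using insert assms by (simp add: Pi_def)
  also have "\<dots> = (f x \<oplus> finsum R f F) \<ominus> (g x \<oplus> finsum R g F)"
    using assms[of x] by (simp add: a_minus_def minus_add a_ac)
  finally show ?case using insert assms by (simp add: Pi_def)
qed (simp_all add: a_minus_def)

lemma diff_eq_zeroD:
  assumes "\<zero> = x \<ominus> y" "x \<in> carrier R" "y \<in> carrier R"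
  shows "x = y"
proof -
  have "x = (x \<ominus> y) \<oplus> y" using assms(2,3) by algebra
  also have "\<dots> = y" unfolding assms(1)[symmetric] using assms(3) by simp
  finally show ?thesis .
qed

lemma finsum_support:
  assumes "finite A" "B \<subseteq> A" "\<And>x. f x \<in> carrier R" "\<And>x. x \<in> A - B \<Longrightarrow> f x = \<zero>"
  shows "(\<Oplus>x\<in>A. f x) = (\<Oplus>x\<in>B. f x)"
  by (rule add.finprod_mono_neutral_cong_right) (use assms in auto)

section \<open>Products, differences and tensor products of matrices\<close>

lemma mtx_mult_assoc:
  assumes "finite J" "finite L" "mtx A" "mtx B" "mtx C"
  shows "mtx_mult L (mtx_mult J A B) C i k = mtx_mult J A (mtx_mult L B C) i k"
proof -
  have "mtx_mult L (mtx_mult J A B) C i k = (\<Oplus>l\<in>L. \<Oplus>j\<in>J. A i j \<otimes> B j l \<otimes> C l k)"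
    unfolding mtx_mult_def using assms by (simp add: finsum_mult_right)
  also have "\<dots> = (\<Oplus>j\<in>J. \<Oplus>l\<in>L. A i j \<otimes> B j l \<otimes> C l k)"
    using assms by (intro finsum_swap) auto
  also have "\<dots> = mtx_mult J A (mtx_mult L B C) i k"
    unfolding mtx_mult_def using assms by (simp add: finsum_mult_left m_assoc)
  finally show ?thesis .
qed

lemma mtx_mult_one_right:
  assumes "finite J" "mtx M" "j \<in> J"
  shows "mtx_mult J M mtx_one i j = M i j"
proof -
  have "mtx_mult J M mtx_one i j = (\<Oplus>l\<in>J. if j = l then M i l else \<zero>)"
    unfolding mtx_mult_def mtx_one_def using assms by (intro finsum_cong') auto
  then show ?thesis
    using finsum_delta[of J j "M i"] assms by simp
qed

lemma mtx_mult_one_left: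
  assumes "finite J" "mtx M" "i \<in> J"
  shows "mtx_mult J mtx_one M i k = M i k"
proof -
  have "mtx_mult J mtx_one M i k = (\<Oplus>l\<in>J. if i = l then M l k else \<zero>)"
    unfolding mtx_mult_def mtx_one_def using assms by (intro finsum_cong') auto
  then show ?thesis
    using finsum_delta[of J i "\<lambda>l. M l k"] assms by simp
qed

lemma mtx_diff_mult:
  assumes "mtx A" "mtx B" "mtx C"
  shows "mtx_mult J (mtx_diff A B) C i k = mtx_diff (mtx_mult J A C) (mtx_mult J B C) i k"
proof -
  have "mtx_mult J (mtx_diff A B) C i k = (\<Oplus>j\<in>J. A i j \<otimes> C j k \<ominus> B i j \<otimes> C j k)"
    unfolding mtx_mult_def mtx_diff_def using assms
    by (simp add: l_minus l_distr a_minus_def)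
  then show "mtx_mult J (mtx_diff A B) C i k = mtx_diff (mtx_mult J A C) (mtx_mult J B C) i k"
    unfolding mtx_mult_def mtx_diff_def using assms by (simp add: finsum_diff)
qed

lemma mtx_mult_tensor:
  assumes "finite J" "finite L" "mtx A" "mtx B" "mtx C" "mtx D"
  shows "mtx_mult (J \<times> L) (mtx_tensor A B) (mtx_tensor C D) p q =
    mtx_tensor (mtx_mult J A C) (mtx_mult L B D) p q"
proof -
  have "mtx_mult (J \<times> L) (mtx_tensor A B) (mtx_tensor C D) p q =
    (\<Oplus>j\<in>J. \<Oplus>l\<in>L. A (fst p) j \<otimes> B (snd p) l \<otimes> (C j (fst q) \<otimes> D l (snd q)))"
    unfolding mtx_mult_def mtx_tensor_def using assms by (subst finsum_Sigma) auto
  also have "\<dots> = (\<Oplus>j\<in>J. \<Oplus>l\<in>L. A (fst p) j \<otimes> C j (fst q) \<otimes> (B (snd p) l \<otimes> D l (snd q)))"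
    using assms by (intro finsum_cong' refl) (auto intro!: finsum_closed simp: m_ac)
  also have "\<dots> = (\<Oplus>j\<in>J. A (fst p) j \<otimes> C j (fst q) \<otimes> (\<Oplus>l\<in>L. B (snd p) l \<otimes> D l (snd q)))"
    using assms by (simp add: finsum_mult_left)
  also have "\<dots> = mtx_tensor (mtx_mult J A C) (mtx_mult L B D) p q"
    unfolding mtx_mult_def mtx_tensor_def using assms
    by (subst finsum_mult_right) (auto intro!: finsum_closed)
  finally show ?thesis .
qed

lemma mtx_tensor_diff:
  fixes A B :: "'i \<Rightarrow> 'j \<Rightarrow> 'a" and C :: "'k \<Rightarrow> 'l \<Rightarrow> 'a"
  assumes "mtx A" "mtx B" "mtx C"
  shows "mtx_tensor (mtx_diff A B) C = mtx_diff (mtx_tensor A C) (mtx_tensor B C)"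
    and "mtx_tensor C (mtx_diff A B) = mtx_diff (mtx_tensor C A) (mtx_tensor C B)"
  unfolding mtx_tensor_def mtx_diff_def using assms
  by (simp_all add: fun_eq_iff l_distr r_distr a_minus_def l_minus r_minus)

section \<open>Rank through factorizations: reindexing, sums, tensor products, column blocks\<close>

lemma rank_leI:
  assumes "finite L" "mtx U" "mtx V" "\<And>i j. i \<in> I \<Longrightarrow> j \<in> J \<Longrightarrow> M i j = mtx_mult L U V i j"
  shows "rank_le I J (card L) M"
proof -
  \<comment> \<open>Renumbering the inner index set once and for all lets later proofs factor
    through disjoint unions and products.\<close>
  obtain h where h: "bij_betw h {..<card L} L"
    using assms(1) bij_betw_from_nat_into_finite by blast
  show ?thesis unfolding rank_le_def
  proof (intro exI conjI ballI)
    show "mtx (\<lambda>i l. U i (h l))" "mtx (\<lambda>l j. V (h l) j)"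
      using assms by (auto simp: mtx_def)
    show "M i j = mtx_mult {..<card L} (\<lambda>i l. U i (h l)) (\<lambda>l j. V (h l) j) i j"
      if "i \<in> I" "j \<in> J" for i j
      using assms that finsum_bij[OF h, of "\<lambda>l. U i l \<otimes> V l j"] by (simp add: mtx_mult_def)
  qed
qed

lemma rank_le_mono:
  assumes "rank_le I J r M" "r \<le> s"
  shows "rank_le I J s M"
proof -
  obtain U V where UV: "mtx (U :: _ \<Rightarrow> nat \<Rightarrow> _)" "mtx V"
    "\<And>i j. i \<in> I \<Longrightarrow> j \<in> J \<Longrightarrow> M i j = mtx_mult {..<r} U V i j"
    using assms unfolding rank_le_def by blast
  \<comment> \<open>Padding: the additional columns of the left factor are zero, so the additional
    rows of \<open>V\<close> do not contribute.\<close>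
  define U' where "U' = (\<lambda>i l. if l < r then U i l else \<zero>)"
  have U': "mtx U'" using UV by (auto simp: U'_def mtx_def)
  have "mtx_mult {..<s} U' V i j = mtx_mult {..<r} U V i j" for i j
  proof -
    have "mtx_mult {..<s} U' V i j = mtx_mult {..<r} U' V i j"
      unfolding mtx_mult_def using assms(2) UV U'
      by (intro finsum_support) (auto simp: U'_def)
    also have "\<dots> = mtx_mult {..<r} U V i j"
      unfolding mtx_mult_def using UV by (intro finsum_cong') (auto simp: U'_def)
    finally show ?thesis .
  qed
  with UV U' show ?thesis unfolding rank_le_def by metis
qed

lemma rank_le_card:
  assumes "finite J" "mtx M"
  shows "rank_le I J (card J) M"
  by (rule rank_leI[where U = M and V = mtx_one]) (use assms in \<open>simp_all add: mtx_mult_one_right\<close>)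

text \<open>The set of admissible lengths is nonempty, because \<open>M\<close> factors as
  \<open>M\<close> times the identity, and it is upward closed by \<open>rank_le_mono\<close>; so
  its least element describes it completely.\<close>

lemma rank_le_iff:
  assumes "finite J" "mtx M"
  shows "rank_le I J r M \<longleftrightarrow> mtx_rank I J M \<le> r"
  unfolding mtx_rank_def
  using LeastI[of "\<lambda>r. rank_le I J r M", OF rank_le_card[OF assms]]
    rank_le_mono Least_le[of "\<lambda>r. rank_le I J r M" r] by metis

lemma rank_le_cong:
  assumes "\<And>i j. i \<in> I \<Longrightarrow> j \<in> J \<Longrightarrow> M i j = N i j"
  shows "rank_le I J r M \<longleftrightarrow> rank_le I J r N"
  unfolding rank_le_def using assms by auto

lemma mtx_rank_cong:
  assumes "\<And>i j. i \<in> I \<Longrightarrow> j \<in> J \<Longrightarrow> M i j = N i j"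
  shows "mtx_rank I J M = mtx_rank I J N"
  unfolding mtx_rank_def using rank_le_cong[of I J M N] assms by simp

lemma rank_le_subset:
  "rank_le I J r M \<Longrightarrow> I' \<subseteq> I \<Longrightarrow> J' \<subseteq> J \<Longrightarrow> rank_le I' J' r M"
  unfolding rank_le_def by (meson subsetD)

lemma rank_le_reindex:
  assumes "rank_le I J r M" and sub: "f ` I' \<subseteq> I" "g ` J' \<subseteq> J"
  shows "rank_le I' J' r (\<lambda>i j. M (f i) (g j))"
proof -
  obtain U V where UV: "mtx (U :: _ \<Rightarrow> nat \<Rightarrow> _)" "mtx V"
    "\<And>i j. i \<in> I \<Longrightarrow> j \<in> J \<Longrightarrow> M i j = mtx_mult {..<r} U V i j"
    using assms unfolding rank_le_def by blast
  show ?thesis unfolding rank_le_def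
    by (rule exI[of _ "\<lambda>i. U (f i)"], rule exI[of _ "\<lambda>l j. V l (g j)"])
      (use UV sub in \<open>auto simp: mtx_mult_def image_subset_iff mtx_def\<close>)
qed

lemma mtx_rank_reindex:
  assumes "bij_betw f I' I" "bij_betw g J' J" "finite J'" "mtx M"
  shows "mtx_rank I' J' (\<lambda>i j. M (f i) (g j)) = mtx_rank I J M"
proof (rule antisym)
  have J: "finite J" using assms bij_betw_finite by blast
  have M': "mtx (\<lambda>i j. M (f i) (g j))" using assms by (simp add: mtx_def)
  show "mtx_rank I' J' (\<lambda>i j. M (f i) (g j)) \<le> mtx_rank I J M"
    using rank_le_reindex[of I J "mtx_rank I J M" M f I' g J'] rank_le_iff[OF J assms(4)]
      rank_le_iff[OF assms(3) M'] assms by (auto simp: bij_betw_def)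
  have "rank_le I J (mtx_rank I' J' (\<lambda>i j. M (f i) (g j)))
      (\<lambda>i j. M (f (inv_into I' f i)) (g (inv_into J' g j)))"
  proof (rule rank_le_reindex[of I' J' _ "\<lambda>i j. M (f i) (g j)" "inv_into I' f" I "inv_into J' g" J])
    show "rank_le I' J' (mtx_rank I' J' (\<lambda>i j. M (f i) (g j))) (\<lambda>i j. M (f i) (g j))"
      using rank_le_iff[OF assms(3) M'] by blast
    show "inv_into I' f ` I \<subseteq> I'" "inv_into J' g ` J \<subseteq> J'"
      using assms(1,2) by (auto simp: bij_betw_def intro: inv_into_into)
  qed
  then have "rank_le I J (mtx_rank I' J' (\<lambda>i j. M (f i) (g j))) M"
    by (rule rank_le_cong[THEN iffD1, rotated])
      (use assms in \<open>simp add: bij_betw_inv_into_right\<close>)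
  then show "mtx_rank I J M \<le> mtx_rank I' J' (\<lambda>i j. M (f i) (g j))"
    using rank_le_iff[OF J assms(4)] by simp
qed

lemma mtx_rank_le_card: "finite J \<Longrightarrow> mtx M \<Longrightarrow> mtx_rank I J M \<le> card J"
  using rank_le_iff rank_le_card by blast

lemma rank_factor:
  assumes "finite J" "mtx M"
  obtains U V where "mtx (U :: 'i \<Rightarrow> nat \<Rightarrow> 'a)" "mtx (V :: nat \<Rightarrow> 'j \<Rightarrow> 'a)"
    "\<And>i j. i \<in> I \<Longrightarrow> j \<in> J \<Longrightarrow> M i j = mtx_mult {..<mtx_rank I J M} U V i j"
  using rank_le_iff[OF assms, of I "mtx_rank I J M"] unfolding rank_le_def by blast

text \<open>The factors of \<open>M\<close> and \<open>N\<close> are put side by side and on top of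
  each other, with the disjoint union of the two inner index sets as the new one.\<close>

lemma mtx_rank_add:
  assumes J: "finite J" and M: "mtx M" "mtx N" "mtx P"
    and eq: "\<And>i j. i \<in> I \<Longrightarrow> j \<in> J \<Longrightarrow> P i j = M i j \<oplus> N i j"
  shows "mtx_rank I J P \<le> mtx_rank I J M + mtx_rank I J N"
proof -
  obtain U V where UV: "mtx (U :: _ \<Rightarrow> nat \<Rightarrow> _)" "mtx V"
    "\<And>i j. i \<in> I \<Longrightarrow> j \<in> J \<Longrightarrow> M i j = mtx_mult {..<mtx_rank I J M} U V i j"
    using rank_factor[OF J M(1)] by metis
  obtain U' V' where UV': "mtx (U' :: _ \<Rightarrow> nat \<Rightarrow> _)" "mtx V'"
    "\<And>i j. i \<in> I \<Longrightarrow> j \<in> J \<Longrightarrow> N i j = mtx_mult {..<mtx_rank I J N} U' V' i j"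
    using rank_factor[OF J M(2)] by metis
  define A where "A = {..<mtx_rank I J M}"
  define B where "B = {..<mtx_rank I J N}"
  define U2 where "U2 = (\<lambda>i. case_sum (U i) (U' i))"
  define V2 where "V2 = (\<lambda>l j. case_sum (\<lambda>l. V l j) (\<lambda>l. V' l j) l)"
  have U2: "mtx U2" "mtx V2"
    using UV UV' by (auto simp: U2_def V2_def mtx_def split: sum.split)
  have "mtx_mult (A <+> B) U2 V2 i j = mtx_mult A U V i j \<oplus> mtx_mult B U' V' i j" for i j
  proof -
    have "mtx_mult (A <+> B) U2 V2 i j =
      (\<Oplus>l\<in>Inl ` A. U2 i l \<otimes> V2 l j) \<oplus> (\<Oplus>l\<in>Inr ` B. U2 i l \<otimes> V2 l j)"
      unfolding mtx_mult_def Plus_def using U2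
      by (intro finsum_Un_disjoint) (auto simp: A_def B_def)
    also have "(\<Oplus>l\<in>Inl ` A. U2 i l \<otimes> V2 l j) = mtx_mult A U V i j"
      unfolding mtx_mult_def using mtxD[OF U2(1)] mtxD[OF U2(2)]
      by (subst finsum_reindex) (simp_all add: U2_def V2_def inj_on_def Pi_def)
    also have "(\<Oplus>l\<in>Inr ` B. U2 i l \<otimes> V2 l j) = mtx_mult B U' V' i j"
      unfolding mtx_mult_def using mtxD[OF U2(1)] mtxD[OF U2(2)]
      by (subst finsum_reindex) (simp_all add: U2_def V2_def inj_on_def Pi_def)
    finally show ?thesis .
  qed
  then have "rank_le I J (card (A <+> B)) P"
    by (intro rank_leI[OF _ U2]) (simp_all add: A_def B_def eq UV(3) UV'(3))
  then show ?thesis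
    using rank_le_iff[OF J M(3)] by (simp add: A_def B_def card_Plus)
qed

lemma mtx_rank_diff_triangle:
  assumes "finite J" "mtx M" "mtx N" "mtx P"
  shows "mtx_rank I J (mtx_diff M P) \<le> mtx_rank I J (mtx_diff M N) + mtx_rank I J (mtx_diff N P)"
proof (rule mtx_rank_add)
  fix i j
  have "M i j \<in> carrier R" "N i j \<in> carrier R" "P i j \<in> carrier R" using assms by auto
  then show "mtx_diff M P i j = mtx_diff M N i j \<oplus> mtx_diff N P i j"
    unfolding mtx_diff_def by algebra
qed (use assms in auto)

text \<open>By the mixed product rule a factorization \<open>U V\<close> of \<open>M\<close> gives
  the factorization of \<open>M \<otimes> N\<close> into \<open>U \<otimes> N\<close> and
  \<open>V \<otimes> 1\<close>; symmetrically for \<open>N\<close>.\<close>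

lemma mtx_rank_tensor_le:
  fixes M :: "'i \<Rightarrow> 'j \<Rightarrow> 'a" and N :: "'k \<Rightarrow> 'l \<Rightarrow> 'a"
  assumes "finite J" "finite L" "mtx M" "mtx N"
  shows "mtx_rank (I \<times> K) (J \<times> L) (mtx_tensor M N) \<le> mtx_rank I J M * card L"
    and "mtx_rank (I \<times> K) (J \<times> L) (mtx_tensor M N) \<le> card J * mtx_rank K L N"
proof -
  obtain U V where UV: "mtx (U :: _ \<Rightarrow> nat \<Rightarrow> _)" "mtx V"
    "\<And>i j. i \<in> I \<Longrightarrow> j \<in> J \<Longrightarrow> M i j = mtx_mult {..<mtx_rank I J M} U V i j"
    using rank_factor[OF assms(1,3)] by metis
  have "rank_le (I \<times> K) (J \<times> L) (card ({..<mtx_rank I J M} \<times> L)) (mtx_tensor M N)"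
  proof (rule rank_leI[where U = "mtx_tensor U N" and V = "mtx_tensor V mtx_one"])
    fix p q assume "p \<in> I \<times> K" "q \<in> J \<times> L"
    then show "mtx_tensor M N p q =
        mtx_mult ({..<mtx_rank I J M} \<times> L) (mtx_tensor U N) (mtx_tensor V mtx_one) p q"
      using assms UV mtx_mult_one_right[of L N]
      by (subst mtx_mult_tensor) (auto simp: mtx_tensor_def)
  qed (use assms UV in auto)
  then show "mtx_rank (I \<times> K) (J \<times> L) (mtx_tensor M N) \<le> mtx_rank I J M * card L"
    using rank_le_iff[of "J \<times> L" "mtx_tensor M N"] assms by (simp add: card_cartesian_product)
next
  obtain U V where UV: "mtx (U :: _ \<Rightarrow> nat \<Rightarrow> _)" "mtx V"
    "\<And>i j. i \<in> K \<Longrightarrow> j \<in> L \<Longrightarrow> N i j = mtx_mult {..<mtx_rank K L N} U V i j"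
    using rank_factor[OF assms(2,4)] by metis
  have "rank_le (I \<times> K) (J \<times> L) (card (J \<times> {..<mtx_rank K L N})) (mtx_tensor M N)"
  proof (rule rank_leI[where U = "mtx_tensor M U" and V = "mtx_tensor mtx_one V"])
    fix p q assume "p \<in> I \<times> K" "q \<in> J \<times> L"
    then show "mtx_tensor M N p q =
        mtx_mult (J \<times> {..<mtx_rank K L N}) (mtx_tensor M U) (mtx_tensor mtx_one V) p q"
      using assms UV mtx_mult_one_right[of J M]
      by (subst mtx_mult_tensor) (auto simp: mtx_tensor_def)
  qed (use assms UV in auto)
  then show "mtx_rank (I \<times> K) (J \<times> L) (mtx_tensor M N) \<le> card J * mtx_rank K L N"
    using rank_le_iff[of "J \<times> L" "mtx_tensor M N"] assms by (simp add: card_cartesian_product)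
qed

lemma mtx_rank_column_blocks:
  assumes fin: "finite A" "\<And>s. s \<in> A \<Longrightarrow> finite (J s)" and M: "mtx M"
    and disj: "\<And>s t. s \<in> A \<Longrightarrow> t \<in> A \<Longrightarrow> s \<noteq> t \<Longrightarrow> J s \<inter> J t = {}"
  shows "mtx_rank I (\<Union>s\<in>A. J s) M \<le> (\<Sum>s\<in>A. mtx_rank I (J s) M)"
proof -
  define r where "r s = mtx_rank I (J s) M" for s
  have "\<forall>s\<in>A. \<exists>U V. mtx (U :: _ \<Rightarrow> nat \<Rightarrow> _) \<and> mtx V \<and>
    (\<forall>i\<in>I. \<forall>j\<in>J s. M i j = mtx_mult {..<r s} U V i j)"
    unfolding r_def using rank_factor[OF fin(2) M] by metis
  then obtain U V where UV: "\<And>s. s \<in> A \<Longrightarrow> mtx (U s :: _ \<Rightarrow> nat \<Rightarrow> _)" "\<And>s. s \<in> A \<Longrightarrow> mtx (V s)"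
    "\<And>s i j. s \<in> A \<Longrightarrow> i \<in> I \<Longrightarrow> j \<in> J s \<Longrightarrow> M i j = mtx_mult {..<r s} (U s) (V s) i j"
    by metis
  define U' where "U' = (\<lambda>i p. if fst p \<in> A then U (fst p) i (snd p) else \<zero>)"
  \<comment> \<open>The inner index is a pair of a block and a position in its factorization.
    Setting \<open>V'\<close> to zero when the column is not in that block makes every column see
    only its own factorization.\<close>
  define V' where "V' = (\<lambda>p j. if fst p \<in> A \<and> j \<in> J (fst p) then V (fst p) (snd p) j else \<zero>)"
  have U': "mtx U'" "mtx V'" using UV by (auto simp: U'_def V'_def mtx_def)
  have "rank_le I (\<Union>s\<in>A. J s) (card (SIGMA s:A. {..<r s})) M"
  proof (rule rank_leI[OF _ U'])
    fix i j assume i: "i \<in> I" and "j \<in> (\<Union>s\<in>A. J s)"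
    then obtain s where s: "s \<in> A" "j \<in> J s" by auto
    have "mtx_mult (SIGMA s:A. {..<r s}) U' V' i j = (\<Oplus>t\<in>A. \<Oplus>l\<in>{..<r t}. U' i (t, l) \<otimes> V' (t, l) j)"
      unfolding mtx_mult_def using fin U' by (intro finsum_Sigma) auto
    also have "\<dots> = (\<Oplus>t\<in>A. if s = t then (\<Oplus>l\<in>{..<r t}. U' i (t, l) \<otimes> V' (t, l) j) else \<zero>)"
    proof (rule finsum_cong')
      fix t assume "t \<in> A"
      show "(\<Oplus>l\<in>{..<r t}. U' i (t, l) \<otimes> V' (t, l) j) =
        (if s = t then (\<Oplus>l\<in>{..<r t}. U' i (t, l) \<otimes> V' (t, l) j) else \<zero>)"
      proof (cases "s = t")
        case False
        then have "V' (t, l) j = \<zero>" for l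
          using disj[of s t] s \<open>t \<in> A\<close> by (auto simp: V'_def)
        then show ?thesis using U' False by (simp)
      qed simp
    qed (use U' in \<open>auto intro!: finsum_closed\<close>)
    also have "\<dots> = (\<Oplus>l\<in>{..<r s}. U' i (s, l) \<otimes> V' (s, l) j)"
      using fin s U' by (intro finsum_delta) (auto intro!: finsum_closed)
    also have "\<dots> = M i j"
      using UV(3)[OF s(1) i s(2)] s by (simp add: U'_def V'_def mtx_mult_def)
    finally show "M i j = mtx_mult (SIGMA s:A. {..<r s}) U' V' i j" ..
  qed (use fin in auto)
  moreover have "finite (\<Union>s\<in>A. J s)" using fin by auto
  ultimately show ?thesis using rank_le_iff[OF _ M] fin by (simp add: r_def)
qed

section \<open>Linear systems and independent columns: lower bounds for the rank\<close>

lemma homogeneous_system: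
  assumes "finite L" "finite J" "card L < card J" "mtx V"
  shows "\<exists>a. (\<forall>j. a j \<in> carrier R) \<and> (\<exists>j\<in>J. a j \<noteq> \<zero>) \<and> (\<forall>l\<in>L. (\<Oplus>j\<in>J. V l j \<otimes> a j) = \<zero>)"
  using assms
\<comment> \<open>Gaussian elimination: an equation with a nonzero coefficient is solved for one
  unknown, which leaves one equation and one unknown less.\<close>
proof (induction L arbitrary: V J)
  case empty
  then show ?case by (intro exI[of _ "\<lambda>_. \<one>"]) (auto simp: card_gt_0_iff)
next
  case (insert l L)
  show ?case
  proof (cases "\<forall>j\<in>J. V l j = \<zero>")
    case True
    have "card L < card J" using insert by simp
    then obtain a where a: "\<forall>j. a j \<in> carrier R" "\<exists>j\<in>J. a j \<noteq> \<zero>" "\<forall>l\<in>L. (\<Oplus>j\<in>J. V l j \<otimes> a j) = \<zero>"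
      using insert.IH[of J V] insert.prems by blast
    have "(\<Oplus>j\<in>J. V l j \<otimes> a j) = \<zero>"
      using a True by (intro add.finprod_one_eqI) auto
    then show ?thesis using a by blast
  next
    case False
    then obtain j0 where j0: "j0 \<in> J" "V l j0 \<noteq> \<zero>" by blast
    define p where "p = inv (V l j0)"
    have p: "p \<in> carrier R" "V l j0 \<otimes> p = \<one>"
      using j0 insert.prems(3) field_Units by (auto simp: p_def)
    define J' where "J' = J - {j0}"
    have J': "finite J'" "card L < card J'" "J = insert j0 J'" "j0 \<notin> J'"
      using insert j0 by (auto simp: J'_def)
    \<comment> \<open>The system after elimination of \<open>j0\<close>: from equation
      \<open>q\<close> the multiple of equation \<open>l\<close> is subtracted that cancels the
      coefficient at \<open>j0\<close>.\<close>
    define W where "W = (\<lambda>q j. V q j \<ominus> V q j0 \<otimes> p \<otimes> V l j)"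
    have W: "mtx W" using insert.prems p by (simp add: W_def mtx_def)
    obtain a where a: "\<And>j. a j \<in> carrier R" "\<exists>j\<in>J'. a j \<noteq> \<zero>" "\<And>q. q\<in>L \<Longrightarrow> (\<Oplus>j\<in>J'. W q j \<otimes> a j) = \<zero>"
      using insert.IH[OF J'(1,2) W] by blast
    define T where "T = (\<Oplus>j\<in>J'. V l j \<otimes> a j)"
    have T: "T \<in> carrier R" using insert.prems a by (auto simp: T_def intro!: finsum_closed)
    \<comment> \<open>The value at the eliminated unknown is the one forced by equation
      \<open>l\<close>.\<close>
    define b where "b = (\<lambda>j. if j = j0 then \<ominus> (p \<otimes> T) else a j)"
    have b: "b j \<in> carrier R" for j using a p T by (simp add: b_def)
    have sum: "(\<Oplus>j\<in>J. V q j \<otimes> b j) = \<ominus> (V q j0 \<otimes> (p \<otimes> T)) \<oplus> (\<Oplus>j\<in>J'. V q j \<otimes> a j)" for q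
    proof -
      have "(\<Oplus>j\<in>J. V q j \<otimes> b j) = V q j0 \<otimes> b j0 \<oplus> (\<Oplus>j\<in>J'. V q j \<otimes> b j)"
        using J' insert.prems b by simp
      also have "(\<Oplus>j\<in>J'. V q j \<otimes> b j) = (\<Oplus>j\<in>J'. V q j \<otimes> a j)"
        using J' insert.prems a by (intro finsum_cong') (auto simp: b_def)
      finally show ?thesis using p T insert.prems by (simp add: b_def r_minus)
    qed
    have "(\<Oplus>j\<in>J. V q j \<otimes> b j) = \<zero>" if q: "q \<in> insert l L" for q
    proof (cases "q = l")
      case True
      have "V l j0 \<otimes> (p \<otimes> T) = T" using p T insert.prems by (simp add: m_assoc[symmetric])
      then show ?thesis unfolding sum True T_def[symmetric] using T by (simp add: l_neg)
    next
      case False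
      have c: "V q j0 \<otimes> p \<in> carrier R" using p insert.prems by simp
      have "\<zero> = (\<Oplus>j\<in>J'. V q j \<otimes> a j \<ominus> V q j0 \<otimes> p \<otimes> (V l j \<otimes> a j))"
        using a(3)[of q] False q p insert.prems a(1)
        by (simp add: W_def a_minus_def l_distr l_minus m_assoc)
      also have "\<dots> = (\<Oplus>j\<in>J'. V q j \<otimes> a j) \<ominus> V q j0 \<otimes> p \<otimes> T"
        unfolding T_def using a(1) insert.prems p c
        by (simp add: finsum_diff finsum_mult_left)
      finally have "(\<Oplus>j\<in>J'. V q j \<otimes> a j) = V q j0 \<otimes> (p \<otimes> T)"
        using diff_eq_zeroD[of "\<Oplus>j\<in>J'. V q j \<otimes> a j" "V q j0 \<otimes> p \<otimes> T"]
          insert.prems(3) a(1) T p c by (simp add: m_assoc finsum_closed Pi_def)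
      then show ?thesis unfolding sum using insert.prems p T by (simp add: l_neg)
    qed
    moreover have "\<exists>j\<in>J. b j \<noteq> \<zero>" using a(2) J' by (auto simp: b_def)
    ultimately show ?thesis using b by blast
  qed
qed

text \<open>If \<open>r\<close> were smaller than \<open>card J\<close>, the right factor of a
  factorization of length \<open>r\<close> would kill a nonzero vector, and then so would
  \<open>M\<close>.\<close>

lemma indep_columns_card_le:
  assumes "indep_columns I J M" "finite J" "mtx M" "rank_le I J r M"
  shows "card J \<le> r"
proof (rule ccontr)
  assume "\<not> card J \<le> r"
  then have r: "card {..<r} < card J" by simp
  obtain U V where UV: "mtx (U :: _ \<Rightarrow> nat \<Rightarrow> _)" "mtx V"
    "\<And>i j. i \<in> I \<Longrightarrow> j \<in> J \<Longrightarrow> M i j = mtx_mult {..<r} U V i j"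
    using assms unfolding rank_le_def by blast
  obtain a where a: "\<And>j. a j \<in> carrier R" "\<exists>j\<in>J. a j \<noteq> \<zero>" "\<And>l. l\<in>{..<r} \<Longrightarrow> (\<Oplus>j\<in>J. V l j \<otimes> a j) = \<zero>"
    using homogeneous_system[OF _ assms(2) r UV(2)] by blast
  have "(\<Oplus>j\<in>J. M i j \<otimes> a j) = \<zero>" if i: "i \<in> I" for i
  proof -
    have "(\<Oplus>j\<in>J. M i j \<otimes> a j) = mtx_mult J (mtx_mult {..<r} U V) (\<lambda>j _. a j) i ()"
      unfolding mtx_mult_def[of J] using UV i a by (intro finsum_cong') auto
    also have "\<dots> = mtx_mult {..<r} U (mtx_mult J V (\<lambda>j _. a j)) i ()"
      using UV assms a by (intro mtx_mult_assoc) (auto simp: mtx_def)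
    also have "\<dots> = \<zero>"
      unfolding mtx_mult_def using UV(1) a by (intro add.finprod_one_eqI) auto
    finally show ?thesis .
  qed
  then show False using assms(1) a unfolding indep_columns_def by blast
qed

lemma indep_columns_le_rank:
  assumes "indep_columns I J' M" "J' \<subseteq> J" "finite J" "mtx M"
  shows "card J' \<le> mtx_rank I J M"
  using indep_columns_card_le[OF assms(1)] rank_le_subset[of I J "mtx_rank I J M" M I J']
    rank_le_iff[OF assms(3,4)] assms finite_subset by blast

text \<open>An independent set of columns of greatest size spans every column, so \<open>M\<close>
  factors through it; the size is then an upper bound for the rank, and by independence also a lower
  bound. Here factorization rank and column rank meet.\<close>

lemma maximal_indep_columns:
  assumes J: "finite J" and M: "mtx M"
  obtains J' V where "J' \<subseteq> J" "indep_columns I J' M" "mtx V"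
    "\<And>i j. i \<in> I \<Longrightarrow> j \<in> J \<Longrightarrow> M i j = mtx_mult J' M V i j" "card J' = mtx_rank I J M"
proof -
  define Q where "Q J' \<longleftrightarrow> J' \<subseteq> J \<and> indep_columns I J' M" for J'
  have "Q {}" by (simp add: Q_def indep_columns_def)
  moreover have "\<forall>J'. Q J' \<longrightarrow> card J' < Suc (card J)"
    using J by (auto simp: Q_def less_Suc_eq_le card_mono)
  ultimately obtain J' where J': "Q J'" "\<And>J''. Q J'' \<Longrightarrow> card J'' \<le> card J'"
    using ex_has_greatest_nat[of Q "{}" card] by (metis less_imp_le_nat)
  have sub: "J' \<subseteq> J" and ind: "indep_columns I J' M" using J' by (auto simp: Q_def)
  have fin: "finite J'" using sub J finite_subset by blast
  have "\<exists>v. (\<forall>l. v l \<in> carrier R) \<and> (\<forall>i\<in>I. M i j = (\<Oplus>l\<in>J'. M i l \<otimes> v l))" if j: "j \<in> J" for j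
  proof (cases "j \<in> J'")
    case True
    show ?thesis
      by (rule exI[of _ "\<lambda>l. mtx_one l j"])
        (use mtx_mult_one_right[OF fin M True] in \<open>auto simp: mtx_mult_def\<close>)
  next
    case False
    have "\<not> Q (insert j J')" using J'(2)[of "insert j J'"] False fin by auto
    then obtain a where a: "\<And>j. a j \<in> carrier R" "\<And>i. i\<in>I \<Longrightarrow> (\<Oplus>l\<in>insert j J'. M i l \<otimes> a l) = \<zero>"
      "\<exists>l\<in>insert j J'. a l \<noteq> \<zero>"
      using j sub unfolding Q_def indep_columns_def by auto
    have split: "M i j \<otimes> a j \<oplus> (\<Oplus>l\<in>J'. M i l \<otimes> a l) = \<zero>" if "i \<in> I" for i
      using a(2)[OF that] False fin M a(1) by simp
    \<comment> \<open>Otherwise the relation would already hold among the columns in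
      \<open>J'\<close>, and all its coefficients would vanish.\<close>
    have "a j \<noteq> \<zero>"
    proof
      assume 0: "a j = \<zero>"
      have "(\<Oplus>l\<in>J'. M i l \<otimes> a l) \<in> carrier R" for i using M a by (auto intro!: finsum_closed)
      then have "\<forall>i\<in>I. (\<Oplus>l\<in>J'. M i l \<otimes> a l) = \<zero>" using split 0 M by auto
      then have "\<forall>l\<in>J'. a l = \<zero>" using ind a(1) unfolding indep_columns_def by blast
      then show False using a(3) 0 by auto
    qed
    define p where "p = inv (a j)"
    have p: "p \<in> carrier R" "a j \<otimes> p = \<one>"
      using \<open>a j \<noteq> \<zero>\<close> a(1) field_Units by (auto simp: p_def)
    have "M i j = (\<Oplus>l\<in>J'. M i l \<otimes> (\<ominus> (a l \<otimes> p)))" if i: "i \<in> I" for i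
    proof -
      define T where "T = (\<Oplus>l\<in>J'. M i l \<otimes> a l)"
      have T: "T \<in> carrier R" using M a by (auto intro!: finsum_closed simp: T_def)
      have "M i j \<otimes> a j = \<ominus> T"
        using split[OF i] T M a(1) unfolding T_def by (metis minus_equality m_closed mtxD)
      then have "M i j = T \<otimes> (\<ominus> p)"
        using p T M a(1) by (metis l_minus m_assoc mtxD r_minus r_one)
      also have "\<dots> = (\<Oplus>l\<in>J'. M i l \<otimes> a l \<otimes> (\<ominus> p))"
        unfolding T_def using p M a(1) by (intro finsum_mult_right) auto
      finally show ?thesis using p M a(1) by (simp add: m_assoc r_minus)
    qed
    then show ?thesis using p a(1) by (intro exI[of _ "\<lambda>l. \<ominus> (a l \<otimes> p)"]) auto
  qed
  then obtain v where v: "\<And>j l. j \<in> J \<Longrightarrow> v j l \<in> carrier R"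
    "\<And>i j. j \<in> J \<Longrightarrow> i \<in> I \<Longrightarrow> M i j = (\<Oplus>l\<in>J'. M i l \<otimes> v j l)" by metis
  define V where "V = (\<lambda>l j. if j \<in> J then v j l else \<zero>)"
  have V: "mtx V" using v by (auto simp: V_def mtx_def)
  have fact: "M i j = mtx_mult J' M V i j" if "i \<in> I" "j \<in> J" for i j
    using v(2)[of j i] that by (simp add: mtx_mult_def V_def)
  then have "mtx_rank I J M \<le> card J'"
    using rank_leI[OF fin M V, of I J M] rank_le_iff[OF J M] by blast
  moreover have "card J' \<le> mtx_rank I J M"
    by (rule indep_columns_le_rank[OF ind sub J M])
  ultimately show ?thesis using that[OF sub ind V fact] by simp
qed

text \<open>Maximal independent columns of the single blocks stay independent together: on the rows
  \<open>I s\<close> the columns chosen in other blocks vanish, so every relation restricts to one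
  inside block \<open>s\<close>. Rows and columns outside the blocks may contribute further rank,
  hence an inequality.\<close>

lemma block_diagonal_rank:
  assumes A: "finite A" "\<And>s. s \<in> A \<Longrightarrow> finite (J s)" and M: "mtx M" and T: "finite T" "(\<Union>s\<in>A. J s) \<subseteq> T"
    and IK: "(\<Union>s\<in>A. I s) \<subseteq> K"
    and diag: "\<And>s t i j. s \<in> A \<Longrightarrow> t \<in> A \<Longrightarrow> s \<noteq> t \<Longrightarrow> i \<in> I s \<Longrightarrow> j \<in> J t \<Longrightarrow> M i j = \<zero>"
    and disj: "\<And>s t. s \<in> A \<Longrightarrow> t \<in> A \<Longrightarrow> s \<noteq> t \<Longrightarrow> J s \<inter> J t = {}"
  shows "(\<Sum>s\<in>A. mtx_rank (I s) (J s) M) \<le> mtx_rank K T M"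
proof -
  have "\<forall>s\<in>A. \<exists>B. B \<subseteq> J s \<and> indep_columns (I s) B M \<and> card B = mtx_rank (I s) (J s) M"
    using maximal_indep_columns[OF A(2) M] by metis
  then obtain B where B: "\<And>s. s \<in> A \<Longrightarrow> B s \<subseteq> J s" "\<And>s. s \<in> A \<Longrightarrow> indep_columns (I s) (B s) M"
    "\<And>s. s \<in> A \<Longrightarrow> card (B s) = mtx_rank (I s) (J s) M" by metis
  have finB: "\<And>s. s \<in> A \<Longrightarrow> finite (B s)" using A B finite_subset by metis
  have "indep_columns K (\<Union>s\<in>A. B s) M"
    unfolding indep_columns_def
  proof (intro allI impI ballI)
    fix a j assume a: "\<forall>j. a j \<in> carrier R" "\<forall>i\<in>K. (\<Oplus>j\<in>(\<Union>s\<in>A. B s). M i j \<otimes> a j) = \<zero>"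
      and j: "j \<in> (\<Union>s\<in>A. B s)"
    then obtain s where s: "s \<in> A" "j \<in> B s" by blast
    have "(\<Oplus>j\<in>B s. M i j \<otimes> a j) = \<zero>" if i: "i \<in> I s" for i
    proof -
      have "M i l = \<zero>" if "l \<in> (\<Union>s\<in>A. B s) - B s" for l
        using that diag[OF s(1) _ _ i] B(1) by auto
      then have "(\<Oplus>j\<in>(\<Union>s\<in>A. B s). M i j \<otimes> a j) = (\<Oplus>j\<in>B s. M i j \<otimes> a j)"
        using A(1) finB s a(1) M by (intro finsum_support) auto
      then show ?thesis using a(2) i s IK by auto
    qed
    then show "a j = \<zero>" using B(2)[OF s(1)] a(1) s(2) unfolding indep_columns_def by blast
  qed
  moreover have "(\<Union>s\<in>A. B s) \<subseteq> T" using B(1) T(2) by blast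
  ultimately have "card (\<Union>s\<in>A. B s) \<le> mtx_rank K T M"
    using indep_columns_le_rank T(1) M by blast
  also have "card (\<Union>s\<in>A. B s) = (\<Sum>s\<in>A. card (B s))"
    using A(1) finB disj B(1) by (intro card_UN_disjoint) blast+
  finally show ?thesis using B(3) by simp
qed

section \<open>Agreement with the dimension of the column span\<close>

lemma finsum_func_space:
  assumes "finite J" "\<And>j. j \<in> J \<Longrightarrow> f j \<in> S \<rightarrow>\<^sub>E carrier R"
  shows "finsum (func_space S) f J = (\<lambda>i\<in>S. \<Oplus>j\<in>J. f j i)"
proof -
  interpret V: module R "func_space S" by (rule func_space_is_module)
  have [simp]: "carrier (func_space S) = (S \<rightarrow>\<^sub>E carrier R)"
    "\<zero>\<^bsub>func_space S\<^esub> = (\<lambda>i\<in>S. \<zero>)" "x \<oplus>\<^bsub>func_space S\<^esub> y = (\<lambda>i\<in>S. x i \<oplus> y i)" for x y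
    by (auto simp: func_space_def)
  show ?thesis using assms
  proof (induction J)
    case empty
    then show ?case by (simp add: restrict_def fun_eq_iff)
  next
    case (insert j J)
    have "finsum (func_space S) f (insert j J) = f j \<oplus>\<^bsub>func_space S\<^esub> finsum (func_space S) f J"
      using insert by (intro V.finsum_insert) auto
    also have "\<dots> = (\<lambda>i\<in>S. f j i \<oplus> (\<Oplus>j\<in>J. f j i))"
      using insert by (auto simp: fun_eq_iff restrict_def)
    also have "\<dots> = (\<lambda>i\<in>S. \<Oplus>j\<in>insert j J. f j i)"
    proof (rule restrict_ext)
      fix i assume "i \<in> S"
      then have "f k i \<in> carrier R" if "k \<in> insert j J" for k
        using insert.prems that PiE_mem by metis
      then show "f j i \<oplus> (\<Oplus>j\<in>J. f j i) = (\<Oplus>j\<in>insert j J. f j i)"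
        using insert.hyps by simp
    qed
    finally show ?case .
  qed
qed

text \<open>A maximal independent set of columns is turned into a basis of the span of all columns;
  its size is the factorization rank. All later estimates can therefore be made with
  \<open>mtx_rank\<close>.\<close>

lemma matrix_rank_eq:
  assumes M: "mtx M" and A: "\<And>i j. i < n \<Longrightarrow> j < n \<Longrightarrow> M i j = A $$ (i, j)"
  shows "matrix_rank n R A = mtx_rank {..<n} {..<n} M"
proof -
  define S where "S = {..<n}"
  define V where "V = func_space S"
  have fs: "module R V" unfolding V_def by (rule func_space_is_module)
  then interpret V: vectorspace R V
    by (simp add: vectorspace_def field_axioms)
  have cV: "carrier V = (S \<rightarrow>\<^sub>E carrier R)" and zV: "\<zero>\<^bsub>V\<^esub> = (\<lambda>i\<in>S. \<zero>)"
    and sV: "\<And>a f. a \<odot>\<^bsub>V\<^esub> f = (\<lambda>i\<in>S. a \<otimes> f i)"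
    by (auto simp: V_def func_space_def)
  define c where "c = (\<lambda>j. \<lambda>i\<in>S. M i j)"
  have c: "c j \<in> carrier V" for j using M by (auto simp: c_def cV)
  have C: "{(\<lambda>i\<in>{..<n}. A $$ (i, j)) |j. j < n} = c ` S"
    using A by (auto simp: c_def S_def image_iff fun_eq_iff restrict_def)
  obtain J W where J: "J \<subseteq> S" "indep_columns S J M" and W: "mtx W"
    "\<And>i j. i \<in> S \<Longrightarrow> j \<in> S \<Longrightarrow> M i j = mtx_mult J M W i j" and card: "card J = mtx_rank S S M"
    using maximal_indep_columns[of S M S] M by (auto simp: S_def)
  have fJ: "finite J" using J finite_subset by (auto simp: S_def)
  \<comment> \<open>The span is taken over a set of vectors, where equal columns coincide.
    Independent columns are distinct, since two equal ones would satisfy a relation with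
    coefficients 1 and -1.\<close>
  have inj: "inj_on c J"
  proof (rule inj_onI, rule ccontr)
    fix j k assume jk: "j \<in> J" "k \<in> J" "c j = c k" "j \<noteq> k"
    define a where "a l = (if l = j then \<one> else if l = k then \<ominus> \<one> else \<zero>)" for l
    have a: "a l \<in> carrier R" for l by (simp add: a_def)
    have "(\<Oplus>l\<in>J. M i l \<otimes> a l) = \<zero>" if "i \<in> S" for i
    proof -
      have "(\<Oplus>l\<in>J. M i l \<otimes> a l) = (\<Oplus>l\<in>{j, k}. M i l \<otimes> a l)"
        using fJ jk M a by (intro finsum_support) (auto simp: a_def)
      also have "\<dots> = M i j \<oplus> M i k \<otimes> \<ominus> \<one>" using jk M by (simp add: a_def)
      also have "M i k = M i j" using fun_cong[OF jk(3), of i] that by (simp add: c_def)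
      finally show ?thesis using M by (simp add: r_minus r_neg)
    qed
    then have "a j = \<zero>" using J(2) a jk(1) unfolding indep_columns_def by blast
    then show False by (simp add: a_def)
  qed
  have lin: "V.lincomb a (c ` J) = (\<lambda>i\<in>S. \<Oplus>j\<in>J. M i j \<otimes> a (c j))" if a: "a \<in> c ` J \<rightarrow> carrier R" for a
  proof -
    have ac: "a (c j) \<in> carrier R" if "j \<in> J" for j using a that by blast
    have "V.lincomb a (c ` J) = finsum V (\<lambda>j. a (c j) \<odot>\<^bsub>V\<^esub> c j) J"
      unfolding V.lincomb_def using inj a c by (subst V.finsum_reindex) auto
    also have "\<dots> = (\<lambda>i\<in>S. \<Oplus>j\<in>J. (a (c j) \<odot>\<^bsub>V\<^esub> c j) i)"
      unfolding V_def
    proof (rule finsum_func_space[OF fJ])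
      show "a (c j) \<odot>\<^bsub>func_space S\<^esub> c j \<in> S \<rightarrow>\<^sub>E carrier R" if "j \<in> J" for j
        using V.smult_closed[OF ac[OF that] c[of j]] unfolding cV unfolding V_def .
    qed
    also have "\<dots> = (\<lambda>i\<in>S. \<Oplus>j\<in>J. M i j \<otimes> a (c j))"
    proof (intro restrict_ext finsum_cong' refl)
      fix i j assume ij: "i \<in> S" "j \<in> J"
      have "c j i = M i j" using ij by (simp add: c_def)
      then show "(a (c j) \<odot>\<^bsub>V\<^esub> c j) i = M i j \<otimes> a (c j)"
        using ij ac M by (simp add: sV m_comm)
    qed (use ac M in auto)
    finally show ?thesis .
  qed
  have B: "c ` J \<subseteq> carrier V" "finite (c ` J)" using c fJ by auto
  have indpt: "V.lin_indpt (c ` J)"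
  proof (rule V.finite_lin_indpt2[OF B(2,1)])
    fix a assume a: "a \<in> c ` J \<rightarrow> carrier R" "V.lincomb a (c ` J) = \<zero>\<^bsub>V\<^esub>"
    define b where "b j = (if j \<in> J then a (c j) else \<zero>)" for j
    have ac: "a (c j) \<in> carrier R" if "j \<in> J" for j using a(1) that by blast
    then have b: "b j \<in> carrier R" for j by (auto simp: b_def)
    have "(\<Oplus>j\<in>J. M i j \<otimes> b j) = \<zero>" if "i \<in> S" for i
    proof -
      have "(\<Oplus>j\<in>J. M i j \<otimes> b j) = (\<Oplus>j\<in>J. M i j \<otimes> a (c j))"
        using ac M by (intro finsum_cong') (auto simp: b_def)
      also have "\<dots> = V.lincomb a (c ` J) i" using lin[OF a(1)] that by simp
      finally show ?thesis using a(2) that zV by simp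
    qed
    then have "\<forall>j\<in>J. b j = \<zero>" using J(2) b unfolding indep_columns_def by blast
    then show "\<forall>v\<in>c ` J. a v = \<zero>" by (auto simp: b_def)
  qed
  have "c ` S \<subseteq> V.span (c ` J)"
  proof
    fix v assume "v \<in> c ` S"
    then obtain j where j: "j \<in> S" "v = c j" by blast
    \<comment> \<open>The coefficients form a column of the right factor \<open>W\<close>;
      \<open>inv_into\<close> turns vectors back into column indices.\<close>
    define a where "a v = W (inv_into J c v) j" for v
    have "V.lincomb a (c ` J) = (\<lambda>i\<in>S. \<Oplus>l\<in>J. M i l \<otimes> a (c l))"
      by (rule lin) (use W in \<open>auto simp: a_def\<close>)
    also have "\<dots> = (\<lambda>i\<in>S. \<Oplus>l\<in>J. M i l \<otimes> W l j)"
      using W M inj by (intro restrict_ext finsum_cong') (auto simp: a_def)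
    also have "\<dots> = v"
      using W(2) j by (auto simp: c_def mtx_mult_def restrict_def fun_eq_iff)
    finally have "v = V.lincomb a (c ` J)" ..
    then show "v \<in> V.span (c ` J)"
      unfolding V.span_def using B(2) W(1) by (force simp: a_def)
  qed
  then have "V.span (c ` S) \<subseteq> V.span (c ` J)"
    by (rule V.span_is_subset[OF _ V.span_is_submodule[OF B(1)]])
  moreover have "V.span (c ` J) \<subseteq> V.span (c ` S)"
    using V.span_is_monotone J(1) by (simp add: image_mono)
  ultimately have span: "V.span (c ` S) = V.span (c ` J)" by simp
  have cS: "c ` S \<subseteq> carrier V" using c by auto
  have sub: "submodule R (V.span (c ` S)) V" by (rule V.span_is_submodule[OF cS])
  interpret U: vectorspace R "V\<lparr>carrier := V.span (c ` S)\<rparr>"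
    by (rule V.subspace_is_vs[OF V.span_is_subspace[OF cS]])
  have BU: "c ` J \<subseteq> V.span (c ` S)" using V.in_own_span[OF B(1)] span by simp
  have "U.basis (c ` J)"
    unfolding U.basis_def using V.span_li_not_depend[OF BU sub] indpt span BU by simp
  then have "U.dim = card (c ` J)" by (rule U.dim_basis[OF B(2)])
  also have "\<dots> = card J" by (rule card_image[OF inj])
  finally show ?thesis
    unfolding matrix_rank_def Let_def C using card by (simp add: V_def S_def)
qed

section \<open>Approximate representations\<close>

definition gl :: "'i set \<Rightarrow> ('i \<Rightarrow> 'i \<Rightarrow> 'a) set" where
  "gl I = {M. mtx M \<and> (\<exists>N. mtx N \<and> (\<forall>i\<in>I. \<forall>j\<in>I.
     mtx_mult I M N i j = mtx_one i j \<and> mtx_mult I N M i j = mtx_one i j))}"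

text \<open>The normalised rank exceeds \<open>c\<close>, with the sizes multiplied out. The test
  matrices \<open>C\<close> are indexed by natural numbers because a definition cannot quantify over
  index types; \<open>far_from_oneD\<close> removes this restriction.\<close>

definition far_from_one :: "real \<Rightarrow> 'i set \<Rightarrow> ('i \<Rightarrow> 'i \<Rightarrow> 'a) \<Rightarrow> bool" where
  "far_from_one c I M \<longleftrightarrow> (\<forall>(J :: nat set) C. finite J \<longrightarrow> J \<noteq> {} \<longrightarrow> C \<in> gl J \<longrightarrow>
     c * real (card I) * real (card J) < real (mtx_rank (I \<times> J) (I \<times> J) (mtx_diff (mtx_tensor M C) mtx_one)))"

definition approx_rep ::
  "('g, 'n) monoid_scheme \<Rightarrow> 'g set \<Rightarrow> real \<Rightarrow> 'i set \<Rightarrow> ('g \<Rightarrow> 'i \<Rightarrow> 'i \<Rightarrow> 'a) \<Rightarrow> bool" where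
  "approx_rep G F \<epsilon> I \<phi> \<longleftrightarrow> finite I \<and> I \<noteq> {} \<and> (\<forall>g\<in>carrier G. \<phi> g \<in> gl I) \<and>
     (\<forall>i\<in>I. \<forall>j\<in>I. \<phi> \<one>\<^bsub>G\<^esub> i j = mtx_one i j) \<and>
     (\<forall>g\<in>F. \<forall>h\<in>F. g \<otimes>\<^bsub>G\<^esub> h \<in> F \<longrightarrow>
       real (mtx_rank I I (mtx_diff (\<phi> (g \<otimes>\<^bsub>G\<^esub> h)) (mtx_mult I (\<phi> g) (\<phi> h)))) < \<epsilon> * real (card I))"

text \<open>The constant is a parameter and not hidden behind a quantifier, since it has to be
  followed through products of unbounded size.\<close>

definition strongly_sofic :: "('g, 'n) monoid_scheme \<Rightarrow> real \<Rightarrow> bool" where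
  "strongly_sofic G c \<longleftrightarrow> group G \<and>
     (\<forall>F \<epsilon>. finite F \<longrightarrow> F \<subseteq> carrier G \<longrightarrow> \<epsilon> > 0 \<longrightarrow>
       (\<exists>(I :: nat set) \<phi>. approx_rep G F \<epsilon> I \<phi> \<and> (\<forall>g\<in>F. g \<noteq> \<one>\<^bsub>G\<^esub> \<longrightarrow> far_from_one c I (\<phi> g))))"

section \<open>Invertible matrices and stable distance from the identity\<close>

lemma gl_mtx [simp]: "M \<in> gl I \<Longrightarrow> mtx M"
  by (simp add: gl_def)

lemma gl_inverse:
  assumes "M \<in> gl I"
  obtains N where "mtx N" "\<And>i j. i \<in> I \<Longrightarrow> j \<in> I \<Longrightarrow> mtx_mult I M N i j = mtx_one i j"
    "\<And>i j. i \<in> I \<Longrightarrow> j \<in> I \<Longrightarrow> mtx_mult I N M i j = mtx_one i j"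
  using assms unfolding gl_def by blast

lemma glI:
  assumes "mtx M" "mtx N" "\<And>i j. i \<in> I \<Longrightarrow> j \<in> I \<Longrightarrow> mtx_mult I M N i j = mtx_one i j"
    "\<And>i j. i \<in> I \<Longrightarrow> j \<in> I \<Longrightarrow> mtx_mult I N M i j = mtx_one i j"
  shows "M \<in> gl I"
  using assms unfolding gl_def by blast

lemma one_in_gl: "finite I \<Longrightarrow> mtx_one \<in> gl I"
  by (rule glI[of _ mtx_one]) (simp_all add: mtx_mult_one_left)

lemma mtx_mult_reindex:
  assumes "bij_betw h J I" "mtx M" "mtx N"
  shows "mtx_mult J (\<lambda>i j. M (f i) (h j)) (\<lambda>i j. N (h i) (g j)) i j = mtx_mult I M N (f i) (g j)"
  unfolding mtx_mult_def using assms by (subst finsum_bij[OF assms(1)]) auto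

lemma mtx_one_reindex:
  assumes "inj_on h J" "i \<in> J" "j \<in> J"
  shows "mtx_one (h i) (h j) = mtx_one i j"
  using assms by (auto simp: mtx_one_def inj_on_def)

lemma mtx_rank_diff_eq_0:
  assumes "finite J" "mtx M" "mtx N" "\<And>i j. i \<in> I \<Longrightarrow> j \<in> J \<Longrightarrow> M i j = N i j"
  shows "mtx_rank I J (mtx_diff M N) = 0"
proof -
  have "rank_le I J (card ({} :: nat set)) (mtx_diff M N)"
    by (rule rank_leI[of _ "\<lambda>_ _. \<zero>" "\<lambda>_ _. \<zero>"])
      (use assms in \<open>auto simp: mtx_diff_def mtx_mult_def a_minus_def r_neg mtx_def\<close>)
  then show ?thesis using rank_le_iff[of J "mtx_diff M N" I 0] assms by simp
qed

lemma mtx_reindex: "mtx M \<Longrightarrow> mtx (\<lambda>i j. M (f i) (g j))"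
  by (simp add: mtx_def)

lemma mtx_one_prod: "mtx_one p q = mtx_one (fst p) (fst q) \<otimes> mtx_one (snd p) (snd q)"
  by (auto simp: mtx_one_def prod_eq_iff)

lemma gl_reindex:
  assumes "bij_betw h J I" "M \<in> gl I"
  shows "(\<lambda>i j. M (h i) (h j)) \<in> gl J"
proof -
  obtain N where N: "mtx N" "\<And>i j. i \<in> I \<Longrightarrow> j \<in> I \<Longrightarrow> mtx_mult I M N i j = mtx_one i j"
    "\<And>i j. i \<in> I \<Longrightarrow> j \<in> I \<Longrightarrow> mtx_mult I N M i j = mtx_one i j"
    using gl_inverse[OF assms(2)] by metis
  have h: "inj_on h J" "\<And>j. j \<in> J \<Longrightarrow> h j \<in> I" using assms(1) by (auto simp: bij_betw_def)
  show ?thesis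
  proof (rule glI)
    show "mtx (\<lambda>i j. M (h i) (h j))" "mtx (\<lambda>i j. N (h i) (h j))"
      using N gl_mtx[OF assms(2)] by (auto intro: mtx_reindex)
  qed (use N h gl_mtx[OF assms(2)] mtx_mult_reindex[OF assms(1), of M N h h]
      mtx_mult_reindex[OF assms(1), of N M h h] in \<open>simp_all add: mtx_one_reindex\<close>)
qed

lemma gl_tensor:
  assumes "M \<in> gl I" "N \<in> gl J" "finite I" "finite J"
  shows "mtx_tensor M N \<in> gl (I \<times> J)"
proof -
  obtain M' where M': "mtx M'" "\<And>i j. i \<in> I \<Longrightarrow> j \<in> I \<Longrightarrow> mtx_mult I M M' i j = mtx_one i j"
    "\<And>i j. i \<in> I \<Longrightarrow> j \<in> I \<Longrightarrow> mtx_mult I M' M i j = mtx_one i j"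
    using gl_inverse[OF assms(1)] by metis
  obtain N' where N': "mtx N'" "\<And>i j. i \<in> J \<Longrightarrow> j \<in> J \<Longrightarrow> mtx_mult J N N' i j = mtx_one i j"
    "\<And>i j. i \<in> J \<Longrightarrow> j \<in> J \<Longrightarrow> mtx_mult J N' N i j = mtx_one i j"
    using gl_inverse[OF assms(2)] by metis
  show ?thesis
  proof (rule glI)
    show "mtx (mtx_tensor M N)" "mtx (mtx_tensor M' N')" using assms M' N' by auto
    fix p q assume pq: "p \<in> I \<times> J" "q \<in> I \<times> J"
    show "mtx_mult (I \<times> J) (mtx_tensor M N) (mtx_tensor M' N') p q = mtx_one p q"
      using assms M' N' pq by (subst mtx_mult_tensor) (auto simp: mtx_tensor_def mtx_one_prod[of "(_, _)"])
    show "mtx_mult (I \<times> J) (mtx_tensor M' N') (mtx_tensor M N) p q = mtx_one p q"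
      using assms M' N' pq by (subst mtx_mult_tensor) (auto simp: mtx_tensor_def mtx_one_prod[of "(_, _)"])
  qed
qed

lemma mtx_rank_diff_one_reindex:
  assumes k: "bij_betw k I' I" and "finite I'" "mtx M"
    and eq: "\<And>p q. p \<in> I' \<Longrightarrow> q \<in> I' \<Longrightarrow> M' p q = M (k p) (k q)"
  shows "mtx_rank I' I' (mtx_diff M' mtx_one) = mtx_rank I I (mtx_diff M mtx_one)"
proof -
  have "mtx_rank I' I' (mtx_diff M' mtx_one) = mtx_rank I' I' (\<lambda>p q. mtx_diff M mtx_one (k p) (k q))"
    using eq mtx_one_reindex[OF bij_betw_imp_inj_on[OF k]]
    by (intro mtx_rank_cong) (simp add: mtx_diff_def)
  also have "\<dots> = mtx_rank I I (mtx_diff M mtx_one)"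
    by (rule mtx_rank_reindex[OF k k]) (use assms in auto)
  finally show ?thesis .
qed

lemma far_from_oneD:
  fixes I :: "'i set" and J :: "'j set"
  assumes "far_from_one c I M" "finite I" "mtx M" "finite J" "J \<noteq> {}" "C \<in> gl J"
  shows "c * card I * card J < mtx_rank (I \<times> J) (I \<times> J) (mtx_diff (mtx_tensor M C) mtx_one)"
proof -
  obtain h where h: "bij_betw h {..<card J} J"
    using assms(4) bij_betw_from_nat_into_finite by blast
  define k where "k = map_prod (id :: 'i \<Rightarrow> 'i) h"
  have k: "bij_betw k (I \<times> {..<card J}) (I \<times> J)"
    unfolding k_def using h by (intro bij_betw_map_prod) auto
  have "c * card I * card {..<card J} < mtx_rank (I \<times> {..<card J}) (I \<times> {..<card J})
      (mtx_diff (mtx_tensor M (\<lambda>i j. C (h i) (h j))) mtx_one)"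
    using assms(1) gl_reindex[OF h assms(6)] assms(4,5) card_gt_0_iff[of J]
    unfolding far_from_one_def by blast
  also have "mtx_rank (I \<times> {..<card J}) (I \<times> {..<card J})
      (mtx_diff (mtx_tensor M (\<lambda>i j. C (h i) (h j))) mtx_one) =
    mtx_rank (I \<times> J) (I \<times> J) (mtx_diff (mtx_tensor M C) mtx_one)"
    by (rule mtx_rank_diff_one_reindex[OF k _ mtx_tensor_closed[OF assms(3) gl_mtx[OF assms(6)]]])
      (use assms in \<open>auto simp: mtx_tensor_def[of M] k_def\<close>)
  finally show ?thesis by simp
qed

lemma far_from_one_reindex:
  assumes "far_from_one c I M" "finite I" "mtx M" "bij_betw h I' I"
  shows "far_from_one c I' (\<lambda>i j. M (h i) (h j))"
  unfolding far_from_one_def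
proof (intro allI impI)
  fix J :: "nat set" and C assume J: "finite J" "J \<noteq> {}" "C \<in> gl J"
  define k where "k = map_prod h (id :: nat \<Rightarrow> nat)"
  have k: "bij_betw k (I' \<times> J) (I \<times> J)"
    unfolding k_def using assms by (intro bij_betw_map_prod) auto
  have fin: "finite I'" using assms bij_betw_finite by blast
  have "mtx_rank (I' \<times> J) (I' \<times> J) (mtx_diff (mtx_tensor (\<lambda>i j. M (h i) (h j)) C) mtx_one) =
      mtx_rank (I \<times> J) (I \<times> J) (mtx_diff (mtx_tensor M C) mtx_one)"
    by (rule mtx_rank_diff_one_reindex[OF k _ mtx_tensor_closed[OF assms(3) gl_mtx[OF J(3)]]])
      (use J fin in \<open>auto simp: mtx_tensor_def[of _ C] k_def\<close>)
  then show "c * card I' * card J < mtx_rank (I' \<times> J) (I' \<times> J)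
      (mtx_diff (mtx_tensor (\<lambda>i j. M (h i) (h j)) C) mtx_one)"
    using far_from_oneD[OF assms(1-3) J] bij_betw_same_card[OF assms(4)] by simp
qed

text \<open>Associativity moves \<open>B\<close> into the test matrix:
  \<open>(A \<otimes> B) \<otimes> C\<close> is \<open>A \<otimes> (B \<otimes> C)\<close> up to
  reindexing, and \<open>B \<otimes> C\<close> is again invertible. This is what the quantifier over
  \<open>C\<close> in \<open>far_from_one\<close> is made for.\<close>

lemma far_from_one_tensor_left:
  fixes I :: "'i set" and J :: "'j set"
  assumes "far_from_one c I A" "finite I" "mtx A" "B \<in> gl J" "finite J" "J \<noteq> {}"
  shows "far_from_one c (I \<times> J) (mtx_tensor A B)"
  unfolding far_from_one_def
proof (intro allI impI)
  fix K :: "nat set" and C assume K: "finite K" "K \<noteq> {}" "C \<in> gl K"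
  define k where "k = (\<lambda>p :: ('i \<times> 'j) \<times> nat. (fst (fst p), (snd (fst p), snd p)))"
  have k: "bij_betw k ((I \<times> J) \<times> K) (I \<times> (J \<times> K))"
    by (rule bij_betwI[where g = "\<lambda>q. ((fst q, fst (snd q)), snd (snd q))"]) (auto simp: k_def)
  have "mtx_rank ((I \<times> J) \<times> K) ((I \<times> J) \<times> K) (mtx_diff (mtx_tensor (mtx_tensor A B) C) mtx_one) =
      mtx_rank (I \<times> (J \<times> K)) (I \<times> (J \<times> K)) (mtx_diff (mtx_tensor A (mtx_tensor B C)) mtx_one)"
  proof (rule mtx_rank_diff_one_reindex[OF k])
    show "mtx_tensor (mtx_tensor A B) C p q = mtx_tensor A (mtx_tensor B C) (k p) (k q)" for p q
      using assms K gl_mtx by (simp add: mtx_tensor_def k_def m_assoc)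
  qed (use assms K gl_mtx in auto)
  then show "c * card (I \<times> J) * card K <
      mtx_rank ((I \<times> J) \<times> K) ((I \<times> J) \<times> K) (mtx_diff (mtx_tensor (mtx_tensor A B) C) mtx_one)"
    using far_from_oneD[OF assms(1-3) _ _ gl_tensor[OF assms(4) K(3) assms(5) K(1)]] assms K
    by (simp add: card_cartesian_product mult_ac)
qed

text \<open>Exchanging the tensor factors is a mere reindexing, because multiplication in a field
  commutes.\<close>

lemma far_from_one_tensor_right:
  assumes "far_from_one c J B" "finite I" "A \<in> gl I" "mtx B" "finite J" "I \<noteq> {}"
  shows "far_from_one c (I \<times> J) (mtx_tensor A B)"
proof -
  have swap: "bij_betw prod.swap (I \<times> J) (J \<times> I)"
    by (rule bij_betwI[where g = prod.swap]) auto
  have "far_from_one c (J \<times> I) (mtx_tensor B A)"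
    by (rule far_from_one_tensor_left) (use assms in auto)
  then have "far_from_one c (I \<times> J) (\<lambda>p q. mtx_tensor B A (prod.swap p) (prod.swap q))"
    by (rule far_from_one_reindex[OF _ _ _ swap]) (use assms gl_mtx in auto)
  moreover have "(\<lambda>p q. mtx_tensor B A (prod.swap p) (prod.swap q)) = mtx_tensor A B"
    using assms gl_mtx[OF assms(3)] by (auto simp: mtx_tensor_def fun_eq_iff m_comm)
  ultimately show ?thesis by simp
qed

text \<open>The constructions produce index sets of pairs, whereas \<open>strongly_sofic\<close>
  asks for natural numbers. Separation is carried over for every constant at once.\<close>

lemma approx_rep_reindex:
  fixes I :: "'i set"
  assumes "approx_rep G F \<epsilon> I \<phi>" and F: "F \<subseteq> carrier G"
  obtains n \<psi> where "n > 0" "approx_rep G F \<epsilon> {..<n::nat} \<psi>"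
    "\<And>g c. g \<in> carrier G \<Longrightarrow> far_from_one c I (\<phi> g) \<Longrightarrow> far_from_one c {..<n} (\<psi> g)"
proof -
  have I: "finite I" "I \<noteq> {}" using assms by (auto simp: approx_rep_def)
  define n where "n = card I"
  obtain h where h: "bij_betw h {..<n} I"
    using I(1) bij_betw_from_nat_into_finite n_def by blast
  have h': "inj_on h {..<n}" "\<And>j. j < n \<Longrightarrow> h j \<in> I" using h by (auto simp: bij_betw_def)
  define \<psi> where "\<psi> = (\<lambda>g i j. \<phi> g (h i) (h j))"
  have \<phi>: "\<phi> g \<in> gl I" "mtx (\<phi> g)" if "g \<in> carrier G" for g
    using assms that gl_mtx by (auto simp: approx_rep_def)
  have "mtx_rank {..<n} {..<n} (mtx_diff (\<psi> (g \<otimes>\<^bsub>G\<^esub> k)) (mtx_mult {..<n} (\<psi> g) (\<psi> k))) < \<epsilon> * n"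
    if gk: "g \<in> F" "k \<in> F" "g \<otimes>\<^bsub>G\<^esub> k \<in> F" for g k
  proof -
    have m: "mtx (\<phi> g)" "mtx (\<phi> k)" "mtx (\<phi> (g \<otimes>\<^bsub>G\<^esub> k))" using gk F \<phi> by auto
    have "mtx_diff (\<psi> (g \<otimes>\<^bsub>G\<^esub> k)) (mtx_mult {..<n} (\<psi> g) (\<psi> k)) =
      (\<lambda>i j. mtx_diff (\<phi> (g \<otimes>\<^bsub>G\<^esub> k)) (mtx_mult I (\<phi> g) (\<phi> k)) (h i) (h j))"
      unfolding \<psi>_def mtx_diff_def using mtx_mult_reindex[OF h m(1,2), of h h] by simp
    moreover have "mtx_rank {..<n} {..<n} \<dots> =
        mtx_rank I I (mtx_diff (\<phi> (g \<otimes>\<^bsub>G\<^esub> k)) (mtx_mult I (\<phi> g) (\<phi> k)))"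
      by (rule mtx_rank_reindex[OF h h]) (use m in auto)
    ultimately show ?thesis using assms(1) gk by (simp add: approx_rep_def n_def)
  qed
  moreover have "n > 0" using I by (auto simp: n_def card_gt_0_iff)
  moreover have "\<psi> g \<in> gl {..<n}" if "g \<in> carrier G" for g
    unfolding \<psi>_def by (rule gl_reindex[OF h \<phi>(1)[OF that]])
  moreover have "\<psi> \<one>\<^bsub>G\<^esub> i j = mtx_one i j" if "i < n" "j < n" for i j
    using assms(1) h' that mtx_one_reindex[OF h'(1)] by (simp add: approx_rep_def \<psi>_def)
  ultimately have "approx_rep G F \<epsilon> {..<n} \<psi>"
    unfolding approx_rep_def by auto
  moreover have "far_from_one c {..<n} (\<psi> g)" if "g \<in> carrier G" "far_from_one c I (\<phi> g)" for g c
    unfolding \<psi>_def using far_from_one_reindex[OF that(2) I(1) \<phi>(2)[OF that(1)] h] .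
  ultimately show ?thesis using that \<open>n > 0\<close> by blast
qed

section \<open>Permanence: pullback, tensor products, extensions and finite powers\<close>

lemma approx_rep_comp:
  assumes "approx_rep H (q ` F) \<epsilon> I \<phi>" "q \<in> hom G H" "group G" "group H" "F \<subseteq> carrier G"
  shows "approx_rep G F \<epsilon> I (\<phi> \<circ> q)"
proof -
  interpret q: group_hom G H q using assms by (simp add: group_hom_def group_hom_axioms_def)
  show ?thesis using assms(1,5) unfolding approx_rep_def
    by (auto simp: subset_iff) (metis image_eqI q.hom_mult)
qed

text \<open>Telescoping: \<open>A1 \<otimes> B1 - A2 \<otimes> B2\<close> is the sum of
  \<open>(A1 - A2) \<otimes> B1\<close> and \<open>A2 \<otimes> (B1 - B2)\<close>, and the
  normalised rank of a tensor product is at most that of either factor. So the relative errors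
  add.\<close>

lemma approx_rep_tensor:
  assumes A: "approx_rep G F \<epsilon> I \<phi>" "approx_rep G F \<delta> J \<psi>" and F: "F \<subseteq> carrier G"
  shows "approx_rep G F (\<epsilon> + \<delta>) (I \<times> J) (\<lambda>g. mtx_tensor (\<phi> g) (\<psi> g))"
proof -
  have fin: "finite I" "finite J" "I \<noteq> {}" "J \<noteq> {}" using A by (auto simp: approx_rep_def)
  have gl: "\<phi> g \<in> gl I" "\<psi> g \<in> gl J" if "g \<in> carrier G" for g
    using A that by (auto simp: approx_rep_def)
  have "mtx_rank (I \<times> J) (I \<times> J) (mtx_diff (mtx_tensor (\<phi> (g \<otimes>\<^bsub>G\<^esub> h)) (\<psi> (g \<otimes>\<^bsub>G\<^esub> h)))
      (mtx_mult (I \<times> J) (mtx_tensor (\<phi> g) (\<psi> g)) (mtx_tensor (\<phi> h) (\<psi> h))))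
    < (\<epsilon> + \<delta>) * card (I \<times> J)" if gh: "g \<in> F" "h \<in> F" "g \<otimes>\<^bsub>G\<^esub> h \<in> F" for g h
  proof -
    define A1 where "A1 = \<phi> (g \<otimes>\<^bsub>G\<^esub> h)"
    define A2 where "A2 = mtx_mult I (\<phi> g) (\<phi> h)"
    define B1 where "B1 = \<psi> (g \<otimes>\<^bsub>G\<^esub> h)"
    define B2 where "B2 = mtx_mult J (\<psi> g) (\<psi> h)"
    have gm: "mtx (\<phi> g)" "mtx (\<phi> h)" "mtx (\<psi> g)" "mtx (\<psi> h)"
      using gl gl_mtx gh F by blast+
    have m: "mtx A1" "mtx A2" "mtx B1" "mtx B2"
      unfolding A1_def A2_def B1_def B2_def using gl gl_mtx gh F gm by (blast, simp, blast, simp)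
    have eq: "mtx_mult (I \<times> J) (mtx_tensor (\<phi> g) (\<psi> g)) (mtx_tensor (\<phi> h) (\<psi> h)) = mtx_tensor A2 B2"
      using mtx_mult_tensor[OF fin(1,2) gm(1,3,2,4)] by (auto simp: A2_def B2_def fun_eq_iff)
    have "mtx_rank (I \<times> J) (I \<times> J) (mtx_diff (mtx_tensor A1 B1) (mtx_tensor A2 B2)) \<le>
      mtx_rank (I \<times> J) (I \<times> J) (mtx_diff (mtx_tensor A1 B1) (mtx_tensor A2 B1)) +
      mtx_rank (I \<times> J) (I \<times> J) (mtx_diff (mtx_tensor A2 B1) (mtx_tensor A2 B2))"
      by (rule mtx_rank_diff_triangle) (use fin m in auto)
    also have "\<dots> \<le> mtx_rank I I (mtx_diff A1 A2) * card J + card I * mtx_rank J J (mtx_diff B1 B2)"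
      unfolding mtx_tensor_diff(1)[OF m(1,2,3), symmetric] mtx_tensor_diff(2)[OF m(3,4,2), symmetric]
      using fin m by (intro add_mono mtx_rank_tensor_le) auto
    finally have "real (mtx_rank (I \<times> J) (I \<times> J) (mtx_diff (mtx_tensor A1 B1) (mtx_tensor A2 B2))) \<le>
      real (mtx_rank I I (mtx_diff A1 A2)) * card J + card I * real (mtx_rank J J (mtx_diff B1 B2))"
      by (metis of_nat_add of_nat_le_iff of_nat_mult)
    also have "\<dots> < \<epsilon> * card I * card J + card I * (\<delta> * card J)"
      using A gh fin unfolding approx_rep_def A1_def A2_def B1_def B2_def
      by (intro add_strict_mono mult_strict_right_mono mult_strict_left_mono) (auto simp: card_gt_0_iff)
    finally show ?thesis
      unfolding eq by (simp add: A1_def B1_def card_cartesian_product algebra_simps)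
  qed
  moreover have "mtx_tensor (\<phi> \<one>\<^bsub>G\<^esub>) (\<psi> \<one>\<^bsub>G\<^esub>) p q = mtx_one p q" if "p \<in> I \<times> J" "q \<in> I \<times> J" for p q
    using A that unfolding mtx_one_prod[of p q] by (auto simp: approx_rep_def mtx_tensor_def)
  ultimately show ?thesis
    unfolding approx_rep_def using fin by (auto simp: gl gl_tensor)
qed

text \<open>A representation pulled back from \<open>Q\<close> is tensored with one that only has to
  separate the kernel of \<open>f\<close>. Elements outside the kernel are separated by the first
  factor, nontrivial ones inside it by the second; stability under tensoring keeps the
  constant.\<close>

lemma strongly_sofic_extension:
  assumes G: "group G" and f: "f \<in> hom G Q" and Q: "strongly_sofic Q c"
    and ker: "\<And>F \<epsilon>. finite F \<Longrightarrow> F \<subseteq> carrier G \<Longrightarrow> \<epsilon> > 0 \<Longrightarrow> \<exists>(I :: 'i set) \<phi>. approx_rep G F \<epsilon> I \<phi> \<and>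
      (\<forall>g\<in>F. g \<noteq> \<one>\<^bsub>G\<^esub> \<longrightarrow> f g = \<one>\<^bsub>Q\<^esub> \<longrightarrow> far_from_one c I (\<phi> g))"
  shows "strongly_sofic G c"
  unfolding strongly_sofic_def
proof (intro conjI allI impI)
  fix F and \<epsilon> :: real assume F: "finite F" "F \<subseteq> carrier G" "\<epsilon> > 0"
  have gQ: "group Q" using Q by (simp add: strongly_sofic_def)
  have fF: "f ` F \<subseteq> carrier Q" using f F by (auto simp: hom_def Pi_def)
  obtain I :: "nat set" and \<rho> where \<rho>: "approx_rep Q (f ` F) (\<epsilon>/2) I \<rho>"
    "\<And>g. g \<in> f ` F \<Longrightarrow> g \<noteq> \<one>\<^bsub>Q\<^esub> \<Longrightarrow> far_from_one c I (\<rho> g)"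
    using Q F fF unfolding strongly_sofic_def by (metis finite_imageI half_gt_zero)
  obtain J :: "'i set" and \<phi> where \<phi>: "approx_rep G F (\<epsilon>/2) J \<phi>"
    "\<And>g. g \<in> F \<Longrightarrow> g \<noteq> \<one>\<^bsub>G\<^esub> \<Longrightarrow> f g = \<one>\<^bsub>Q\<^esub> \<Longrightarrow> far_from_one c J (\<phi> g)"
    using ker[of F "\<epsilon>/2"] F by (metis half_gt_zero)
  have \<rho>': "approx_rep G F (\<epsilon>/2) I (\<rho> \<circ> f)" by (rule approx_rep_comp[OF \<rho>(1) f G gQ F(2)])
  have fin: "finite I" "finite J" "I \<noteq> {}" "J \<noteq> {}" using \<rho> \<phi> by (auto simp: approx_rep_def)
  have gl: "\<rho> (f g) \<in> gl I" "\<phi> g \<in> gl J" if "g \<in> carrier G" for g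
    using \<rho>' \<phi> that by (auto simp: approx_rep_def)
  define \<Phi> where "\<Phi> g = mtx_tensor (\<rho> (f g)) (\<phi> g)" for g
  have \<Phi>: "approx_rep G F \<epsilon> (I \<times> J) \<Phi>"
    using approx_rep_tensor[OF \<rho>' \<phi>(1) F(2)] unfolding \<Phi>_def comp_def by simp
  have far: "far_from_one c (I \<times> J) (\<Phi> g)" if g: "g \<in> F" "g \<noteq> \<one>\<^bsub>G\<^esub>" for g
  proof (cases "f g = \<one>\<^bsub>Q\<^esub>")
    case True
    show ?thesis unfolding \<Phi>_def
      by (rule far_from_one_tensor_right[OF \<phi>(2)[OF g True]]) (use fin g F in \<open>auto intro: gl gl_mtx[OF gl(1)] gl_mtx[OF gl(2)]\<close>)
  next
    case False
    show ?thesis unfolding \<Phi>_def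
      by (rule far_from_one_tensor_left[OF \<rho>(2)[OF _ False]]) (use fin g F in \<open>auto intro: gl gl_mtx[OF gl(1)] gl_mtx[OF gl(2)]\<close>)
  qed
  obtain n \<psi> where n: "approx_rep G F \<epsilon> {..<n::nat} \<psi>"
    "\<And>g c. g \<in> carrier G \<Longrightarrow> far_from_one c (I \<times> J) (\<Phi> g) \<Longrightarrow> far_from_one c {..<n} (\<psi> g)"
    using approx_rep_reindex[OF \<Phi> F(2)] by metis
  show "\<exists>(I :: nat set) \<phi>. approx_rep G F \<epsilon> I \<phi> \<and> (\<forall>g\<in>F. g \<noteq> \<one>\<^bsub>G\<^esub> \<longrightarrow> far_from_one c I (\<phi> g))"
    using n far F by blast
qed (rule G)

text \<open>The extension lemma is applied to the restriction that forgets one coordinate, whose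
  kernel is separated by that coordinate. What matters is that \<open>c\<close> does not depend on
  the size of \<open>B\<close>, which later varies with the approximation.\<close>

lemma strongly_sofic_power:
  assumes H: "strongly_sofic H c" and B: "finite B"
  shows "strongly_sofic (product_group B (\<lambda>_. H)) c"
  using B
proof (induction B)
  case empty
  have "group H" using H by (simp add: strongly_sofic_def)
  then have g: "group (product_group {} (\<lambda>_. H))" by simp
  \<comment> \<open>The empty power is the trivial group: a one-dimensional identity represents it,
    and there is nothing to separate.\<close>
  have "approx_rep (product_group {} (\<lambda>_. H)) F \<epsilon> {0::nat} (\<lambda>_. mtx_one)" if "\<epsilon> > 0" for F \<epsilon>
  proof -
    have "mtx_rank {0::nat} {0} (mtx_diff mtx_one (mtx_mult {0} mtx_one mtx_one)) = 0"
      by (rule mtx_rank_diff_eq_0) (simp_all add: mtx_mult_one_left)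
    then show ?thesis using that one_in_gl[of "{0}"] unfolding approx_rep_def by simp
  qed
  then show ?case unfolding strongly_sofic_def using g by fastforce
next
  case (insert b B)
  have gH: "group H" using H by (simp add: strongly_sofic_def)
  let ?G = "product_group (insert b B) (\<lambda>_. H)"
  show ?case
  proof (rule strongly_sofic_extension[OF _ _ insert.IH])
    show gG: "group ?G" using gH by simp
    show "(\<lambda>f. restrict f B) \<in> hom ?G (product_group B (\<lambda>_. H))"
      using gH by (auto simp: hom_def fun_eq_iff restrict_def PiE_iff)
    fix F and \<epsilon> :: real assume F: "finite F" "F \<subseteq> carrier ?G" "\<epsilon> > 0"
    have ev: "(\<lambda>f. f b) \<in> hom ?G H" by (auto simp: hom_def PiE_iff)
    have "(\<lambda>f. f b) ` F \<subseteq> carrier H" using F by (auto simp: PiE_iff)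
    then obtain I :: "nat set" and \<rho> where \<rho>: "approx_rep H ((\<lambda>f. f b) ` F) \<epsilon> I \<rho>"
      "\<And>h. h \<in> (\<lambda>f. f b) ` F \<Longrightarrow> h \<noteq> \<one>\<^bsub>H\<^esub> \<Longrightarrow> far_from_one c I (\<rho> h)"
      using H F unfolding strongly_sofic_def by (metis finite_imageI)
    have "approx_rep ?G F \<epsilon> I (\<rho> \<circ> (\<lambda>f. f b))"
      by (rule approx_rep_comp[OF \<rho>(1) ev gG gH F(2)])
    moreover have "far_from_one c I ((\<rho> \<circ> (\<lambda>f. f b)) f)" if f: "f \<in> F" "f \<noteq> \<one>\<^bsub>?G\<^esub>"
      "restrict f B = \<one>\<^bsub>product_group B (\<lambda>_. H)\<^esub>" for f
    proof -
      have "f b \<noteq> \<one>\<^bsub>H\<^esub>"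
      proof
        assume "f b = \<one>\<^bsub>H\<^esub>"
        moreover have "f x = \<one>\<^bsub>H\<^esub>" if "x \<in> B" for x
          using fun_cong[OF f(3), of x] that by simp
        moreover have "f x = undefined" if "x \<notin> insert b B" for x
        proof -
          have "f \<in> carrier ?G" using f(1) F(2) by blast
          then have "f \<in> (\<Pi>\<^sub>E i\<in>insert b B. carrier H)" by simp
          then show ?thesis using that by (rule PiE_arb)
        qed
        ultimately have "f = \<one>\<^bsub>?G\<^esub>" by (auto simp: fun_eq_iff restrict_def)
        then show False using f(2) by simp
      qed
      then show ?thesis using \<rho>(2) f(1) by simp
    qed
    ultimately show "\<exists>(I :: nat set) \<phi>. approx_rep ?G F \<epsilon> I \<phi> \<and> (\<forall>f\<in>F. f \<noteq> \<one>\<^bsub>?G\<^esub> \<longrightarrow>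
        restrict f B = \<one>\<^bsub>product_group B (\<lambda>_. H)\<^esub> \<longrightarrow> far_from_one c I (\<phi> f))"
      by blast
  qed
qed

section \<open>Block permutation matrices\<close>

definition mtx_block :: "('s \<Rightarrow> 's) \<Rightarrow> ('s \<Rightarrow> 'i \<Rightarrow> 'i \<Rightarrow> 'a) \<Rightarrow> 's \<times> 'i \<Rightarrow> 's \<times> 'i \<Rightarrow> 'a" where
  "mtx_block \<sigma> D = (\<lambda>p q. if fst p = \<sigma> (fst q) then D (fst p) (snd p) (snd q) else \<zero>)"

lemma mtx_block_closed [simp]: "(\<And>s. mtx (D s)) \<Longrightarrow> mtx (mtx_block \<sigma> D)"
  by (auto simp: mtx_def mtx_block_def)

lemma finsum_block:
  assumes "finite A" "finite J" "u \<in> A" "\<And>p. f p \<in> carrier R" "\<And>s j. s \<in> A \<Longrightarrow> s \<noteq> u \<Longrightarrow> f (s, j) = \<zero>"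
  shows "(\<Oplus>p\<in>A \<times> J. f p) = (\<Oplus>j\<in>J. f (u, j))"
proof -
  have "(\<Oplus>p\<in>A \<times> J. f p) = (\<Oplus>p\<in>Pair u ` J. f p)"
  proof (rule finsum_support)
    fix p assume "p \<in> A \<times> J - Pair u ` J"
    then have "fst p \<in> A" "fst p \<noteq> u" by auto
    then show "f p = \<zero>" using assms(5)[of "fst p" "snd p"] by simp
  qed (use assms in auto)
  also have "\<dots> = (\<Oplus>j\<in>J. f (u, j))"
    using assms by (intro finsum_reindex) (auto intro: inj_onI)
  finally show ?thesis .
qed

text \<open>\<open>mtx_block \<sigma> D\<close> is the permutation matrix of \<sigma> multiplied
  from the left by the block diagonal matrix of \<open>D\<close>, so a block is named by its row. In
  a product the left blocks are therefore read off at the row, the right ones at the intermediate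
  index.\<close>

lemma mtx_mult_block:
  assumes "finite A" "finite J" "\<And>s. mtx (D s)" "\<And>s. mtx (D' s)" "\<tau> (fst q) \<in> A"
  shows "mtx_mult (A \<times> J) (mtx_block \<sigma> D) (mtx_block \<tau> D') p q =
    (if fst p = \<sigma> (\<tau> (fst q)) then mtx_mult J (D (fst p)) (D' (\<tau> (fst q))) (snd p) (snd q) else \<zero>)"
proof -
  have "mtx_mult (A \<times> J) (mtx_block \<sigma> D) (mtx_block \<tau> D') p q =
      (\<Oplus>j\<in>J. mtx_block \<sigma> D p (\<tau> (fst q), j) \<otimes> mtx_block \<tau> D' (\<tau> (fst q), j) q)"
    unfolding mtx_mult_def using assms by (intro finsum_block) (auto simp: mtx_block_def)
  also have "\<dots> = (if fst p = \<sigma> (\<tau> (fst q)) then mtx_mult J (D (fst p)) (D' (\<tau> (fst q))) (snd p) (snd q) else \<zero>)"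
    using assms by (simp add: mtx_block_def mtx_mult_def)
  finally show ?thesis .
qed

lemma gl_block:
  assumes fin: "finite A" "finite J" and D: "\<And>s. D s \<in> gl J" and \<sigma>: "bij_betw \<sigma> A A"
  shows "mtx_block \<sigma> D \<in> gl (A \<times> J)"
proof -
  have "\<forall>s. \<exists>N. mtx N \<and> (\<forall>i\<in>J. \<forall>j\<in>J. mtx_mult J (D s) N i j = mtx_one i j \<and> mtx_mult J N (D s) i j = mtx_one i j)"
  proof
    fix s
    show "\<exists>N. mtx N \<and> (\<forall>i\<in>J. \<forall>j\<in>J. mtx_mult J (D s) N i j = mtx_one i j \<and> mtx_mult J N (D s) i j = mtx_one i j)"
      using D[of s] unfolding gl_def by blast
  qed
  then obtain D' where D': "\<And>s. mtx (D' s)"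
    "\<And>s i j. i \<in> J \<Longrightarrow> j \<in> J \<Longrightarrow> mtx_mult J (D s) (D' s) i j = mtx_one i j"
    "\<And>s i j. i \<in> J \<Longrightarrow> j \<in> J \<Longrightarrow> mtx_mult J (D' s) (D s) i j = mtx_one i j" by metis
  have m: "\<And>s. mtx (D s)" using D gl_mtx by blast
  define \<tau> where "\<tau> = inv_into A \<sigma>"
  have \<tau>: "\<And>s. s \<in> A \<Longrightarrow> \<sigma> (\<tau> s) = s" "\<And>s. s \<in> A \<Longrightarrow> \<tau> (\<sigma> s) = s"
    "\<And>s. s \<in> A \<Longrightarrow> \<tau> s \<in> A" "\<And>s. s \<in> A \<Longrightarrow> \<sigma> s \<in> A"
    unfolding \<tau>_def using \<sigma>
    by (auto simp: bij_betw_inv_into_right bij_betw_inv_into_left bij_betw_def inv_into_into)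
  show ?thesis
  proof (rule glI)
    \<comment> \<open>Since blocks are named by rows, the inverse matrix belongs to the inverse
      permutation and carries the inverted blocks shifted by \<sigma>.\<close>
    show "mtx (mtx_block \<sigma> D)" "mtx (mtx_block \<tau> (\<lambda>s. D' (\<sigma> s)))" using m D' by simp_all
    fix p q assume pq: "p \<in> A \<times> J" "q \<in> A \<times> J"
    have one: "mtx_one p q = (if fst p = fst q then mtx_one (snd p) (snd q) else \<zero>)"
      by (auto simp: mtx_one_def prod_eq_iff)
    show "mtx_mult (A \<times> J) (mtx_block \<sigma> D) (mtx_block \<tau> (\<lambda>s. D' (\<sigma> s))) p q = mtx_one p q"
      using pq \<tau> D' m by (subst mtx_mult_block[OF fin]) (auto simp: one)
    show "mtx_mult (A \<times> J) (mtx_block \<tau> (\<lambda>s. D' (\<sigma> s))) (mtx_block \<sigma> D) p q = mtx_one p q"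
      using pq \<tau> D' m by (subst mtx_mult_block[OF fin]) (auto simp: one)
  qed
qed

lemma mtx_rank_block_column_le:
  assumes fin: "finite J" and M: "mtx M" and X: "mtx X"
    and eq: "\<And>t i j. t \<in> A \<Longrightarrow> i \<in> J \<Longrightarrow> j \<in> J \<Longrightarrow> M (t, i) (s, j) = (if t = u then X i j else \<zero>)"
  shows "mtx_rank (A \<times> J) ({s} \<times> J) M \<le> mtx_rank J J X"
proof -
  obtain U V where UV: "mtx (U :: _ \<Rightarrow> nat \<Rightarrow> _)" "mtx V"
    "\<And>i j. i \<in> J \<Longrightarrow> j \<in> J \<Longrightarrow> X i j = mtx_mult {..<mtx_rank J J X} U V i j"
    using rank_factor[OF fin X] by metis
  have "rank_le (A \<times> J) ({s} \<times> J) (card {..<mtx_rank J J X}) M"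
  proof (rule rank_leI[where U = "\<lambda>p l. if fst p = u then U (snd p) l else \<zero>" and V = "\<lambda>l q. V l (snd q)"])
    show "mtx (\<lambda>p l. if fst p = u then U (snd p) l else \<zero>)" "mtx (\<lambda>l q. V l (snd q))"
      using UV by (auto simp: mtx_def)
    fix p q assume "p \<in> A \<times> J" "q \<in> {s} \<times> J"
    then show "M p q = mtx_mult {..<mtx_rank J J X}
        (\<lambda>p l. if fst p = u then U (snd p) l else \<zero>) (\<lambda>l q. V l (snd q)) p q"
      using eq UV by (cases p; cases q) (auto simp: mtx_mult_def)
  qed simp
  then show ?thesis using rank_le_iff[OF _ M] fin by simp
qed

text \<open>The error is estimated one block column at a time. For \<open>s\<close> in
  \<open>B\<close> both matrices have a single block in the same place, and the error is that of the
  blocks; any other block column contributes at most its width \<open>card J\<close>.\<close>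

lemma mtx_rank_block_mult_le:
  assumes fin: "finite A" "finite J" and D: "\<And>s. mtx (D s)" "\<And>s. mtx (D1 s)" "\<And>s. mtx (D2 s)"
    and \<tau>: "\<And>s. s \<in> A \<Longrightarrow> \<tau> s \<in> A" and B: "B \<subseteq> A"
    and r: "\<And>s. s \<in> B \<Longrightarrow> \<rho> s = \<sigma> (\<tau> s) \<and>
      mtx_rank J J (mtx_diff (D (\<rho> s)) (mtx_mult J (D1 (\<rho> s)) (D2 (\<tau> s)))) \<le> r"
  shows "mtx_rank (A \<times> J) (A \<times> J) (mtx_diff (mtx_block \<rho> D)
      (mtx_mult (A \<times> J) (mtx_block \<sigma> D1) (mtx_block \<tau> D2))) \<le> card B * r + card (A - B) * card J"
proof -
  define M where "M = mtx_diff (mtx_block \<rho> D) (mtx_mult (A \<times> J) (mtx_block \<sigma> D1) (mtx_block \<tau> D2))"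
  have M: "mtx M" unfolding M_def using D by simp
  have col: "mtx_rank (A \<times> J) ({s} \<times> J) M \<le> (if s \<in> B then r else card J)" if s: "s \<in> A" for s
  proof (cases "s \<in> B")
    case True
    have "mtx_rank (A \<times> J) ({s} \<times> J) M \<le>
        mtx_rank J J (mtx_diff (D (\<rho> s)) (mtx_mult J (D1 (\<rho> s)) (D2 (\<tau> s))))"
    proof (rule mtx_rank_block_column_le[OF fin(2) M])
      show "M (t, i) (s, j) = (if t = \<rho> s then
          mtx_diff (D (\<rho> s)) (mtx_mult J (D1 (\<rho> s)) (D2 (\<tau> s))) i j else \<zero>)" for t i j
        unfolding M_def mtx_diff_def using r[OF True] D \<tau>[OF s]
        by (subst mtx_mult_block[OF fin]) (auto simp: mtx_block_def a_minus_def)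
    qed (use D in simp)
    then show ?thesis using order_trans[OF _ conjunct2[OF r[OF True]]] True by simp
  next
    case False
    have "mtx_rank (A \<times> J) ({s} \<times> J) M \<le> card ({s} \<times> J)"
      using fin M by (intro mtx_rank_le_card) auto
    then show ?thesis using False by (simp add: card_cartesian_product)
  qed
  have "(\<Union>s\<in>A. {s} \<times> J) = A \<times> J" by auto
  then have "mtx_rank (A \<times> J) (A \<times> J) M \<le> (\<Sum>s\<in>A. mtx_rank (A \<times> J) ({s} \<times> J) M)"
    using mtx_rank_column_blocks[OF fin(1), of "\<lambda>s. {s} \<times> J" M "A \<times> J"] fin(2) M by auto
  also have "\<dots> \<le> (\<Sum>s\<in>A. if s \<in> B then r else card J)" by (rule sum_mono) (rule col)
  also have "\<dots> = card B * r + card (A - B) * card J"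
    using fin(1) B by (simp add: sum.If_cases Int_absorb1 Diff_eq Compl_eq)
  finally show ?thesis unfolding M_def .
qed

text \<open>When the permutation is the identity on \<open>A\<close>, the matrix, its tensor product
  with \<open>C\<close> and the difference from 1 are all block diagonal, so the ranks of the blocks
  indexed by \<open>S\<close> add up to a lower bound.\<close>

lemma mtx_rank_block_tensor_ge:
  fixes J :: "'i set" and K :: "'k set"
  assumes fin: "finite A" "finite J" "finite K" and D: "\<And>s. mtx (D s)" and C: "mtx C" and S: "S \<subseteq> A"
    and id: "\<And>s. s \<in> A \<Longrightarrow> \<sigma> s = s"
  shows "(\<Sum>s\<in>S. mtx_rank (J \<times> K) (J \<times> K) (mtx_diff (mtx_tensor (D s) C) mtx_one)) \<le>
    mtx_rank ((A \<times> J) \<times> K) ((A \<times> J) \<times> K) (mtx_diff (mtx_tensor (mtx_block \<sigma> D) C) mtx_one)"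
proof -
  define M where "M = mtx_diff (mtx_tensor (mtx_block \<sigma> D) C) mtx_one"
  have M: "mtx M" unfolding M_def using D C by simp
  have one: "mtx_rank (({s} \<times> J) \<times> K) (({s} \<times> J) \<times> K) M =
    mtx_rank (J \<times> K) (J \<times> K) (mtx_diff (mtx_tensor (D s) C) mtx_one)" if s: "s \<in> S" for s
  proof -
    define h where "h = (\<lambda>p :: 'i \<times> 'k. ((s, fst p), snd p))"
    have h: "bij_betw h (J \<times> K) (({s} \<times> J) \<times> K)"
      by (rule bij_betwI[where g = "\<lambda>q. (snd (fst q), snd q)"]) (auto simp: h_def)
    have "mtx_rank (({s} \<times> J) \<times> K) (({s} \<times> J) \<times> K) M = mtx_rank (J \<times> K) (J \<times> K) (\<lambda>p q. M (h p) (h q))"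
      by (rule mtx_rank_reindex[OF h h, symmetric]) (use fin M in auto)
    also have "\<dots> = mtx_rank (J \<times> K) (J \<times> K) (mtx_diff (mtx_tensor (D s) C) mtx_one)"
      using id s S by (intro mtx_rank_cong)
        (auto simp: M_def h_def mtx_diff_def mtx_tensor_def mtx_block_def mtx_one_def)
    finally show ?thesis .
  qed
  have "(\<Sum>s\<in>S. mtx_rank (({s} \<times> J) \<times> K) (({s} \<times> J) \<times> K) M) \<le>
      mtx_rank ((A \<times> J) \<times> K) ((A \<times> J) \<times> K) M"
  proof (rule block_diagonal_rank[OF _ _ M])
    show "M i j = \<zero>" if "s \<in> S" "t \<in> S" "s \<noteq> t" "i \<in> ({s} \<times> J) \<times> K" "j \<in> ({t} \<times> J) \<times> K" for s t i j
      using that id S C by (auto simp: M_def mtx_diff_def mtx_tensor_def mtx_block_def mtx_one_def a_minus_def)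
  qed (use fin S finite_subset in auto)
  then show ?thesis using one by (simp add: M_def)
qed

text \<open>More than half of the diagonal blocks have distance above \<open>c\<close>, so the
  average over all blocks exceeds \<open>c / 2\<close>.\<close>

lemma far_from_one_block:
  assumes fin: "finite A" "finite J" and D: "\<And>s. mtx (D s)"
    and id: "\<And>s. s \<in> A \<Longrightarrow> \<sigma> s = s" and S: "S \<subseteq> A" and far: "\<And>s. s \<in> S \<Longrightarrow> far_from_one c J (D s)"
    and c: "c \<ge> 0" and S2: "2 * card S > card A"
  shows "far_from_one (c / 2) (A \<times> J) (mtx_block \<sigma> D)"
  unfolding far_from_one_def
proof (intro allI impI)
  fix K :: "nat set" and C assume K: "finite K" "K \<noteq> {}" "C \<in> gl K"
  have Sne: "S \<noteq> {}" and Sf: "finite S" using S2 S fin finite_subset by auto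
  have "c / 2 * real (card (A \<times> J)) * real (card K) = c * card J * card K * (card A / 2)"
    by (simp add: card_cartesian_product)
  also have "\<dots> \<le> c * card J * card K * card S"
    using c S2 by (intro mult_left_mono) auto
  also have "\<dots> = (\<Sum>s\<in>S. c * card J * card K)" by simp
  also have "\<dots> < (\<Sum>s\<in>S. real (mtx_rank (J \<times> K) (J \<times> K) (mtx_diff (mtx_tensor (D s) C) mtx_one)))"
    using far K by (intro sum_strict_mono Sf Sne) (simp add: far_from_one_def)
  also have "\<dots> \<le> real (mtx_rank ((A \<times> J) \<times> K) ((A \<times> J) \<times> K) (mtx_diff (mtx_tensor (mtx_block \<sigma> D) C) mtx_one))"
    unfolding of_nat_sum[symmetric] of_nat_le_iff
    by (rule mtx_rank_block_tensor_ge) (use fin K D gl_mtx[OF K(3)] S id in auto)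
  finally show "c / 2 * real (card (A \<times> J)) * real (card K) <
      real (mtx_rank ((A \<times> J) \<times> K) ((A \<times> J) \<times> K) (mtx_diff (mtx_tensor (mtx_block \<sigma> D) C) mtx_one))" .
qed

section \<open>Translation between index functions and the elements of
  \<open>matrix_ring\<close>\<close>

definition mtx_of_mat :: "nat \<Rightarrow> 'a mat \<Rightarrow> nat \<Rightarrow> nat \<Rightarrow> 'a" where
  "mtx_of_mat n A = (\<lambda>i j. if i < n \<and> j < n then A $$ (i, j) else \<zero>)"

lemma matrix_ring_carrier:
  "A \<in> carrier (matrix_ring n R) \<longleftrightarrow> A \<in> carrier_mat n n \<and> (\<forall>i<n. \<forall>j<n. A $$ (i, j) \<in> carrier R)"
proof -
  have "elements_mat A \<subseteq> carrier R \<longleftrightarrow> (\<forall>i<n. \<forall>j<n. A $$ (i, j) \<in> carrier R)" if A: "A \<in> carrier_mat n n"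
  proof
    assume "elements_mat A \<subseteq> carrier R"
    then show "\<forall>i<n. \<forall>j<n. A $$ (i, j) \<in> carrier R" using elements_matI[OF A] by blast
  next
    assume *: "\<forall>i<n. \<forall>j<n. A $$ (i, j) \<in> carrier R"
    have dim: "dim_row A = n" "dim_col A = n" using A by auto
    show "elements_mat A \<subseteq> carrier R"
    proof
      fix x assume "x \<in> elements_mat A"
      then show "x \<in> carrier R" using elements_matD[of x A] * unfolding dim by blast
    qed
  qed
  then show ?thesis by (auto simp: matrix_ring_def)
qed

text \<open>Entries of a \<open>mat\<close> beyond its dimensions are unspecified; the default zero
  in \<open>mtx_of_mat\<close> puts them into the carrier.\<close>

lemma mtx_of_mat_closed: "A \<in> carrier (matrix_ring n R) \<Longrightarrow> mtx (mtx_of_mat n A)"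
  by (auto simp: matrix_ring_carrier mtx_of_mat_def mtx_def simp del: mtxD)

lemma mat_in_matrix_ring: "mtx M \<Longrightarrow> mat n n (\<lambda>(i, j). M i j) \<in> carrier (matrix_ring n R)"
  by (auto simp: matrix_ring_carrier)

lemma matrix_ring_mult_nth:
  assumes "A \<in> carrier (matrix_ring n R)" "B \<in> carrier (matrix_ring n R)" "i < n" "j < n"
    "mtx M" "mtx N" "\<And>i j. i < n \<Longrightarrow> j < n \<Longrightarrow> M i j = A $$ (i, j)" "\<And>i j. i < n \<Longrightarrow> j < n \<Longrightarrow> N i j = B $$ (i, j)"
  shows "(A \<otimes>\<^bsub>matrix_ring n R\<^esub> B) $$ (i, j) = mtx_mult {..<n} M N i j"
proof -
  have "mtx_mult {..<n} M N i j = (\<Oplus>k\<in>{..<n}. A $$ (i, k) \<otimes> B $$ (k, j))"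
    unfolding mtx_mult_def using assms by (intro finsum_cong') (auto simp: matrix_ring_carrier)
  then show ?thesis using assms by (simp add: matrix_ring_def)
qed

lemma matrix_ring_mult_closed:
  assumes "A \<in> carrier (matrix_ring n R)" "B \<in> carrier (matrix_ring n R)"
  shows "A \<otimes>\<^bsub>matrix_ring n R\<^esub> B \<in> carrier (matrix_ring n R)"
proof -
  have "(A \<otimes>\<^bsub>matrix_ring n R\<^esub> B) $$ (i, j) \<in> carrier R" if "i < n" "j < n" for i j
    using matrix_ring_mult_nth[OF assms that, of "mtx_of_mat n A" "mtx_of_mat n B"] assms
      mtx_of_mat_closed by (simp add: mtx_of_mat_def)
  moreover have "A \<otimes>\<^bsub>matrix_ring n R\<^esub> B \<in> carrier_mat n n" by (simp add: matrix_ring_def)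
  ultimately show ?thesis by (simp add: matrix_ring_carrier)
qed

lemma matrix_ring_one_nth: "i < n \<Longrightarrow> j < n \<Longrightarrow> \<one>\<^bsub>matrix_ring n R\<^esub> $$ (i, j) = mtx_one i j"
  by (simp add: matrix_ring_def mtx_one_def)

lemma matrix_ring_one_closed: "\<one>\<^bsub>matrix_ring n R\<^esub> \<in> carrier (matrix_ring n R)"
  unfolding matrix_ring_carrier using matrix_ring_one_nth[of _ n] by (auto simp: matrix_ring_def)

text \<open>The subtraction in \<open>rank_dist\<close> refers to the inverse in the additive
  monoid, which is given by a definite description; so the entrywise negative is checked to be its
  unique solution.\<close>

lemma matrix_ring_uminus:
  assumes "B \<in> carrier (matrix_ring n R)"
  shows "\<ominus>\<^bsub>matrix_ring n R\<^esub> B = mat n n (\<lambda>(i, j). \<ominus> B $$ (i, j))"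
  unfolding a_inv_def[of "matrix_ring n R"] m_inv_def[of "add_monoid (matrix_ring n R)"]
proof (rule the_equality)
  let ?C = "mat n n (\<lambda>(i, j). \<ominus> B $$ (i, j))"
  show "?C \<in> carrier (add_monoid (matrix_ring n R)) \<and>
      B \<otimes>\<^bsub>add_monoid (matrix_ring n R)\<^esub> ?C = \<one>\<^bsub>add_monoid (matrix_ring n R)\<^esub> \<and>
      ?C \<otimes>\<^bsub>add_monoid (matrix_ring n R)\<^esub> B = \<one>\<^bsub>add_monoid (matrix_ring n R)\<^esub>"
    using assms unfolding matrix_ring_carrier by (auto simp: matrix_ring_carrier) (auto simp: matrix_ring_def r_neg l_neg intro!: eq_matI)
next
  fix C assume C: "C \<in> carrier (add_monoid (matrix_ring n R)) \<and>
      B \<otimes>\<^bsub>add_monoid (matrix_ring n R)\<^esub> C = \<one>\<^bsub>add_monoid (matrix_ring n R)\<^esub> \<and>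
      C \<otimes>\<^bsub>add_monoid (matrix_ring n R)\<^esub> B = \<one>\<^bsub>add_monoid (matrix_ring n R)\<^esub>"
  then have Cc: "C \<in> carrier_mat n n" "\<And>i j. i < n \<Longrightarrow> j < n \<Longrightarrow> C $$ (i, j) \<in> carrier R"
    by (auto simp: matrix_ring_carrier)
  have "C $$ (i, j) = \<ominus> B $$ (i, j)" if ij: "i < n" "j < n" for i j
  proof -
    have "C \<oplus>\<^bsub>matrix_ring n R\<^esub> B = \<zero>\<^bsub>matrix_ring n R\<^esub>" using C by simp
    then have "(C \<oplus>\<^bsub>matrix_ring n R\<^esub> B) $$ (i, j) = \<zero>\<^bsub>matrix_ring n R\<^esub> $$ (i, j)" by simp
    then have "C $$ (i, j) \<oplus> B $$ (i, j) = \<zero>"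
      using ij by (simp add: matrix_ring_def)
    then show ?thesis
      using Cc(2)[OF ij] assms ij minus_equality by (auto simp: matrix_ring_carrier)
  qed
  then show "C = mat n n (\<lambda>(i, j). \<ominus> B $$ (i, j))" using Cc by (intro eq_matI) auto
qed

text \<open>\<open>M\<close> and \<open>N\<close> may be any index functions that agree with the
  matrices in range, so that products can be presented through \<open>mtx_mult\<close>.\<close>

lemma rank_dist_eq:
  assumes A: "A \<in> carrier (matrix_ring n R)" and B: "B \<in> carrier (matrix_ring n R)"
    and M: "mtx M" "mtx N" "\<And>i j. i < n \<Longrightarrow> j < n \<Longrightarrow> M i j = A $$ (i, j)"
      "\<And>i j. i < n \<Longrightarrow> j < n \<Longrightarrow> N i j = B $$ (i, j)"
  shows "rank_dist n R A B = mtx_rank {..<n} {..<n} (mtx_diff M N) / n"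
proof -
  have "matrix_rank n R (A \<ominus>\<^bsub>matrix_ring n R\<^esub> B) = mtx_rank {..<n} {..<n} (mtx_diff M N)"
  proof (rule matrix_rank_eq)
    fix i j assume "i < n" "j < n"
    then show "mtx_diff M N i j = (A \<ominus>\<^bsub>matrix_ring n R\<^esub> B) $$ (i, j)"
      using M unfolding a_minus_def[of "matrix_ring n R"] matrix_ring_uminus[OF B]
      by (simp add: matrix_ring_def mtx_diff_def a_minus_def)
  qed (use M in simp)
  then show ?thesis by (simp add: rank_dist_def)
qed

lemma gl_of_Units:
  assumes "A \<in> Units (matrix_ring n R)"
  shows "mtx_of_mat n A \<in> gl {..<n}"
proof -
  obtain B where B: "A \<in> carrier (matrix_ring n R)" "B \<in> carrier (matrix_ring n R)"
    "B \<otimes>\<^bsub>matrix_ring n R\<^esub> A = \<one>\<^bsub>matrix_ring n R\<^esub>" "A \<otimes>\<^bsub>matrix_ring n R\<^esub> B = \<one>\<^bsub>matrix_ring n R\<^esub>"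
    using assms unfolding Units_def by blast
  have m: "mtx (mtx_of_mat n A)" "mtx (mtx_of_mat n B)" using B mtx_of_mat_closed by auto
  show ?thesis
  proof (rule glI[OF m])
    fix i j assume ij: "i \<in> {..<n}" "j \<in> {..<n}"
    show "mtx_mult {..<n} (mtx_of_mat n A) (mtx_of_mat n B) i j = mtx_one i j"
      using matrix_ring_mult_nth[OF B(1,2) _ _ m, of i j] B(4) matrix_ring_one_nth[of i n j] ij
      by (simp add: mtx_of_mat_def)
    show "mtx_mult {..<n} (mtx_of_mat n B) (mtx_of_mat n A) i j = mtx_one i j"
      using matrix_ring_mult_nth[OF B(2,1) _ _ m(2,1), of i j] B(3) matrix_ring_one_nth[of i n j] ij
      by (simp add: mtx_of_mat_def)
  qed
qed

lemma Units_of_gl: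
  assumes "M \<in> gl {..<n}"
  shows "mat n n (\<lambda>(i, j). M i j) \<in> Units (matrix_ring n R)"
proof -
  obtain N where N: "mtx N" "\<And>i j. i < n \<Longrightarrow> j < n \<Longrightarrow> mtx_mult {..<n} M N i j = mtx_one i j"
    "\<And>i j. i < n \<Longrightarrow> j < n \<Longrightarrow> mtx_mult {..<n} N M i j = mtx_one i j"
    using gl_inverse[OF assms] by (metis lessThan_iff)
  have m: "mtx M" using assms by simp
  let ?A = "mat n n (\<lambda>(i, j). M i j)" and ?B = "mat n n (\<lambda>(i, j). N i j)"
  have c: "?A \<in> carrier (matrix_ring n R)" "?B \<in> carrier (matrix_ring n R)"
    using m N mat_in_matrix_ring by auto
  have "?A \<otimes>\<^bsub>matrix_ring n R\<^esub> ?B = \<one>\<^bsub>matrix_ring n R\<^esub>"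
    using matrix_ring_mult_nth[OF c _ _ m N(1)] N(2) matrix_ring_one_nth[of _ n]
    by (intro eq_matI) (auto simp: matrix_ring_def)
  moreover have "?B \<otimes>\<^bsub>matrix_ring n R\<^esub> ?A = \<one>\<^bsub>matrix_ring n R\<^esub>"
    using matrix_ring_mult_nth[OF c(2,1) _ _ N(1) m] N(3) matrix_ring_one_nth[of _ n]
    by (intro eq_matI) (auto simp: matrix_ring_def)
  ultimately show ?thesis using c unfolding Units_def by blast
qed

section \<open>From linear soficity to stable separation and back\<close>

lemma mtx_rank_diff_commute:
  fixes A B :: "'i \<Rightarrow> 'j \<Rightarrow> 'a"
  assumes "finite J" "mtx A" "mtx B"
  shows "mtx_rank I J (mtx_diff A B) = mtx_rank I J (mtx_diff B A)"
proof -
  have "mtx_rank I J (mtx_diff B A) \<le> mtx_rank I J (mtx_diff A B)" if m: "mtx A" "mtx B"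
    for A B :: "'i \<Rightarrow> 'j \<Rightarrow> 'a"
  proof -
    obtain U V where UV: "mtx (U :: _ \<Rightarrow> nat \<Rightarrow> _)" "mtx V"
      "\<And>i j. i \<in> I \<Longrightarrow> j \<in> J \<Longrightarrow> mtx_diff A B i j = mtx_mult {..<mtx_rank I J (mtx_diff A B)} U V i j"
      using rank_factor[OF assms(1) mtx_diff_closed[OF m]] by metis
    \<comment> \<open>Negation of the left factor is written as a difference from the zero matrix,
      so that \<open>mtx_diff_mult\<close> applies.\<close>
    define Z :: "'i \<Rightarrow> nat \<Rightarrow> 'a" where "Z = (\<lambda>_ _. \<zero>)"
    have Z: "mtx Z" by (simp add: Z_def mtx_def)
    have "rank_le I J (mtx_rank I J (mtx_diff A B)) (mtx_diff B A)"
      unfolding rank_le_def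
    proof (intro exI conjI ballI)
      fix i j assume ij: "i \<in> I" "j \<in> J"
      have ab: "A i j \<in> carrier R" "B i j \<in> carrier R" using m by auto
      have "mtx_mult {..<mtx_rank I J (mtx_diff A B)} (mtx_diff Z U) V i j = \<ominus> (mtx_diff A B i j)"
      proof -
        have "mtx_mult {..<mtx_rank I J (mtx_diff A B)} Z V i j = \<zero>"
          using UV(2) by (simp add: mtx_mult_def Z_def)
        then show ?thesis
          unfolding mtx_diff_mult[OF Z UV(1,2)] UV(3)[OF ij]
          unfolding mtx_diff_def[of "mtx_mult _ Z V"] using mtxD[OF mtx_mult_closed[OF UV(1,2)]]
          by (simp add: a_minus_def)
      qed
      also have "\<dots> = mtx_diff B A i j" using ab unfolding mtx_diff_def by algebra
      finally show "mtx_diff B A i j = mtx_mult {..<mtx_rank I J (mtx_diff A B)} (mtx_diff Z U) V i j" ..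
    qed (use UV Z in auto)
    then show ?thesis using rank_le_iff[OF assms(1) mtx_diff_closed[OF m(2,1)]] by simp
  qed
  from this[OF assms(2,3)] this[OF assms(3,2)] show ?thesis by simp
qed

text \<open>If \<open>B\<close> indexes a maximal independent set of columns of \<open>M\<close>,
  then \<open>B \<times> K\<close> indexes independent columns of \<open>M \<otimes> C\<close>. Each
  row of \<open>C\<close> turns a relation into one between columns of \<open>M\<close>; hence
  \<open>C\<close> kills every slice of the coefficients, and \<open>C\<close> is
  invertible.\<close>

lemma mtx_rank_tensor_ge:
  assumes fin: "finite J" "finite K" and M: "mtx M" and C: "C \<in> gl K"
  shows "mtx_rank I J M * card K \<le> mtx_rank (I \<times> K) (J \<times> K) (mtx_tensor M C)"
proof -
  obtain B where B: "B \<subseteq> J" "indep_columns I B M" "card B = mtx_rank I J M"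
    using maximal_indep_columns[OF fin(1) M] by metis
  have fB: "finite B" using B fin finite_subset by blast
  have mC: "mtx C" using C by simp
  obtain C' where C': "mtx C'" "\<And>i j. i \<in> K \<Longrightarrow> j \<in> K \<Longrightarrow> mtx_mult K C' C i j = mtx_one i j"
    using gl_inverse[OF C] by metis
  have "indep_columns (I \<times> K) (B \<times> K) (mtx_tensor M C)"
    unfolding indep_columns_def
  proof (intro allI impI ballI)
    fix a p assume a: "\<forall>j. a j \<in> carrier R"
      "\<forall>q\<in>I \<times> K. (\<Oplus>j\<in>B \<times> K. mtx_tensor M C q j \<otimes> a j) = \<zero>" and p: "p \<in> B \<times> K"
    define b where "b = (\<lambda>k l. \<Oplus>m\<in>K. C k m \<otimes> a (l, m))"
    have b: "b k l \<in> carrier R" for k l unfolding b_def using mC a by (auto intro!: finsum_closed)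
    have b0: "b k l = \<zero>" if k: "k \<in> K" and l: "l \<in> B" for k l
    proof -
      have "(\<Oplus>l\<in>B. M i l \<otimes> b k l) = \<zero>" if i: "i \<in> I" for i
      proof -
        have "\<zero> = (\<Oplus>j\<in>B \<times> K. mtx_tensor M C (i, k) j \<otimes> a j)" using a(2) i k by simp
        also have "\<dots> = (\<Oplus>l\<in>B. \<Oplus>m\<in>K. M i l \<otimes> C k m \<otimes> a (l, m))"
          using fB fin a(1) M mC by (subst finsum_Sigma) (auto simp: mtx_tensor_def)
        also have "\<dots> = (\<Oplus>l\<in>B. M i l \<otimes> b k l)"
          unfolding b_def using M mC a(1) by (simp add: finsum_mult_left m_assoc)
        finally show ?thesis ..
      qed
      then show ?thesis using B(2) b l unfolding indep_columns_def by blast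
    qed
    obtain l k where lk: "p = (l, k)" "l \<in> B" "k \<in> K" using p by auto
    define v where "v = (\<lambda>m (_::unit). a (l, m))"
    have v: "mtx v" using a(1) by (simp add: v_def mtx_def)
    have "a p = mtx_mult K mtx_one v k ()"
      using mtx_mult_one_left[OF fin(2) v lk(3)] by (simp add: v_def lk)
    also have "\<dots> = mtx_mult K (mtx_mult K C' C) v k ()"
      unfolding mtx_mult_def[of K _ v] using C'(2)[OF lk(3)] v C'(1) mC by (intro finsum_cong') auto
    also have "\<dots> = mtx_mult K C' (mtx_mult K C v) k ()"
      using fin mC C' v by (intro mtx_mult_assoc) auto
    also have "\<dots> = \<zero>"
    proof -
      have "mtx_mult K C v m () = \<zero>" if "m \<in> K" for m
        using b0[OF that lk(2)] by (simp add: mtx_mult_def v_def b_def)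
      then show ?thesis unfolding mtx_mult_def[of K C'] using C'(1) by (intro add.finprod_one_eqI) auto
    qed
    finally show "a p = \<zero>" .
  qed
  then have "card (B \<times> K) \<le> mtx_rank (I \<times> K) (J \<times> K) (mtx_tensor M C)"
    by (rule indep_columns_le_rank) (use B fin M mC in auto)
  then show ?thesis using B by (simp add: card_cartesian_product)
qed

text \<open>Adding an identity block makes the distance to the identity stable under tensoring with any
  invertible matrix \<open>C\<close>: the two blocks \<open>M \<otimes> C\<close> and \<open>1 \<otimes> C\<close> cannot both be close to \<open>1\<close>.\<close>

lemma far_from_one_double:
  fixes c :: real
  assumes J: "finite J" and M: "mtx M" and far: "c * card J < mtx_rank J J (mtx_diff M mtx_one)"
  shows "far_from_one (c / 2) ((UNIV :: bool set) \<times> J) (mtx_block (\<lambda>b. b) (\<lambda>b. if b then M else mtx_one))"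
  unfolding far_from_one_def
proof (intro allI impI)
  fix K :: "nat set" and C assume K: "finite K" "K \<noteq> {}" "C \<in> gl K"
  define D where "D = (\<lambda>b. if b then M else mtx_one)"
  have C: "mtx C" using K by simp
  have "mtx_rank J J (mtx_diff M mtx_one) * card K \<le>
      mtx_rank (J \<times> K) (J \<times> K) (mtx_tensor (mtx_diff M mtx_one) C)"
    by (rule mtx_rank_tensor_ge) (use J K M in auto)
  \<comment> \<open>\<open>(M - 1) \<otimes> C\<close> is the difference of
    \<open>M \<otimes> C\<close> and \<open>1 \<otimes> C\<close>; the triangle inequality is
    applied with the identity in between.\<close>
  also have "\<dots> \<le> mtx_rank (J \<times> K) (J \<times> K) (mtx_diff (mtx_tensor M C) mtx_one) +
      mtx_rank (J \<times> K) (J \<times> K) (mtx_diff mtx_one (mtx_tensor mtx_one C))"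
    unfolding mtx_tensor_diff(1)[OF M mtx_one_closed C]
    by (rule mtx_rank_diff_triangle) (use J K M C in auto)
  also have "\<dots> = (\<Sum>b\<in>UNIV. mtx_rank (J \<times> K) (J \<times> K) (mtx_diff (mtx_tensor (D b) C) mtx_one))"
    using mtx_rank_diff_commute[of "J \<times> K" mtx_one "mtx_tensor mtx_one C" "J \<times> K"] J K C
    by (simp add: UNIV_bool D_def)
  also have "\<dots> \<le> mtx_rank ((UNIV \<times> J) \<times> K) ((UNIV \<times> J) \<times> K)
      (mtx_diff (mtx_tensor (mtx_block (\<lambda>b. b) D) C) mtx_one)"
    by (rule mtx_rank_block_tensor_ge) (use J K M C in \<open>auto simp: D_def\<close>)
  finally have le: "real (mtx_rank J J (mtx_diff M mtx_one)) * card K \<le>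
    mtx_rank ((UNIV \<times> J) \<times> K) ((UNIV \<times> J) \<times> K) (mtx_diff (mtx_tensor (mtx_block (\<lambda>b. b) D) C) mtx_one)"
    by (simp only: of_nat_mult[symmetric] of_nat_le_iff)
  \<comment> \<open>The two blocks double the size of the matrix, which uses up the factor
    1/2.\<close>
  have "c / 2 * real (card ((UNIV :: bool set) \<times> J)) * real (card K) = c * card J * card K"
    by (simp add: card_cartesian_product)
  also have "\<dots> < real (mtx_rank J J (mtx_diff M mtx_one)) * card K"
    using far K by (intro mult_strict_right_mono) (auto simp: card_gt_0_iff)
  finally show "c / 2 * real (card ((UNIV :: bool set) \<times> J)) * real (card K) <
      real (mtx_rank ((UNIV \<times> J) \<times> K) ((UNIV \<times> J) \<times> K)
        (mtx_diff (mtx_tensor (mtx_block (\<lambda>b. b) (\<lambda>b. if b then M else mtx_one)) C) mtx_one))"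
    using le unfolding D_def by linarith
qed

lemma strongly_soficE:
  assumes "strongly_sofic G c" "finite F" "F \<subseteq> carrier G" "\<epsilon> > 0"
  obtains I :: "nat set" and \<phi> where "approx_rep G F \<epsilon> I \<phi>"
    "\<And>g. g \<in> F \<Longrightarrow> g \<noteq> \<one>\<^bsub>G\<^esub> \<Longrightarrow> far_from_one c I (\<phi> g)"
proof -
  have "\<exists>(I :: nat set) \<phi>. approx_rep G F \<epsilon> I \<phi> \<and> (\<forall>g\<in>F. g \<noteq> \<one>\<^bsub>G\<^esub> \<longrightarrow> far_from_one c I (\<phi> g))"
    using assms unfolding strongly_sofic_def by simp
  then show thesis using that by (elim exE conjE) simp
qed

lemma far_from_one_mono:
  assumes "far_from_one c I M" "c' \<le> c"
  shows "far_from_one c' I M"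
  unfolding far_from_one_def
proof (intro allI impI)
  fix J :: "nat set" and C assume J: "finite J" "J \<noteq> {}" "C \<in> gl J"
  have "c' * real (card I) * real (card J) \<le> c * real (card I) * real (card J)"
    using assms(2) by (intro mult_right_mono) auto
  then show "c' * real (card I) * real (card J) <
      real (mtx_rank (I \<times> J) (I \<times> J) (mtx_diff (mtx_tensor M C) mtx_one))"
    using assms(1) J unfolding far_from_one_def by (meson le_less_trans)
qed

lemma strongly_sofic_mono:
  assumes "strongly_sofic G c" "c' \<le> c"
  shows "strongly_sofic G c'"
  using assms far_from_one_mono[OF _ assms(2)] unfolding strongly_sofic_def by meson

text \<open>Every approximate representation is enlarged by an identity block of the same size;
  \<open>far_from_one_double\<close> then yields stable separation with half the constant.\<close>

lemma linear_sofic_imp_strongly_sofic: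
  assumes "linear_sofic R G"
  obtains c where "c > 0" "strongly_sofic G c"
proof -
  obtain c where c: "c > 0" and G: "group G" and ex:
    "\<forall>F \<epsilon>. finite F \<longrightarrow> F \<subseteq> carrier G \<longrightarrow> (\<epsilon>::real) > 0 \<longrightarrow>
        (\<exists>n>0. \<exists>\<phi> \<in> carrier G \<rightarrow> Units (matrix_ring n R).
          \<phi> \<one>\<^bsub>G\<^esub> = \<one>\<^bsub>matrix_ring n R\<^esub> \<and>
          (\<forall>g\<in>F. \<forall>h\<in>F. g \<otimes>\<^bsub>G\<^esub> h \<in> F \<longrightarrow>
            rank_dist n R (\<phi> (g \<otimes>\<^bsub>G\<^esub> h)) (\<phi> g \<otimes>\<^bsub>matrix_ring n R\<^esub> \<phi> h) < \<epsilon>) \<and>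
          (\<forall>g\<in>F. g \<noteq> \<one>\<^bsub>G\<^esub> \<longrightarrow> rank_dist n R (\<phi> g) \<one>\<^bsub>matrix_ring n R\<^esub> > c))"
    using assms unfolding linear_sofic_def by (elim conjE exE) (rule that)
  interpret G: group G by (rule G)
  have "strongly_sofic G (c / 2)"
    unfolding strongly_sofic_def
  proof (intro conjI allI impI)
    fix F and \<epsilon> :: real assume F: "finite F" "F \<subseteq> carrier G" "\<epsilon> > 0"
    from ex[THEN spec, THEN spec, THEN mp, THEN mp, THEN mp, OF F] obtain n where n: "n > 0" and ex1: "\<exists>\<phi> \<in> carrier G \<rightarrow> Units (matrix_ring n R).
          \<phi> \<one>\<^bsub>G\<^esub> = \<one>\<^bsub>matrix_ring n R\<^esub> \<and>
          (\<forall>g\<in>F. \<forall>h\<in>F. g \<otimes>\<^bsub>G\<^esub> h \<in> F \<longrightarrow>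
            rank_dist n R (\<phi> (g \<otimes>\<^bsub>G\<^esub> h)) (\<phi> g \<otimes>\<^bsub>matrix_ring n R\<^esub> \<phi> h) < \<epsilon>) \<and>
          (\<forall>g\<in>F. g \<noteq> \<one>\<^bsub>G\<^esub> \<longrightarrow> rank_dist n R (\<phi> g) \<one>\<^bsub>matrix_ring n R\<^esub> > c)"
      by (elim exE conjE) (rule that)
    from ex1 obtain \<phi> where \<phi>0: "\<phi> \<in> carrier G \<rightarrow> Units (matrix_ring n R)"
      and props: "\<phi> \<one>\<^bsub>G\<^esub> = \<one>\<^bsub>matrix_ring n R\<^esub> \<and>
          (\<forall>g\<in>F. \<forall>h\<in>F. g \<otimes>\<^bsub>G\<^esub> h \<in> F \<longrightarrow>
            rank_dist n R (\<phi> (g \<otimes>\<^bsub>G\<^esub> h)) (\<phi> g \<otimes>\<^bsub>matrix_ring n R\<^esub> \<phi> h) < \<epsilon>) \<and>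
          (\<forall>g\<in>F. g \<noteq> \<one>\<^bsub>G\<^esub> \<longrightarrow> rank_dist n R (\<phi> g) \<one>\<^bsub>matrix_ring n R\<^esub> > c)"
      by (elim bexE) (rule that)
    have one: "\<phi> \<one>\<^bsub>G\<^esub> = \<one>\<^bsub>matrix_ring n R\<^esub>"
      and mult: "\<And>g h. g \<in> F \<Longrightarrow> h \<in> F \<Longrightarrow> g \<otimes>\<^bsub>G\<^esub> h \<in> F \<Longrightarrow>
            rank_dist n R (\<phi> (g \<otimes>\<^bsub>G\<^esub> h)) (\<phi> g \<otimes>\<^bsub>matrix_ring n R\<^esub> \<phi> h) < \<epsilon>"
      and far: "\<And>g. g \<in> F \<Longrightarrow> g \<noteq> \<one>\<^bsub>G\<^esub> \<Longrightarrow> rank_dist n R (\<phi> g) \<one>\<^bsub>matrix_ring n R\<^esub> > c"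
      using props by simp_all
    have \<phi>: "\<phi> g \<in> Units (matrix_ring n R)" if "g \<in> carrier G" for g
      using funcset_mem[OF \<phi>0 that] .
    define \<psi> where "\<psi> g = mtx_of_mat n (\<phi> g)" for g
    have gl: "\<psi> g \<in> gl {..<n}" if "g \<in> carrier G" for g
      unfolding \<psi>_def by (rule gl_of_Units[OF \<phi>[OF that]])
    have car: "\<phi> g \<in> carrier (matrix_ring n R)" if "g \<in> carrier G" for g
      using \<phi>[OF that] by (simp add: Units_def)
    have m: "mtx (\<psi> g)" if "g \<in> carrier G" for g using gl[OF that] by simp
    have nth: "\<psi> g i j = \<phi> g $$ (i, j)" if "i < n" "j < n" for g i j using that by (simp add: \<psi>_def mtx_of_mat_def)
    define D where "D g = (\<lambda>b. if b then \<psi> g else mtx_one)" for g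
    define \<Phi> where "\<Phi> g = mtx_block (\<lambda>b::bool. b) (D g)" for g
    let ?I = "(UNIV :: bool set) \<times> {..<n}"
    have Dgl: "D g b \<in> gl {..<n}" if "g \<in> carrier G" for g b using gl[OF that] one_in_gl[of "{..<n}"] by (simp add: D_def)
    have \<Phi>: "approx_rep G F \<epsilon> ?I \<Phi>"
      unfolding approx_rep_def
    proof (intro conjI ballI impI)
      show "\<Phi> g \<in> gl ?I" if "g \<in> carrier G" for g
        unfolding \<Phi>_def by (rule gl_block) (use Dgl that in \<open>auto simp: bij_betw_def\<close>)
      show "\<Phi> \<one>\<^bsub>G\<^esub> p q = mtx_one p q" if "p \<in> ?I" "q \<in> ?I" for p q
        using that nth[of _ _ "\<one>\<^bsub>G\<^esub>"] matrix_ring_one_nth[of _ n]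
        by (auto simp: \<Phi>_def mtx_block_def D_def one mtx_one_def prod_eq_iff)
      fix g h assume gh: "g \<in> F" "h \<in> F" "g \<otimes>\<^bsub>G\<^esub> h \<in> F"
      then have c: "g \<in> carrier G" "h \<in> carrier G" "g \<otimes>\<^bsub>G\<^esub> h \<in> carrier G" using F by auto
      define r where "r = mtx_rank {..<n} {..<n} (mtx_diff (\<psi> (g \<otimes>\<^bsub>G\<^esub> h)) (mtx_mult {..<n} (\<psi> g) (\<psi> h)))"
      have "rank_dist n R (\<phi> (g \<otimes>\<^bsub>G\<^esub> h)) (\<phi> g \<otimes>\<^bsub>matrix_ring n R\<^esub> \<phi> h) = r / n"
        unfolding r_def
        by (rule rank_dist_eq) (use c car m nth matrix_ring_mult_closed in
            \<open>simp_all add: matrix_ring_mult_nth[OF _ _ _ _ m m]\<close>)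
      then have "r / n < \<epsilon>" using mult[OF gh] by simp
      then have r: "r < \<epsilon> * n" using n by (simp add: pos_divide_less_eq)
      \<comment> \<open>The identity block has no error at all, but the common bound
        \<open>r\<close> for both blocks is good enough: \<open>2 * r\<close> is compared with the
        total size \<open>2 * n\<close>.\<close>
      have "mtx_rank ?I ?I (mtx_diff (\<Phi> (g \<otimes>\<^bsub>G\<^esub> h)) (mtx_mult ?I (\<Phi> g) (\<Phi> h)))
          \<le> card (UNIV :: bool set) * r + card (UNIV - UNIV :: bool set) * card {..<n}"
        unfolding \<Phi>_def
      proof (rule mtx_rank_block_mult_le)
        show "b = b \<and> mtx_rank {..<n} {..<n} (mtx_diff (D (g \<otimes>\<^bsub>G\<^esub> h) b) (mtx_mult {..<n} (D g b) (D h b))) \<le> r" for b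
          using mtx_rank_diff_eq_0[of "{..<n}" mtx_one "mtx_mult {..<n} mtx_one mtx_one" "{..<n}"]
          by (simp add: D_def r_def mtx_mult_one_left)
      qed (use Dgl[THEN gl_mtx] c in auto)
      then have "real (mtx_rank ?I ?I (mtx_diff (\<Phi> (g \<otimes>\<^bsub>G\<^esub> h)) (mtx_mult ?I (\<Phi> g) (\<Phi> h)))) \<le> 2 * r" by simp
      also have "\<dots> < \<epsilon> * real (card ?I)" using r by (simp add: card_cartesian_product)
      finally show "real (mtx_rank ?I ?I (mtx_diff (\<Phi> (g \<otimes>\<^bsub>G\<^esub> h)) (mtx_mult ?I (\<Phi> g) (\<Phi> h)))) < \<epsilon> * real (card ?I)" .
    qed (use n in auto)
    have far2: "far_from_one (c / 2) ?I (\<Phi> g)" if g: "g \<in> F" "g \<noteq> \<one>\<^bsub>G\<^esub>" for g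
    proof -
      have gc: "g \<in> carrier G" using g F by auto
      have "rank_dist n R (\<phi> g) \<one>\<^bsub>matrix_ring n R\<^esub> = mtx_rank {..<n} {..<n} (mtx_diff (\<psi> g) mtx_one) / n"
        by (rule rank_dist_eq) (use gc car m nth matrix_ring_one_closed matrix_ring_one_nth in auto)
      then have "c < mtx_rank {..<n} {..<n} (mtx_diff (\<psi> g) mtx_one) / n"
        using far[OF g] by simp
      then have "c * card {..<n} < mtx_rank {..<n} {..<n} (mtx_diff (\<psi> g) mtx_one)"
        using n by (simp add: pos_less_divide_eq)
      then show ?thesis unfolding \<Phi>_def D_def by (intro far_from_one_double) (use m gc in auto)
    qed
    obtain k \<chi> where "approx_rep G F \<epsilon> {..<k::nat} \<chi>"
      "\<And>g c. g \<in> carrier G \<Longrightarrow> far_from_one c ?I (\<Phi> g) \<Longrightarrow> far_from_one c {..<k} (\<chi> g)"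
      by (rule approx_rep_reindex[OF \<Phi> F(2)]) (rule that)
    then show "\<exists>(I :: nat set) \<phi>. approx_rep G F \<epsilon> I \<phi> \<and>
        (\<forall>g\<in>F. g \<noteq> \<one>\<^bsub>G\<^esub> \<longrightarrow> far_from_one (c / 2) I (\<phi> g))"
      using far2 F(2) by blast
  qed (rule G)
  then show ?thesis using that[of "c / 2"] c by simp
qed

text \<open>The identity matrix of size one as test matrix recovers the ordinary distance, so the
  constant is kept.\<close>

lemma strongly_sofic_imp_linear_sofic:
  assumes "strongly_sofic G c" "c > 0"
  shows "linear_sofic R G"
  unfolding linear_sofic_def
proof (intro conjI exI[of _ c] allI impI)
  show G: "group G" using assms by (simp add: strongly_sofic_def)
  interpret G: group G by (rule G)
  fix F and \<epsilon> :: real assume F: "finite F" "F \<subseteq> carrier G" "\<epsilon> > 0"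
  obtain I :: "nat set" and \<phi>0 where \<phi>0: "approx_rep G F \<epsilon> I \<phi>0"
    "\<And>g. g \<in> F \<Longrightarrow> g \<noteq> \<one>\<^bsub>G\<^esub> \<Longrightarrow> far_from_one c I (\<phi>0 g)"
    by (rule strongly_soficE[OF assms(1) F]) (rule that)
  obtain n \<psi> where n: "n > 0" and \<psi>: "approx_rep G F \<epsilon> {..<n::nat} \<psi>"
    and far': "\<And>g c. g \<in> carrier G \<Longrightarrow> far_from_one c I (\<phi>0 g) \<Longrightarrow> far_from_one c {..<n} (\<psi> g)"
    by (rule approx_rep_reindex[OF \<phi>0(1) F(2)]) (rule that)
  have far: "far_from_one c {..<n} (\<psi> g)" if "g \<in> F" "g \<noteq> \<one>\<^bsub>G\<^esub>" for g
    using far' \<phi>0(2) F(2) that by blast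
  have gl: "\<psi> g \<in> gl {..<n}" if "g \<in> carrier G" for g using \<psi> that by (simp add: approx_rep_def)
  have m: "mtx (\<psi> g)" if "g \<in> carrier G" for g using gl[OF that] by simp
  define \<phi> where "\<phi> g = mat n n (\<lambda>(i, j). \<psi> g i j)" for g
  have U: "\<phi> g \<in> Units (matrix_ring n R)" if "g \<in> carrier G" for g
    unfolding \<phi>_def by (rule Units_of_gl[OF gl[OF that]])
  have car: "\<phi> g \<in> carrier (matrix_ring n R)" if "g \<in> carrier G" for g
    using U[OF that] by (simp add: Units_def)
  have nth: "\<psi> g i j = \<phi> g $$ (i, j)" if "i < n" "j < n" for g i j using that by (simp add: \<phi>_def)
  have one: "\<phi> \<one>\<^bsub>G\<^esub> = \<one>\<^bsub>matrix_ring n R\<^esub>"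
  proof (rule eq_matI)
    fix i j assume "i < dim_row \<one>\<^bsub>matrix_ring n R\<^esub>" "j < dim_col \<one>\<^bsub>matrix_ring n R\<^esub>"
    then have ij: "i < n" "j < n" by (simp_all add: matrix_ring_def)
    then show "\<phi> \<one>\<^bsub>G\<^esub> $$ (i, j) = \<one>\<^bsub>matrix_ring n R\<^esub> $$ (i, j)"
      using \<psi> matrix_ring_one_nth[OF ij] by (simp add: nth[symmetric] approx_rep_def)
  qed (simp_all add: \<phi>_def matrix_ring_def)
  have mult: "rank_dist n R (\<phi> (g \<otimes>\<^bsub>G\<^esub> h)) (\<phi> g \<otimes>\<^bsub>matrix_ring n R\<^esub> \<phi> h) < \<epsilon>"
    if gh: "g \<in> F" "h \<in> F" "g \<otimes>\<^bsub>G\<^esub> h \<in> F" for g h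
  proof -
    have c: "g \<in> carrier G" "h \<in> carrier G" "g \<otimes>\<^bsub>G\<^esub> h \<in> carrier G" using F gh by auto
    have "rank_dist n R (\<phi> (g \<otimes>\<^bsub>G\<^esub> h)) (\<phi> g \<otimes>\<^bsub>matrix_ring n R\<^esub> \<phi> h) =
        mtx_rank {..<n} {..<n} (mtx_diff (\<psi> (g \<otimes>\<^bsub>G\<^esub> h)) (mtx_mult {..<n} (\<psi> g) (\<psi> h))) / n"
      by (rule rank_dist_eq) (use c car m nth matrix_ring_mult_closed in
          \<open>simp_all add: matrix_ring_mult_nth[OF _ _ _ _ m m]\<close>)
    moreover have "mtx_rank {..<n} {..<n} (mtx_diff (\<psi> (g \<otimes>\<^bsub>G\<^esub> h)) (mtx_mult {..<n} (\<psi> g) (\<psi> h))) < \<epsilon> * n"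
      using \<psi> gh by (simp add: approx_rep_def)
    ultimately show ?thesis using n by (simp add: divide_less_eq)
  qed
  have dist: "rank_dist n R (\<phi> g) \<one>\<^bsub>matrix_ring n R\<^esub> > c" if g: "g \<in> F" "g \<noteq> \<one>\<^bsub>G\<^esub>" for g
  proof -
    have gc: "g \<in> carrier G" using g F by auto
    have rd: "rank_dist n R (\<phi> g) \<one>\<^bsub>matrix_ring n R\<^esub> = mtx_rank {..<n} {..<n} (mtx_diff (\<psi> g) mtx_one) / n"
      by (rule rank_dist_eq) (use gc car m nth matrix_ring_one_closed matrix_ring_one_nth in auto)
    let ?I = "{..<n} \<times> {0::nat}"
    have b: "bij_betw (\<lambda>i. (i, 0::nat)) {..<n} ?I" by (auto simp: bij_betw_def inj_on_def)
    have "c * card {..<n} * card {0::nat} < mtx_rank ?I ?I (mtx_diff (mtx_tensor (\<psi> g) mtx_one) mtx_one)"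
      by (rule far_from_oneD[OF far[OF g]]) (use m gc one_in_gl[of "{0::nat}"] in auto)
    also have "mtx_rank ?I ?I (mtx_diff (mtx_tensor (\<psi> g) mtx_one) mtx_one) =
        mtx_rank {..<n} {..<n} (\<lambda>i j. mtx_diff (mtx_tensor (\<psi> g) mtx_one) mtx_one (i, 0::nat) (j, 0))"
      by (rule mtx_rank_reindex[OF b b, symmetric]) (use m gc in auto)
    also have "\<dots> = mtx_rank {..<n} {..<n} (mtx_diff (\<psi> g) mtx_one)"
      using m[OF gc] by (intro mtx_rank_cong) (auto simp: mtx_diff_def mtx_tensor_def mtx_one_def)
    finally show ?thesis using rd n by (simp add: pos_less_divide_eq)
  qed
  show "\<exists>n>0. \<exists>\<phi> \<in> carrier G \<rightarrow> Units (matrix_ring n R).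
          \<phi> \<one>\<^bsub>G\<^esub> = \<one>\<^bsub>matrix_ring n R\<^esub> \<and>
          (\<forall>g\<in>F. \<forall>h\<in>F. g \<otimes>\<^bsub>G\<^esub> h \<in> F \<longrightarrow>
            rank_dist n R (\<phi> (g \<otimes>\<^bsub>G\<^esub> h)) (\<phi> g \<otimes>\<^bsub>matrix_ring n R\<^esub> \<phi> h) < \<epsilon>) \<and>
          (\<forall>g\<in>F. g \<noteq> \<one>\<^bsub>G\<^esub> \<longrightarrow> rank_dist n R (\<phi> g) \<one>\<^bsub>matrix_ring n R\<^esub> > c)"
    using n one U mult dist by (intro exI[of _ n] conjI bexI[of _ \<phi>]) auto
qed (rule assms(2))

lemma hamming_dist_card:
  assumes "finite A" "hamming_dist A \<sigma> \<tau> < \<epsilon>" "A \<noteq> {}"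
  shows "real (card {s \<in> A. \<sigma> s \<noteq> \<tau> s}) < \<epsilon> * card A"
proof -
  have "A = {s \<in> A. \<sigma> s = \<tau> s} \<union> {s \<in> A. \<sigma> s \<noteq> \<tau> s}" by auto
  then have "card A = card {s \<in> A. \<sigma> s = \<tau> s} + card {s \<in> A. \<sigma> s \<noteq> \<tau> s}"
    using card_Un_disjoint[of "{s \<in> A. \<sigma> s = \<tau> s}" "{s \<in> A. \<sigma> s \<noteq> \<tau> s}"] assms(1) by auto
  moreover have a: "card A > 0" using assms by (simp add: card_gt_0_iff)
  have "(1 - real (card {s \<in> A. \<sigma> s = \<tau> s}) / card A) * card A < \<epsilon> * card A"
    using assms(2) a by (intro mult_strict_right_mono) (simp_all add: hamming_dist_def)
  then have "card A - real (card {s \<in> A. \<sigma> s = \<tau> s}) < \<epsilon> * card A"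
    using a by (simp add: left_diff_distrib)
  ultimately show ?thesis by linarith
qed

end

text \<open>What each of the three wreath products has to supply. The \<open>p s\<close> are exact
  homomorphisms on all of \<open>N\<close>, while nontriviality is asked only on \<open>F2\<close>,
  and compatibility with the action only where both \<open>s\<close> and its image under
  \<open>\<phi> g\<close> are good points.\<close>

definition equivariant_model ::
  "('a, 'm) monoid_scheme \<Rightarrow> ('g, 'n) monoid_scheme \<Rightarrow> ('g \<Rightarrow> 'a \<Rightarrow> 'a) \<Rightarrow> ('q, 'l) monoid_scheme \<Rightarrow>
    'g set \<Rightarrow> 'a set \<Rightarrow> real \<Rightarrow> bool" where
  "equivariant_model N G \<theta> Q F1 F2 \<epsilon> \<longleftrightarrow>
    (\<exists>(A :: nat set) \<phi> S p. finite A \<and> \<phi> \<in> carrier G \<rightarrow> carrier (BijGroup A) \<and> unital G A \<phi> \<and>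
      approx_multiplicative G F1 \<epsilon> A \<phi> \<and> S \<subseteq> A \<and> real (card S) > (1 - \<epsilon>) * real (card A) \<and>
      (\<forall>s\<in>S. p s \<in> hom N Q \<and> (\<forall>x\<in>F2. x \<noteq> \<one>\<^bsub>N\<^esub> \<longrightarrow> p s x \<noteq> \<one>\<^bsub>Q\<^esub>)) \<and>
      (\<forall>g\<in>F1. \<forall>x\<in>F2. \<forall>s\<in>S. \<phi> g s \<in> S \<longrightarrow> p (\<phi> g s) (\<theta> g x) = p s x))"

text \<open>Each \<open>\<theta> g\<close> is assumed to be an endomorphism; \<open>one\<close> and
  \<open>mult\<close> make it bijective on the carrier.\<close>

locale group_automorphism_action =
  fixes N :: "('a, 'm) monoid_scheme" and G :: "('g, 'n) monoid_scheme" and \<theta> :: "'g \<Rightarrow> 'a \<Rightarrow> 'a"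
  assumes N: "group N" and G: "group G"
    and hom: "g \<in> carrier G \<Longrightarrow> \<theta> g \<in> hom N N"
    and one: "x \<in> carrier N \<Longrightarrow> \<theta> \<one>\<^bsub>G\<^esub> x = x"
    and mult: "g \<in> carrier G \<Longrightarrow> h \<in> carrier G \<Longrightarrow> x \<in> carrier N \<Longrightarrow> \<theta> (g \<otimes>\<^bsub>G\<^esub> h) x = \<theta> g (\<theta> h x)"
begin

lemma group_semidirect: "group (semidirect_product N G \<theta>)"
proof -
  interpret N: group N by (rule N)
  interpret G: group G by (rule G)
  have cl: "\<theta> g x \<in> carrier N" if "g \<in> carrier G" "x \<in> carrier N" for g x
    using hom[OF that(1)] that(2) by (rule hom_in_carrier)
  have hm: "\<theta> g (x \<otimes>\<^bsub>N\<^esub> y) = \<theta> g x \<otimes>\<^bsub>N\<^esub> \<theta> g y"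
    if "g \<in> carrier G" "x \<in> carrier N" "y \<in> carrier N" for g x y
    using hom_mult[OF hom[OF that(1)] that(2,3)] .
  have h1: "\<theta> g \<one>\<^bsub>N\<^esub> = \<one>\<^bsub>N\<^esub>" if "g \<in> carrier G" for g
    using hom_one[OF hom[OF that] N N] .
  show ?thesis
  proof (rule groupI)
    fix p assume p: "p \<in> carrier (semidirect_product N G \<theta>)"
    obtain x g where xg: "p = (x, g)" "x \<in> carrier N" "g \<in> carrier G"
      using p by (cases p) (auto simp: semidirect_product_def)
    let ?q = "(\<theta> (inv\<^bsub>G\<^esub> g) (inv\<^bsub>N\<^esub> x), inv\<^bsub>G\<^esub> g)"
    have "\<theta> (inv\<^bsub>G\<^esub> g) (inv\<^bsub>N\<^esub> x) \<otimes>\<^bsub>N\<^esub> \<theta> (inv\<^bsub>G\<^esub> g) x = \<one>\<^bsub>N\<^esub>"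
      using xg hm[of "inv\<^bsub>G\<^esub> g" "inv\<^bsub>N\<^esub> x" x] h1[of "inv\<^bsub>G\<^esub> g"] by simp
    then show "\<exists>q\<in>carrier (semidirect_product N G \<theta>).
        q \<otimes>\<^bsub>semidirect_product N G \<theta>\<^esub> p = \<one>\<^bsub>semidirect_product N G \<theta>\<^esub>"
      using xg cl by (intro bexI[of _ ?q]) (auto simp: semidirect_product_def)
  next
    fix p q r assume "p \<in> carrier (semidirect_product N G \<theta>)" "q \<in> carrier (semidirect_product N G \<theta>)"
      "r \<in> carrier (semidirect_product N G \<theta>)"
    then show "p \<otimes>\<^bsub>semidirect_product N G \<theta>\<^esub> q \<otimes>\<^bsub>semidirect_product N G \<theta>\<^esub> r =
        p \<otimes>\<^bsub>semidirect_product N G \<theta>\<^esub> (q \<otimes>\<^bsub>semidirect_product N G \<theta>\<^esub> r)"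
      by (auto simp: semidirect_product_def cl hm mult N.m_assoc G.m_assoc)
  qed (auto simp: semidirect_product_def cl one)
qed

lemma hom_snd: "snd \<in> hom (semidirect_product N G \<theta>) G"
  by (auto simp: hom_def semidirect_product_def)

end

context field begin

text \<open>An element \<open>(x, g)\<close> acts by permuting the blocks \<open>s \<in> A\<close> through \<open>\<phi> g\<close>, followed by the
  block diagonal matrix with entries \<open>\<psi> (p s x)\<close>.\<close>

lemma semidirect_strongly_sofic:
  fixes N :: "('e, 'o) monoid_scheme" and G :: "('g, 'n) monoid_scheme"
  assumes act: "group_automorphism_action N G \<theta>"
    and G: "strongly_sofic G c" and d: "d > 0"
    and ex: "\<And>F1 F2 \<epsilon>. finite F1 \<Longrightarrow> F1 \<subseteq> carrier G \<Longrightarrow> finite F2 \<Longrightarrow> F2 \<subseteq> carrier N \<Longrightarrow> \<epsilon> > 0 \<Longrightarrow>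
      \<exists>Q :: ('q, 'l) monoid_scheme. strongly_sofic Q d \<and> equivariant_model N G \<theta> Q F1 F2 \<epsilon>"
  shows "strongly_sofic (semidirect_product N G \<theta>) (min c (d / 2))"
proof -
  interpret act: group_automorphism_action N G \<theta> by (rule act)
  interpret N: group N by (rule act.N)
  interpret G: group G by (rule act.G)
  define W where "W = semidirect_product N G \<theta>"
  have W: "carrier W = carrier N \<times> carrier G" "\<one>\<^bsub>W\<^esub> = (\<one>\<^bsub>N\<^esub>, \<one>\<^bsub>G\<^esub>)"
    "\<And>x g y h. (x, g) \<otimes>\<^bsub>W\<^esub> (y, h) = (x \<otimes>\<^bsub>N\<^esub> \<theta> g y, g \<otimes>\<^bsub>G\<^esub> h)"
    by (auto simp: W_def semidirect_product_def)
  have "strongly_sofic W (min c (d / 2))"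
  \<comment> \<open>Elements with nontrivial second component are left to the representation of
    \<open>G\<close>. The block matrices only have to separate elements \<open>(x, 1)\<close>, and
    for these the permutation is the identity.\<close>
  proof (rule strongly_sofic_extension[where f = snd and Q = G])
    show "group W" "snd \<in> hom W G" unfolding W_def by (rule act.group_semidirect act.hom_snd)+
    show "strongly_sofic G (min c (d / 2))"
      by (rule strongly_sofic_mono[OF G]) simp
    fix F and \<epsilon> :: real assume F: "finite F" "F \<subseteq> carrier W" "\<epsilon> > 0"
    \<comment> \<open>The bound 1/2 makes more than half of the points good. The relative error will
      stay below 4 times \<delta>: one from the blocks, three from the bad positions.\<close>
    define \<delta> where "\<delta> = min (1/2) (\<epsilon> / 5)"
    have \<delta>: "\<delta> > 0" "\<delta> \<le> 1/2" "\<delta> \<le> \<epsilon> / 5" using F by (auto simp: \<delta>_def)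
    have fF: "finite (snd ` F)" "snd ` F \<subseteq> carrier G" "finite (fst ` F)" "fst ` F \<subseteq> carrier N"
      using F W by auto
    from ex[OF fF \<delta>(1)] obtain Q :: "('q, 'l) monoid_scheme" where Q: "strongly_sofic Q d"
      and model: "equivariant_model N G \<theta> Q (snd ` F) (fst ` F) \<delta>"
      by (elim exE conjE) (rule that)
    from model obtain A :: "nat set" and \<phi> S p
      where A: "finite A" and \<phi>: "\<phi> \<in> carrier G \<rightarrow> carrier (BijGroup A)"
      and un: "unital G A \<phi>" and am: "approx_multiplicative G (snd ` F) \<delta> A \<phi>"
      and S: "S \<subseteq> A" "real (card S) > (1 - \<delta>) * real (card A)"
      and p: "\<forall>s\<in>S. p s \<in> hom N Q \<and> (\<forall>x\<in>fst ` F. x \<noteq> \<one>\<^bsub>N\<^esub> \<longrightarrow> p s x \<noteq> \<one>\<^bsub>Q\<^esub>)"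
      and eq: "\<forall>g\<in>snd ` F. \<forall>x\<in>fst ` F. \<forall>s\<in>S. \<phi> g s \<in> S \<longrightarrow> p (\<phi> g s) (\<theta> g x) = p s x"
      unfolding equivariant_model_def by (elim exE conjE) (rule that)
    have Sf: "finite S" using S A finite_subset by blast
    \<comment> \<open>For empty \<open>A\<close> the strict lower bound on \<open>card S\<close>
      would read \<open>0 > 0\<close>.\<close>
    have Ane: "A \<noteq> {}" using S by auto
    have bij: "bij_betw (\<phi> g) A A" if "g \<in> carrier G" for g
      using funcset_mem[OF \<phi> that] by (simp add: BijGroup_def Bij_def)
    have gQ: "group Q" using Q by (simp add: strongly_sofic_def)
    have pc: "p s x \<in> carrier Q" if "s \<in> S" "x \<in> carrier N" for s x
      using p that by (auto intro: hom_in_carrier)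
    have \<theta>c: "\<theta> g x \<in> carrier N" if "g \<in> carrier G" "x \<in> carrier N" for g x
      using act.hom[OF that(1)] that(2) by (rule hom_in_carrier)
    \<comment> \<open>The product of \<open>(x, g)\<close> and \<open>(y, h)\<close> has the
      translate \<open>\<theta> g y\<close> as a factor of its first component, so \<psi> must be
      multiplicative on images of translates too.\<close>
    define F3 where "F3 = fst ` F \<union> (\<lambda>(g, x). \<theta> g x) ` (snd ` F \<times> fst ` F)"
    define FQ where "FQ = (\<Union>s\<in>S. p s ` F3)"
    have F3: "finite F3" "F3 \<subseteq> carrier N"
      unfolding F3_def using fF \<theta>c by (auto simp: subset_iff)
    have FQ: "finite FQ" "FQ \<subseteq> carrier Q" unfolding FQ_def using F3 Sf pc by auto
    obtain J :: "nat set" and \<psi> where \<psi>: "approx_rep Q FQ \<delta> J \<psi>"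
      and far: "\<And>x. x \<in> FQ \<Longrightarrow> x \<noteq> \<one>\<^bsub>Q\<^esub> \<Longrightarrow> far_from_one d J (\<psi> x)"
      by (rule strongly_soficE[OF Q FQ \<delta>(1)]) (rule that)
    have J: "finite J" "J \<noteq> {}" and \<psi>gl: "\<And>x. x \<in> carrier Q \<Longrightarrow> \<psi> x \<in> gl J"
      using \<psi> by (auto simp: approx_rep_def)
    \<comment> \<open>Identity blocks at bad points keep the block matrix invertible.\<close>
    define D where "D x s = (if s \<in> S then \<psi> (p s x) else mtx_one)" for x s
    have D: "D x s \<in> gl J" if "x \<in> carrier N" for x s
      unfolding D_def using \<psi>gl pc that one_in_gl[OF J(1)] by auto
    have Dm: "mtx (D x s)" if "x \<in> carrier N" for x s using D[OF that] by (rule gl_mtx)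
    define \<Phi> where "\<Phi> w = mtx_block (\<phi> (snd w)) (D (fst w))" for w
    have \<phi>1: "\<phi> \<one>\<^bsub>G\<^esub> s = s" if "s \<in> A" for s using un that by (simp add: unital_def BijGroup_def)
    have rep: "approx_rep W F \<epsilon> (A \<times> J) \<Phi>"
      unfolding approx_rep_def
    proof (intro conjI ballI impI)
      show "\<Phi> w \<in> gl (A \<times> J)" if "w \<in> carrier W" for w
        unfolding \<Phi>_def by (rule gl_block[OF A J(1)]) (use D bij that W in auto)
      show "\<Phi> \<one>\<^bsub>W\<^esub> q r = mtx_one q r" if qr: "q \<in> A \<times> J" "r \<in> A \<times> J" for q r
      proof -
        have "D \<one>\<^bsub>N\<^esub> s i j = mtx_one i j" if "i \<in> J" "j \<in> J" for s i j
          using \<psi> that p hom_one[OF _ N.is_group gQ] by (auto simp: D_def approx_rep_def)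
        then show ?thesis
          using qr \<phi>1 by (auto simp: \<Phi>_def W mtx_block_def) (auto simp: mtx_one_def)
      qed
      fix w v assume wv: "w \<in> F" "v \<in> F" "w \<otimes>\<^bsub>W\<^esub> v \<in> F"
      obtain x g y h where xg: "w = (x, g)" "v = (y, h)" by (cases w; cases v)
      have c: "x \<in> carrier N" "y \<in> carrier N" "g \<in> carrier G" "h \<in> carrier G"
        using wv F W xg by auto
      have inF: "x \<in> fst ` F" "y \<in> fst ` F" "g \<in> snd ` F" "h \<in> snd ` F" "x \<otimes>\<^bsub>N\<^esub> \<theta> g y \<in> fst ` F"
        "g \<otimes>\<^bsub>G\<^esub> h \<in> snd ` F"
        using wv xg W by (force intro: image_eqI)+
      \<comment> \<open>Bad positions: \<phi> is not multiplicative there, or the path from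
        \<open>s\<close> through \<open>\<phi> h s\<close> to \<open>\<phi> g (\<phi> h s)\<close>
        leaves \<open>S\<close>. Each set has relative size below \<delta>; for the last two,
        bijections pull \<open>A - S\<close> back to a set of no larger size.\<close>
      let ?b1 = "{s \<in> A. \<phi> (g \<otimes>\<^bsub>G\<^esub> h) s \<noteq> \<phi> g (\<phi> h s)}"
      let ?b2 = "{s \<in> A. \<phi> h s \<notin> S}" and ?b3 = "{s \<in> A. \<phi> g (\<phi> h s) \<notin> S}"
      define B where "B = A - (?b1 \<union> ?b2 \<union> ?b3)"
      have AS: "real (card (A - S)) < \<delta> * card A"
        using S A by (simp add: card_Diff_subset Sf of_nat_diff card_mono algebra_simps)
      have b1: "real (card ?b1) < \<delta> * card A"
      proof -
        have "hamming_dist A (\<phi> (g \<otimes>\<^bsub>G\<^esub> h)) (\<phi> g \<otimes>\<^bsub>BijGroup A\<^esub> \<phi> h) < \<delta>"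
          using am inF by (auto simp: approx_multiplicative_def)
        then have "real (card {s \<in> A. \<phi> (g \<otimes>\<^bsub>G\<^esub> h) s \<noteq> (\<phi> g \<otimes>\<^bsub>BijGroup A\<^esub> \<phi> h) s}) < \<delta> * card A"
          by (rule hamming_dist_card[OF A _ Ane])
        moreover have "(\<phi> g \<otimes>\<^bsub>BijGroup A\<^esub> \<phi> h) s = \<phi> g (\<phi> h s)" if "s \<in> A" for s
          using funcset_mem[OF \<phi>] c that by (simp add: BijGroup_def compose_def)
        ultimately show ?thesis by (simp cong: conj_cong)
      qed
      have inj_le: "card {s \<in> A. \<sigma> s \<notin> S} \<le> card (A - S)" if "bij_betw \<sigma> A A" for \<sigma>
        by (rule card_inj_on_le[of \<sigma>]) (use that A in \<open>auto simp: bij_betw_def inj_on_def\<close>)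
      have b2: "card ?b2 \<le> card (A - S)" by (rule inj_le[OF bij[OF c(4)]])
      have b3: "card ?b3 \<le> card (A - S)"
        using inj_le[OF bij_betw_trans[OF bij[OF c(4)] bij[OF c(3)]]] by simp
      have "card (A - B) \<le> card (?b1 \<union> ?b2 \<union> ?b3)" using A by (intro card_mono) (auto simp: B_def)
      also have "\<dots> \<le> card ?b1 + card ?b2 + card ?b3"
        using card_Un_le[of "?b1 \<union> ?b2" ?b3] card_Un_le[of ?b1 ?b2] by linarith
      finally have bad: "real (card (A - B)) < 3 * \<delta> * card A"
        using b1 b2 b3 AS by linarith
      \<comment> \<open>The block estimate takes a natural number as error bound, hence the
        floor.\<close>
      define r where "r = nat \<lfloor>\<delta> * card J\<rfloor>"
      have r: "real r \<le> \<delta> * card J" "\<And>k::nat. real k \<le> \<delta> * card J \<Longrightarrow> k \<le> r"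
        using \<delta>(1) by (auto simp: r_def le_nat_floor)
      have "mtx_rank (A \<times> J) (A \<times> J) (mtx_diff (\<Phi> (w \<otimes>\<^bsub>W\<^esub> v)) (mtx_mult (A \<times> J) (\<Phi> w) (\<Phi> v)))
          \<le> card B * r + card (A - B) * card J"
        unfolding \<Phi>_def xg W fst_conv snd_conv
      proof (rule mtx_rank_block_mult_le[OF A J(1)])
        show "mtx (D x s)" "mtx (D y s)" "mtx (D (x \<otimes>\<^bsub>N\<^esub> \<theta> g y) s)" for s using Dm c \<theta>c by auto
        show "\<phi> h s \<in> A" if "s \<in> A" for s using bij[OF c(4)] that by (auto simp: bij_betw_def)
        show "B \<subseteq> A" by (auto simp: B_def)
        fix s assume "s \<in> B"
        then have s: "s \<in> A" "\<phi> (g \<otimes>\<^bsub>G\<^esub> h) s = \<phi> g (\<phi> h s)" "\<phi> h s \<in> S" "\<phi> g (\<phi> h s) \<in> S"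
          by (auto simp: B_def)
        define u where "u = \<phi> g (\<phi> h s)"
        have pu: "p u \<in> hom N Q" "u \<in> S" using p s u_def by auto
        \<comment> \<open>Equivariance rewrites the block of the second factor as the image of
          \<open>\<theta> g y\<close> under \<open>p u\<close>, the homomorphism attached to the
          row. Both blocks then come from the same homomorphism and multiply as required.\<close>
        have py: "p (\<phi> h s) y = p u (\<theta> g y)" using bspec[OF bspec[OF bspec[OF eq inF(3)] inF(2)] s(3)] s(4) by (simp add: u_def)
        have pm: "p u (x \<otimes>\<^bsub>N\<^esub> \<theta> g y) = p u x \<otimes>\<^bsub>Q\<^esub> p u (\<theta> g y)"
          using hom_mult[OF pu(1)] c \<theta>c by simp
        have mem: "p u x \<in> FQ" "p u (\<theta> g y) \<in> FQ" "p u (x \<otimes>\<^bsub>N\<^esub> \<theta> g y) \<in> FQ"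
          unfolding FQ_def F3_def using inF pu(2) by force+
        have "real (mtx_rank J J (mtx_diff (\<psi> (p u x \<otimes>\<^bsub>Q\<^esub> p u (\<theta> g y)))
            (mtx_mult J (\<psi> (p u x)) (\<psi> (p u (\<theta> g y)))))) < \<delta> * card J"
          using \<psi> mem unfolding pm by (simp add: approx_rep_def)
        then have "mtx_rank J J (mtx_diff (\<psi> (p u x \<otimes>\<^bsub>Q\<^esub> p u (\<theta> g y)))
            (mtx_mult J (\<psi> (p u x)) (\<psi> (p u (\<theta> g y))))) \<le> r" by (intro r(2)) simp
        then show "\<phi> (g \<otimes>\<^bsub>G\<^esub> h) s = \<phi> g (\<phi> h s) \<and>
            mtx_rank J J (mtx_diff (D (x \<otimes>\<^bsub>N\<^esub> \<theta> g y) (\<phi> (g \<otimes>\<^bsub>G\<^esub> h) s))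
              (mtx_mult J (D x (\<phi> (g \<otimes>\<^bsub>G\<^esub> h) s)) (D y (\<phi> h s)))) \<le> r"
          using s pm py by (simp add: D_def u_def)
      qed
      then have "real (mtx_rank (A \<times> J) (A \<times> J) (mtx_diff (\<Phi> (w \<otimes>\<^bsub>W\<^esub> v)) (mtx_mult (A \<times> J) (\<Phi> w) (\<Phi> v))))
          \<le> card B * real r + card (A - B) * real (card J)"
        by (metis of_nat_add of_nat_le_iff of_nat_mult)
      also have "\<dots> \<le> card A * (\<delta> * card J) + card (A - B) * real (card J)"
        using A r(1) by (intro add_mono mult_mono) (auto simp: B_def intro!: card_mono)
      also have "\<dots> < card A * (\<delta> * card J) + 3 * \<delta> * card A * real (card J)"
        using bad J by (intro add_strict_left_mono mult_strict_right_mono) (auto simp: card_gt_0_iff)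
      also have "\<dots> = 4 * \<delta> * (card A * card J)" by simp
      also have "\<dots> \<le> \<epsilon> * (card A * card J)" using \<delta> by (intro mult_right_mono) auto
      finally show "real (mtx_rank (A \<times> J) (A \<times> J) (mtx_diff (\<Phi> (w \<otimes>\<^bsub>W\<^esub> v))
          (mtx_mult (A \<times> J) (\<Phi> w) (\<Phi> v)))) < \<epsilon> * real (card (A \<times> J))"
        by (simp add: card_cartesian_product)
    qed (use A J Ane in auto)
    moreover have "far_from_one (min c (d / 2)) (A \<times> J) (\<Phi> w)"
      if w: "w \<in> F" "w \<noteq> \<one>\<^bsub>W\<^esub>" "snd w = \<one>\<^bsub>G\<^esub>" for w
    proof -
      have x: "fst w \<in> fst ` F" "fst w \<in> carrier N" "fst w \<noteq> \<one>\<^bsub>N\<^esub>"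
        using w F W by (auto simp: prod_eq_iff)
      have "far_from_one (d / 2) (A \<times> J) (\<Phi> w)"
        unfolding \<Phi>_def
      proof (rule far_from_one_block[OF A J(1)])
        show "mtx (D (fst w) s)" for s using Dm x by simp
        show "\<phi> (snd w) s = s" if "s \<in> A" for s using \<phi>1 that w by simp
        show "far_from_one d J (D (fst w) s)" if "s \<in> S" for s
          using far[of "p s (fst w)"] p x that by (auto simp: D_def FQ_def F3_def)
        have "real (card A) / 2 \<le> (1 - \<delta>) * card A"
          using mult_right_mono[of "1 / 2" "1 - \<delta>" "real (card A)"] \<delta> by simp
        then show "2 * card S > card A" using S by linarith
      qed (use S d in auto)
      then show ?thesis by (rule far_from_one_mono) simp
    qed
    ultimately show "\<exists>(I :: (nat \<times> nat) set) \<phi>. approx_rep W F \<epsilon> I \<phi> \<and>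
      (\<forall>w\<in>F. w \<noteq> \<one>\<^bsub>W\<^esub> \<longrightarrow> snd w = \<one>\<^bsub>G\<^esub> \<longrightarrow> far_from_one (min c (d / 2)) I (\<phi> w))" by blast
  qed
  then show ?thesis by (simp add: W_def)
qed

end

section \<open>Free products and graph products\<close>

definition word_class :: "'v set \<Rightarrow> ('v \<Rightarrow> ('h, 'n) monoid_scheme) \<Rightarrow> ('v \<times> 'h) list \<Rightarrow> ('v \<times> 'h) list set" where
  "word_class V G w = free_product_rel V G `` {w}"

lemma free_product_words_iff:
  "w \<in> free_product_words V G \<longleftrightarrow> (\<forall>(v, g)\<in>set w. v \<in> V \<and> g \<in> carrier (G v))"
  by (auto simp: free_product_words_def in_lists_conv_set)

lemma free_product_words_append [simp]:
  "u @ w \<in> free_product_words V G \<longleftrightarrow> u \<in> free_product_words V G \<and> w \<in> free_product_words V G"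
  by (auto simp: free_product_words_iff)

lemma free_product_words_Nil [simp]: "[] \<in> free_product_words V G"
  by (simp add: free_product_words_iff)

lemma free_product_words_Cons [simp]:
  "(v, g) # w \<in> free_product_words V G \<longleftrightarrow> v \<in> V \<and> g \<in> carrier (G v) \<and> w \<in> free_product_words V G"
  by (auto simp: free_product_words_iff)

locale group_family =
  fixes V :: "'v set" and G :: "'v \<Rightarrow> ('h, 'n) monoid_scheme"
  assumes groups: "v \<in> V \<Longrightarrow> group (G v)"
begin

abbreviation "words \<equiv> free_product_words V G"
abbreviation "rel \<equiv> free_product_rel V G"
abbreviation "step \<equiv> free_product_step V G"
abbreviation "cl \<equiv> word_class V G"

lemma step_words: "(a, b) \<in> step \<Longrightarrow> a \<in> words \<and> b \<in> words"
proof (induction rule: free_product_step.induct)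
  case (mult xs ys v g h)
  interpret group "G v" using groups mult by simp
  show ?case using mult by simp
next
  case (one xs ys v)
  interpret group "G v" using groups one by simp
  show ?case using one by simp
qed

lemma step_context:
  assumes "(a, b) \<in> step" "c \<in> words" "d \<in> words"
  shows "(c @ a @ d, c @ b @ d) \<in> step"
  using assms
proof (induction rule: free_product_step.induct)
  case (mult xs ys v g h)
  then show ?case using free_product_step.mult[of "c @ xs" V G "ys @ d" v g h] by simp
next
  case (one xs ys v)
  then show ?case using free_product_step.one[of "c @ xs" V G "ys @ d" v] by simp
qed

lemma step_rel: "(a, b) \<in> step \<Longrightarrow> (a, b) \<in> rel"
  unfolding free_product_rel_def using step_words by blast

lemma equiv_rel: "equiv words rel"
proof (rule equivI)
  show "rel \<subseteq> words \<times> words" by (auto simp: free_product_rel_def)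
  show "refl_on words rel" by (auto simp: refl_on_def free_product_rel_def)
  have "sym ((step \<union> step\<inverse>)\<^sup>*)" by (intro sym_rtrancl) (auto simp: sym_def)
  then show "sym rel" unfolding free_product_rel_def sym_def by blast
  show "trans rel"
  proof (rule transI)
    fix x y z assume "(x, y) \<in> rel" "(y, z) \<in> rel"
    then show "(x, z) \<in> rel" unfolding free_product_rel_def using rtrancl_trans by auto
  qed
qed

lemma rel_refl: "w \<in> words \<Longrightarrow> (w, w) \<in> rel"
  by (auto simp: free_product_rel_def)

lemma rel_trans: "(a, b) \<in> rel \<Longrightarrow> (b, c) \<in> rel \<Longrightarrow> (a, c) \<in> rel"
  using equiv_rel by (auto simp: equiv_def dest: transD)

lemma rel_words: "(a, b) \<in> rel \<Longrightarrow> a \<in> words \<and> b \<in> words"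
  by (auto simp: free_product_rel_def)

text \<open>Elimination rule for the generated equivalence: it suffices to look at single steps. The
  assumption on \<open>X\<close> gives reflexivity, which starts the chain.\<close>

lemma rel_least:
  assumes "(a, b) \<in> rel" and eq: "equiv X r"
    and step: "\<And>a b. (a, b) \<in> step \<Longrightarrow> (f a, f b) \<in> r" and X: "\<And>w. w \<in> words \<Longrightarrow> f w \<in> X"
  shows "(f a, f b) \<in> r"
proof -
  have ab: "(a, b) \<in> (step \<union> step\<inverse>)\<^sup>*" "a \<in> words" using assms(1) by (auto simp: free_product_rel_def)
  from ab show ?thesis
  proof (induction rule: rtrancl_induct)
    case base
    then show ?case using eq X by (auto simp: equiv_def refl_on_def)
  next
    case (step b c)
    have "(f b, f c) \<in> r"
      using step(2) assms(3) eq by (auto simp: equiv_def sym_def)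
    then show ?case using step eq by (auto simp: equiv_def dest: transD)
  qed
qed

text \<open>One argument is changed at a time, because \<open>rel_least\<close> follows a single
  chain of steps.\<close>

lemma rel_append:
  assumes "(a, a') \<in> rel" "(b, b') \<in> rel"
  shows "(a @ b, a' @ b') \<in> rel"
proof -
  have w: "a \<in> words" "a' \<in> words" "b \<in> words" "b' \<in> words" using assms rel_words by auto
  have "(a @ b, a' @ b) \<in> rel"
    by (rule rel_least[OF assms(1) equiv_rel])
      (use step_context[of _ _ "[]" b] w in \<open>auto intro: step_rel\<close>)
  moreover have "(a' @ b, a' @ b') \<in> rel"
    by (rule rel_least[OF assms(2) equiv_rel])
      (use step_context[of _ _ a' "[]"] w in \<open>auto intro: step_rel\<close>)
  ultimately show ?thesis by (rule rel_trans)
qed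

lemma cl_eq_iff: "a \<in> words \<Longrightarrow> b \<in> words \<Longrightarrow> cl a = cl b \<longleftrightarrow> (a, b) \<in> rel"
  unfolding word_class_def using eq_equiv_class_iff[OF equiv_rel] by blast

lemma mem_cl: "x \<in> cl w \<longleftrightarrow> (w, x) \<in> rel"
  by (simp add: word_class_def)

lemma free_product_carrier: "carrier (free_product V G) = cl ` words"
  by (auto simp: free_product_def quotient_def word_class_def)

lemma cl_closed: "w \<in> words \<Longrightarrow> cl w \<in> carrier (free_product V G)"
  by (simp add: free_product_carrier)

lemma free_product_one: "\<one>\<^bsub>free_product V G\<^esub> = cl []"
  by (simp add: free_product_def word_class_def)

lemma free_product_mult:
  assumes "a \<in> words" "b \<in> words"
  shows "cl a \<otimes>\<^bsub>free_product V G\<^esub> cl b = cl (a @ b)"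
proof -
  \<comment> \<open>Concatenations of members of two classes need not fill a class, which is why the
    multiplication closes them under \<open>rel\<close>; by congruence the closure is the class of
    \<open>a @ b\<close>.\<close>
  have "rel `` {x @ y |x y. x \<in> cl a \<and> y \<in> cl b} = cl (a @ b)"
  proof (intro equalityI subsetI)
    fix z assume "z \<in> rel `` {x @ y |x y. x \<in> cl a \<and> y \<in> cl b}"
    then obtain x y where "(a, x) \<in> rel" "(b, y) \<in> rel" "(x @ y, z) \<in> rel" by (auto simp: mem_cl)
    then show "z \<in> cl (a @ b)" using rel_append rel_trans by (metis mem_cl)
  next
    fix z assume "z \<in> cl (a @ b)"
    then show "z \<in> rel `` {x @ y |x y. x \<in> cl a \<and> y \<in> cl b}"
      using rel_refl[OF assms(1)] rel_refl[OF assms(2)] by (auto simp: mem_cl)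
  qed
  then show ?thesis by (simp add: free_product_def)
qed

text \<open>The inverse of the first letter is appended on the right of the inverse word of the
  rest; one \<open>mult\<close> step and one \<open>one\<close> step cancel the letter.\<close>

lemma left_inverse_word:
  assumes "w \<in> words"
  shows "\<exists>u\<in>words. (u @ w, []) \<in> rel"
  using assms
proof (induction w)
  case Nil
  then show ?case using rel_refl by (intro bexI[of _ "[]"]) auto
next
  case (Cons x w)
  obtain v g where x: "x = (v, g)" by (cases x)
  have vg: "v \<in> V" "g \<in> carrier (G v)" "w \<in> words" using Cons x by auto
  interpret group "G v" using groups vg by simp
  obtain u where u: "u \<in> words" "(u @ w, []) \<in> rel" using Cons vg by auto
  let ?i = "inv\<^bsub>G v\<^esub> g"
  have "(u @ [(v, ?i), (v, g)] @ w, u @ [(v, ?i \<otimes>\<^bsub>G v\<^esub> g)] @ w) \<in> rel"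
    using free_product_step.mult[OF u(1) vg(3,1), of ?i g] vg by (intro step_rel) simp
  moreover have "(u @ [(v, \<one>\<^bsub>G v\<^esub>)] @ w, u @ w) \<in> rel"
    using free_product_step.one[OF u(1) vg(3,1)] by (rule step_rel)
  ultimately have "((u @ [(v, ?i)]) @ x # w, []) \<in> rel"
    using u(2) vg x rel_trans by (metis append.assoc append_Cons append_Nil l_inv)
  then show ?case using u vg by (intro bexI[of _ "u @ [(v, ?i)]"]) auto
qed

lemma group_free_product: "group (free_product V G)"
proof (rule groupI)
  show "\<one>\<^bsub>free_product V G\<^esub> \<in> carrier (free_product V G)"
    by (simp add: free_product_one cl_closed)
  fix x assume "x \<in> carrier (free_product V G)"
  then obtain w where w: "w \<in> words" "x = cl w" by (auto simp: free_product_carrier)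
  then show "\<one>\<^bsub>free_product V G\<^esub> \<otimes>\<^bsub>free_product V G\<^esub> x = x"
    by (simp add: free_product_one free_product_mult)
  obtain u where u: "u \<in> words" "(u @ w, []) \<in> rel" using left_inverse_word w by blast
  then show "\<exists>y\<in>carrier (free_product V G). y \<otimes>\<^bsub>free_product V G\<^esub> x = \<one>\<^bsub>free_product V G\<^esub>"
    using w by (intro bexI[of _ "cl u"]) (auto simp: free_product_one free_product_mult cl_eq_iff cl_closed)
  fix y assume "y \<in> carrier (free_product V G)"
  then obtain w' where w': "w' \<in> words" "y = cl w'" by (auto simp: free_product_carrier)
  then show "x \<otimes>\<^bsub>free_product V G\<^esub> y \<in> carrier (free_product V G)"
    using w by (simp add: free_product_mult cl_closed)
  fix z assume "z \<in> carrier (free_product V G)"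
  then obtain w'' where "w'' \<in> words" "z = cl w''" by (auto simp: free_product_carrier)
  then show "x \<otimes>\<^bsub>free_product V G\<^esub> y \<otimes>\<^bsub>free_product V G\<^esub> z =
      x \<otimes>\<^bsub>free_product V G\<^esub> (y \<otimes>\<^bsub>free_product V G\<^esub> z)"
    using w w' by (simp add: free_product_mult)
qed

end

section \<open>Partial relabellings and the maps they induce on free products\<close>

definition partial_relabel :: "('v \<Rightarrow> 'u option) \<Rightarrow> ('v \<times> 'h) list \<Rightarrow> ('u \<times> 'h) list" where
  "partial_relabel f w = concat (map (\<lambda>(v, h). case f v of None \<Rightarrow> [] | Some u \<Rightarrow> [(u, h)]) w)"

lemma partial_relabel_append [simp]:
  "partial_relabel f (u @ w) = partial_relabel f u @ partial_relabel f w"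
  by (simp add: partial_relabel_def)

lemma partial_relabel_Nil [simp]: "partial_relabel f [] = []"
  by (simp add: partial_relabel_def)

lemma partial_relabel_Cons [simp]:
  "partial_relabel f ((v, h) # w) =
    (case f v of None \<Rightarrow> partial_relabel f w | Some u \<Rightarrow> (u, h) # partial_relabel f w)"
  by (simp add: partial_relabel_def split: option.split)

lemma relabel_eq: "relabel \<sigma> w = partial_relabel (\<lambda>v. Some (\<sigma> v)) w"
  by (induction w) (auto simp: relabel_def)

lemma partial_relabel_comp:
  "partial_relabel g (partial_relabel f w) = partial_relabel (\<lambda>v. Option.bind (f v) g) w"
  by (induction w) (auto split: option.split)

lemma partial_relabel_cong:
  "(\<And>v h. (v, h) \<in> set w \<Longrightarrow> f v = g v) \<Longrightarrow> partial_relabel f w = partial_relabel g w"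
  unfolding partial_relabel_def by (intro arg_cong[where f = concat] map_cong) auto

lemma partial_relabel_Some [simp]: "partial_relabel Some w = w"
  by (induction w) auto

lemma ran_restrict_subset_iff:
  "ran (f |` V) \<subseteq> V' \<longleftrightarrow> (\<forall>v u. v \<in> V \<longrightarrow> f v = Some u \<longrightarrow> u \<in> V')"
  by (auto simp: ran_def restrict_map_def)

lemma partial_relabel_words:
  assumes "ran (f |` V) \<subseteq> V'" "w \<in> free_product_words V (\<lambda>_. H)"
  shows "partial_relabel f w \<in> free_product_words V' (\<lambda>_. H)"
  using assms(2)
proof (induction w)
  case (Cons x w)
  then show ?case using assms(1) unfolding ran_restrict_subset_iff
    by (cases x) (auto split: option.split)
qed simp

context group
begin

text \<open>Steps at a kept index go to steps, and steps at a deleted index become equalities, since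
  the whole factor is sent to 1. So arbitrary partial maps of indices induce homomorphisms.\<close>

lemma partial_relabel_rel:
  assumes f: "ran (f |` V) \<subseteq> V'" and ab: "(a, b) \<in> free_product_rel V (\<lambda>_. G)"
  shows "(partial_relabel f a, partial_relabel f b) \<in> free_product_rel V' (\<lambda>_. G)"
proof -
  interpret A: group_family V "\<lambda>_. G" by unfold_locales
  interpret B: group_family V' "\<lambda>_. G" by unfold_locales
  show ?thesis
  proof (rule A.rel_least[OF ab B.equiv_rel])
    show "partial_relabel f w \<in> B.words" if "w \<in> A.words" for w
      by (rule partial_relabel_words[OF f that])
    fix a b assume "(a, b) \<in> A.step"
    then show "(partial_relabel f a, partial_relabel f b) \<in> B.rel"
    proof (induction rule: free_product_step.induct)
      case (mult xs ys v g h)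
      have w: "partial_relabel f xs \<in> B.words" "partial_relabel f ys \<in> B.words"
        using partial_relabel_words[OF f] mult by auto
      show ?case
      proof (cases "f v")
        case None
        then show ?thesis using w by (simp add: B.rel_refl)
      next
        case (Some u)
        then show ?thesis using f[unfolded ran_restrict_subset_iff] mult w
            B.step_rel[OF free_product_step.mult[OF w, of u g h]] by simp
      qed
    next
      case (one xs ys v)
      have w: "partial_relabel f xs \<in> B.words" "partial_relabel f ys \<in> B.words"
        using partial_relabel_words[OF f] one by auto
      show ?case
      proof (cases "f v")
        case None
        then show ?thesis using w by (simp add: B.rel_refl)
      next
        case (Some u)
        then show ?thesis using f[unfolded ran_restrict_subset_iff] one w
            B.step_rel[OF free_product_step.one[OF w, of u]] by simp
      qed
    qed
  qed
qed

text \<open>The relabelled members of a class need not form a class, hence the closure under the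
  relation.\<close>

definition free_product_map ::
  "'u set \<Rightarrow> ('v \<Rightarrow> 'u option) \<Rightarrow> ('v \<times> 'a) list set \<Rightarrow> ('u \<times> 'a) list set" where
  "free_product_map V' f A = free_product_rel V' (\<lambda>_. G) `` (partial_relabel f ` A)"

lemma free_product_map_class:
  assumes f: "ran (f |` V) \<subseteq> V'" and w: "w \<in> free_product_words V (\<lambda>_. G)"
  shows "free_product_map V' f (word_class V (\<lambda>_. G) w) = word_class V' (\<lambda>_. G) (partial_relabel f w)"
proof -
  interpret A: group_family V "\<lambda>_. G" by unfold_locales
  interpret B: group_family V' "\<lambda>_. G" by unfold_locales
  have "(partial_relabel f w, x) \<in> B.rel" if "(w, y) \<in> A.rel" "(partial_relabel f y, x) \<in> B.rel" for x y
    using partial_relabel_rel[OF f that(1)] that(2) B.rel_trans by blast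
  then show ?thesis
    unfolding free_product_map_def word_class_def using A.rel_refl[OF w] by blast
qed

lemma free_product_map_hom:
  assumes f: "ran (f |` V) \<subseteq> V'"
  shows "free_product_map V' f \<in> hom (free_product V (\<lambda>_. G)) (free_product V' (\<lambda>_. G))"
proof -
  interpret A: group_family V "\<lambda>_. G" by unfold_locales
  interpret B: group_family V' "\<lambda>_. G" by unfold_locales
  note [simp] = free_product_map_class[OF f] partial_relabel_words[OF f]
  show ?thesis
    by (auto simp: hom_def A.free_product_carrier A.free_product_mult B.free_product_mult
        intro!: B.cl_closed)
qed

text \<open>For a bijection of \<open>V\<close> with inverse \<tau> the image is already closed: any
  word related to the relabelled one can be relabelled back. This justifies the plain images in the
  definition of the wreath products.\<close>

lemma relabel_class:
  assumes \<sigma>: "\<And>v. v \<in> V \<Longrightarrow> \<sigma> v \<in> V" "\<And>v. v \<in> V \<Longrightarrow> \<tau> v \<in> V" "\<And>v. v \<in> V \<Longrightarrow> \<sigma> (\<tau> v) = v"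
    "\<And>v. v \<in> V \<Longrightarrow> \<tau> (\<sigma> v) = v"
    and w: "w \<in> free_product_words V (\<lambda>_. G)"
  shows "relabel \<sigma> ` word_class V (\<lambda>_. G) w = word_class V (\<lambda>_. G) (relabel \<sigma> w)"
proof -
  interpret A: group_family V "\<lambda>_. G" by unfold_locales
  have inv: "relabel \<mu> (relabel \<nu> u) = u" if "\<And>v. v \<in> V \<Longrightarrow> \<mu> (\<nu> v) = v" "u \<in> A.words" for \<mu> \<nu> u
    using that(2) by (induction u) (auto simp: relabel_def that(1))
  have ran: "ran ((\<lambda>v. Some (\<sigma> v)) |` V) \<subseteq> V" "ran ((\<lambda>v. Some (\<tau> v)) |` V) \<subseteq> V"
    using \<sigma>(1,2) by (auto simp: ran_restrict_subset_iff)
  show ?thesis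
  proof (intro equalityI subsetI)
    fix x assume "x \<in> relabel \<sigma> ` word_class V (\<lambda>_. G) w"
    then show "x \<in> word_class V (\<lambda>_. G) (relabel \<sigma> w)"
      using partial_relabel_rel[OF ran(1)] by (auto simp: A.mem_cl relabel_eq)
  next
    fix x assume "x \<in> word_class V (\<lambda>_. G) (relabel \<sigma> w)"
    then have x: "(relabel \<sigma> w, x) \<in> A.rel" by (simp add: A.mem_cl)
    then have "(relabel \<tau> (relabel \<sigma> w), relabel \<tau> x) \<in> A.rel"
      using partial_relabel_rel[OF ran(2)] by (auto simp: relabel_eq)
    then have "relabel \<tau> x \<in> word_class V (\<lambda>_. G) w"
      using inv[of \<tau> \<sigma> w, OF \<sigma>(4) w] by (simp add: A.mem_cl)
    moreover have "x = relabel \<sigma> (relabel \<tau> x)"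
      using inv[of \<sigma> \<tau> x, OF \<sigma>(3)] A.rel_words[OF x] by simp
    ultimately show "x \<in> relabel \<sigma> ` word_class V (\<lambda>_. G) w" by (metis imageI)
  qed
qed

section \<open>Normal closures and graph products\<close>

lemma normal_closure_normal:
  assumes "S \<subseteq> carrier G"
  shows "normal_closure G S \<lhd> G"
proof -
  \<comment> \<open>The whole group is among the normal subgroups that are intersected, so the
    family is not empty.\<close>
  have c: "carrier G \<lhd> G"
    unfolding normal_inv_iff by (simp add: subgroup_self)
  have "subgroup (normal_closure G S) G"
    unfolding normal_closure_def
    using c assms by (intro subgroups_Inter) (auto simp: normal_imp_subgroup)
  then show ?thesis
    unfolding normal_inv_iff normal_closure_def by (auto simp: normal_inv_iff)
qed

lemma normal_closure_subset: "S \<subseteq> normal_closure G S"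
  by (auto simp: normal_closure_def)

lemma normal_closure_least: "N \<lhd> G \<Longrightarrow> S \<subseteq> N \<Longrightarrow> normal_closure G S \<subseteq> N"
  by (auto simp: normal_closure_def)

definition graph_commutators ::
  "'v set \<Rightarrow> ('v \<times> 'v) set \<Rightarrow> ('v \<times> 'a) list set set" where
  "graph_commutators V E = (let P = free_product V (\<lambda>_. G); \<iota> = free_product_inj V (\<lambda>_. G) in
     {inv\<^bsub>P\<^esub> \<iota> v h \<otimes>\<^bsub>P\<^esub> inv\<^bsub>P\<^esub> \<iota> w k \<otimes>\<^bsub>P\<^esub> \<iota> v h \<otimes>\<^bsub>P\<^esub> \<iota> w k |v w h k.
       (v, w) \<in> E \<and> h \<in> carrier G \<and> k \<in> carrier G})"

definition graph_kernel :: "'v set \<Rightarrow> ('v \<times> 'v) set \<Rightarrow> ('v \<times> 'a) list set set" where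
  "graph_kernel V E = normal_closure (free_product V (\<lambda>_. G)) (graph_commutators V E)"

definition graph_class :: "'v set \<Rightarrow> ('v \<times> 'v) set \<Rightarrow> ('v \<times> 'a) list \<Rightarrow> ('v \<times> 'a) list set set" where
  "graph_class V E w = graph_kernel V E #>\<^bsub>free_product V (\<lambda>_. G)\<^esub> word_class V (\<lambda>_. G) w"

lemma graph_product_eq: "graph_product V E (\<lambda>_. G) = free_product V (\<lambda>_. G) Mod graph_kernel V E"
  by (simp add: graph_product_def graph_kernel_def graph_commutators_def Let_def)

lemma free_product_inj_eq: "free_product_inj V G' v h = word_class V G' [(v, h)]"
  by (simp add: free_product_inj_def word_class_def)

lemma graph_commutators_carrier:
  assumes "E \<subseteq> V \<times> V"
  shows "graph_commutators V E \<subseteq> carrier (free_product V (\<lambda>_. G))"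
proof -
  interpret A: group_family V "\<lambda>_. G" by unfold_locales
  interpret P: group "free_product V (\<lambda>_. G)" by (rule A.group_free_product)
  show ?thesis
    unfolding graph_commutators_def Let_def free_product_inj_eq
    using assms by (auto intro!: P.m_closed P.inv_closed A.cl_closed)
qed

lemma graph_kernel_normal: "E \<subseteq> V \<times> V \<Longrightarrow> graph_kernel V E \<lhd> free_product V (\<lambda>_. G)"
proof -
  interpret A: group_family V "\<lambda>_. G" by unfold_locales
  interpret P: group "free_product V (\<lambda>_. G)" by (rule A.group_free_product)
  show "E \<subseteq> V \<times> V \<Longrightarrow> ?thesis"
    unfolding graph_kernel_def using P.normal_closure_normal graph_commutators_carrier by blast
qed

lemma group_graph_product: "E \<subseteq> V \<times> V \<Longrightarrow> group (graph_product V E (\<lambda>_. G))"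
  unfolding graph_product_eq using graph_kernel_normal normal.factorgroup_is_group by blast

lemma graph_product_carrier:
  "carrier (graph_product V E (\<lambda>_. G)) = graph_class V E ` free_product_words V (\<lambda>_. G)"
proof -
  interpret A: group_family V "\<lambda>_. G" by unfold_locales
  show ?thesis
    unfolding graph_product_eq carrier_FactGroup A.free_product_carrier by (simp add: graph_class_def image_image)
qed

lemma graph_product_mult:
  assumes "E \<subseteq> V \<times> V" "u \<in> free_product_words V (\<lambda>_. G)" "w \<in> free_product_words V (\<lambda>_. G)"
  shows "graph_class V E u \<otimes>\<^bsub>graph_product V E (\<lambda>_. G)\<^esub> graph_class V E w = graph_class V E (u @ w)"
proof -
  interpret A: group_family V "\<lambda>_. G" by unfold_locales
  interpret N: normal "graph_kernel V E" "free_product V (\<lambda>_. G)" by (rule graph_kernel_normal[OF assms(1)])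
  show ?thesis
    using N.rcos_sum[of "word_class V (\<lambda>_. G) u" "word_class V (\<lambda>_. G) w"] assms A.cl_closed
    by (simp add: graph_product_eq graph_class_def A.free_product_mult)
qed

lemma graph_product_one:
  assumes "E \<subseteq> V \<times> V"
  shows "\<one>\<^bsub>graph_product V E (\<lambda>_. G)\<^esub> = graph_class V E []"
proof -
  interpret A: group_family V "\<lambda>_. G" by unfold_locales
  interpret N: normal "graph_kernel V E" "free_product V (\<lambda>_. G)" by (rule graph_kernel_normal[OF assms])
  show ?thesis
    using N.coset_mult_one[OF N.subset] by (simp add: graph_product_eq graph_class_def A.free_product_one)
qed

end

text \<open>Only edges with both ends kept must be preserved: if an end is deleted, the commutator
  becomes trivial. The notion serves in both directions, for an embedding and, if the embedding also
  reflects edges, for its partial inverse.\<close>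

definition partial_graph_map ::
  "('v \<Rightarrow> 'u option) \<Rightarrow> 'v set \<Rightarrow> ('v \<times> 'v) set \<Rightarrow> 'u set \<Rightarrow> ('u \<times> 'u) set \<Rightarrow> bool" where
  "partial_graph_map f V E V' E' \<longleftrightarrow> ran (f |` V) \<subseteq> V' \<and>
     (\<forall>v w a b. (v, w) \<in> E \<longrightarrow> f v = Some a \<longrightarrow> f w = Some b \<longrightarrow> (a, b) \<in> E')"

context group
begin

text \<open>The preimage \<open>K\<close> of the target kernel is a normal subgroup, so it is enough
  to find the defining commutators in it.\<close>

lemma free_product_map_graph_kernel:
  assumes f: "partial_graph_map f V E V' E'" and E: "E \<subseteq> V \<times> V" "E' \<subseteq> V' \<times> V'"
    and x: "x \<in> graph_kernel V E"
  shows "free_product_map V' f x \<in> graph_kernel V' E'"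
proof -
  interpret A: group_family V "\<lambda>_. G" by unfold_locales
  interpret B: group_family V' "\<lambda>_. G" by unfold_locales
  define P where "P = free_product V (\<lambda>_. G)"
  define P' where "P' = free_product V' (\<lambda>_. G)"
  define F where "F = free_product_map V' f"
  have ran: "ran (f |` V) \<subseteq> V'" using f by (simp add: partial_graph_map_def)
  interpret P: group P unfolding P_def by (rule A.group_free_product)
  interpret P': group P' unfolding P'_def by (rule B.group_free_product)
  interpret F: group_hom P P' F
    unfolding group_hom_def group_hom_axioms_def F_def P_def P'_def
    using free_product_map_hom[OF ran] A.group_free_product B.group_free_product by blast
  interpret N: normal "graph_kernel V' E'" P' unfolding P'_def by (rule graph_kernel_normal[OF E(2)])
  define K where "K = {x \<in> carrier P. F x \<in> graph_kernel V' E'}"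
  have "subgroup K P"
    unfolding K_def by (rule P.subgroupI) (auto intro!: exI[of _ "\<one>\<^bsub>P\<^esub>"])
  then have K: "K \<lhd> P"
    unfolding P.normal_inv_iff using N.inv_op_closed2 by (auto simp: K_def)
  have letter: "F (free_product_inj V (\<lambda>_. G) v h) =
      (case f v of None \<Rightarrow> \<one>\<^bsub>P'\<^esub> | Some u \<Rightarrow> free_product_inj V' (\<lambda>_. G) u h)"
    if "v \<in> V" "h \<in> carrier G" for v h
    unfolding F_def free_product_inj_eq using that free_product_map_class[OF ran, of "[(v, h)]"]
    by (auto simp: P'_def B.free_product_one split: option.split)
  have "graph_commutators V E \<subseteq> K"
  proof
    fix x assume xc: "x \<in> graph_commutators V E"
    then obtain v w h k where x: "x = inv\<^bsub>P\<^esub> free_product_inj V (\<lambda>_. G) v h \<otimes>\<^bsub>P\<^esub>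
        inv\<^bsub>P\<^esub> free_product_inj V (\<lambda>_. G) w k \<otimes>\<^bsub>P\<^esub> free_product_inj V (\<lambda>_. G) v h \<otimes>\<^bsub>P\<^esub>
        free_product_inj V (\<lambda>_. G) w k" and vw: "(v, w) \<in> E" "h \<in> carrier G" "k \<in> carrier G"
      unfolding graph_commutators_def Let_def P_def by blast
    have vV: "v \<in> V" "w \<in> V" using vw E by auto
    have c: "free_product_inj V (\<lambda>_. G) v h \<in> carrier P" "free_product_inj V (\<lambda>_. G) w k \<in> carrier P"
      unfolding free_product_inj_eq P_def using vV vw by (auto intro!: A.cl_closed)
    have c': "free_product_inj V' (\<lambda>_. G) u h \<in> carrier P'" if "u \<in> V'" "h \<in> carrier G" for u h
      unfolding free_product_inj_eq P'_def using that by (auto intro!: B.cl_closed)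
    have uV: "u \<in> V'" if "v \<in> V" "f v = Some u" for v u
      using ran that by (auto simp: ran_restrict_subset_iff)
    have Fx: "F x = inv\<^bsub>P'\<^esub> F (free_product_inj V (\<lambda>_. G) v h) \<otimes>\<^bsub>P'\<^esub>
        inv\<^bsub>P'\<^esub> F (free_product_inj V (\<lambda>_. G) w k) \<otimes>\<^bsub>P'\<^esub> F (free_product_inj V (\<lambda>_. G) v h) \<otimes>\<^bsub>P'\<^esub>
        F (free_product_inj V (\<lambda>_. G) w k)"
      unfolding x using c by simp
    have "F x \<in> graph_kernel V' E'"
    proof (cases "f v")
      \<comment> \<open>With one letter deleted the commutator collapses to an inverse times the
        element itself.\<close>
      case None
      have "F (free_product_inj V (\<lambda>_. G) w k) \<in> carrier P'" using c by simp
      then show ?thesis unfolding Fx letter[OF vV(1) vw(2)] None by simp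
    next
      case v: (Some a)
      show ?thesis
      proof (cases "f w")
        case None
        have "F (free_product_inj V (\<lambda>_. G) v h) \<in> carrier P'" using c by simp
        then show ?thesis unfolding Fx letter[OF vV(2) vw(3)] None by simp
      next
        case w: (Some b)
        have "(a, b) \<in> E'" using f vw v w by (auto simp: partial_graph_map_def)
        then have "F x \<in> graph_commutators V' E'"
          unfolding Fx letter[OF vV(1) vw(2)] letter[OF vV(2) vw(3)] v w option.case
            graph_commutators_def Let_def P'_def using vw by blast
        then show ?thesis unfolding graph_kernel_def by (rule subsetD[OF P'.normal_closure_subset[unfolded P'_def]])
      qed
    qed
    then show "x \<in> K" using xc graph_commutators_carrier[OF E(1)] by (auto simp: K_def P_def)
  qed
  then have "graph_kernel V E \<subseteq> K"
    unfolding graph_kernel_def using P.normal_closure_least[OF K] by (simp add: P_def)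
  then show ?thesis using x by (auto simp: K_def F_def)
qed

text \<open>The induced map of free products, followed by the projection, factors through the
  quotient. The effect on words is recorded because the later arguments compute with words
  only.\<close>

lemma graph_product_map:
  assumes f: "partial_graph_map f V E V' E'" and E: "E \<subseteq> V \<times> V" "E' \<subseteq> V' \<times> V'"
  shows "\<exists>q \<in> hom (graph_product V E (\<lambda>_. G)) (graph_product V' E' (\<lambda>_. G)).
    \<forall>w\<in>free_product_words V (\<lambda>_. G). q (graph_class V E w) = graph_class V' E' (partial_relabel f w)"
proof -
  interpret A: group_family V "\<lambda>_. G" by unfold_locales
  interpret B: group_family V' "\<lambda>_. G" by unfold_locales
  define P where "P = free_product V (\<lambda>_. G)"
  define P' where "P' = free_product V' (\<lambda>_. G)"
  have ran: "ran (f |` V) \<subseteq> V'" using f by (simp add: partial_graph_map_def)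
  interpret P: group P unfolding P_def by (rule A.group_free_product)
  interpret P': group P' unfolding P'_def by (rule B.group_free_product)
  have F: "free_product_map V' f \<in> hom P P'" unfolding P_def P'_def by (rule free_product_map_hom[OF ran])
  interpret N: normal "graph_kernel V E" P unfolding P_def by (rule graph_kernel_normal[OF E(1)])
  interpret N': normal "graph_kernel V' E'" P' unfolding P'_def by (rule graph_kernel_normal[OF E(2)])
  define h where "h x = graph_kernel V' E' #>\<^bsub>P'\<^esub> free_product_map V' f x" for x
  have h: "h \<in> hom P (P' Mod graph_kernel V' E')"
    using Group.hom_compose[OF F N'.r_coset_hom_Mod] by (simp add: h_def[abs_def] comp_def)
  have Nn: "graph_kernel V E \<lhd> P" by (rule N.normal_axioms)
  have eq: "h x = h y" if xy: "x \<in> carrier P" "y \<in> carrier P"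
    "graph_kernel V E #>\<^bsub>P\<^esub> x = graph_kernel V E #>\<^bsub>P\<^esub> y" for x y
  proof -
    have "x \<in> graph_kernel V E #>\<^bsub>P\<^esub> y" using P.rcos_self[OF xy(1) N.subgroup_axioms] xy(3) by simp
    then obtain n where n: "n \<in> graph_kernel V E" "x = n \<otimes>\<^bsub>P\<^esub> y" by (auto simp: r_coset_def)
    have Fn: "free_product_map V' f n \<in> graph_kernel V' E'"
      by (rule free_product_map_graph_kernel[OF f E n(1)])
    have "free_product_map V' f x = free_product_map V' f n \<otimes>\<^bsub>P'\<^esub> free_product_map V' f y"
      using n xy hom_mult[OF F] N.subset by auto
    then have "free_product_map V' f x \<in> graph_kernel V' E' #>\<^bsub>P'\<^esub> free_product_map V' f y"
      using Fn by (auto simp: r_coset_def)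
    then show ?thesis
      unfolding h_def using P'.repr_independence[OF _ _ N'.subgroup_axioms] hom_in_carrier[OF F xy(2)] by metis
  qed
  obtain q where q: "q \<in> hom (P Mod graph_kernel V E) (P' Mod graph_kernel V' E')"
    "\<And>x. x \<in> carrier P \<Longrightarrow> q (graph_kernel V E #>\<^bsub>P\<^esub> x) = h x"
    using FactGroup_universal[OF h Nn eq] by blast
  have "q (graph_class V E w) = graph_class V' E' (partial_relabel f w)" if "w \<in> A.words" for w
    using q(2)[of "word_class V (\<lambda>_. G) w"] A.cl_closed[OF that] free_product_map_class[OF ran that]
    by (simp add: graph_class_def P_def P'_def h_def)
  then show ?thesis using q(1) by (auto simp: graph_product_eq P_def P'_def)
qed

text \<open>Relabelling by a graph automorphism is an automorphism of the free product that maps the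
  kernel onto itself, as \<sigma> and \<tau> both preserve edges; hence cosets go onto
  cosets.\<close>

lemma relabel_graph_class:
  assumes E: "E \<subseteq> V \<times> V" and \<sigma>: "\<And>v. v \<in> V \<Longrightarrow> \<sigma> v \<in> V" "\<And>v. v \<in> V \<Longrightarrow> \<tau> v \<in> V"
    "\<And>v. v \<in> V \<Longrightarrow> \<sigma> (\<tau> v) = v" "\<And>v. v \<in> V \<Longrightarrow> \<tau> (\<sigma> v) = v"
    "\<And>v w. (v, w) \<in> E \<Longrightarrow> (\<sigma> v, \<sigma> w) \<in> E" "\<And>v w. (v, w) \<in> E \<Longrightarrow> (\<tau> v, \<tau> w) \<in> E"
    and w: "w \<in> free_product_words V (\<lambda>_. G)"
  shows "image (relabel \<sigma>) ` graph_class V E w = graph_class V E (relabel \<sigma> w)"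
proof -
  interpret A: group_family V "\<lambda>_. G" by unfold_locales
  define P where "P = free_product V (\<lambda>_. G)"
  interpret P: group P unfolding P_def by (rule A.group_free_product)
  interpret N: normal "graph_kernel V E" P unfolding P_def by (rule graph_kernel_normal[OF E])
  \<comment> \<open>Stated for any inverse pair, since it is used for \<sigma> with inverse \<tau>
    and for \<tau> with inverse \<sigma>.\<close>
  have aut: "relabel \<mu> ` x \<in> graph_kernel V E" "\<And>y. y \<in> carrier P \<Longrightarrow> relabel \<mu> ` (x \<otimes>\<^bsub>P\<^esub> y) = relabel \<mu> ` x \<otimes>\<^bsub>P\<^esub> relabel \<mu> ` y"
    "relabel \<mu> ` relabel \<nu> ` x = x"
    if \<mu>: "\<And>v. v \<in> V \<Longrightarrow> \<mu> v \<in> V" "\<And>v. v \<in> V \<Longrightarrow> \<nu> v \<in> V" "\<And>v. v \<in> V \<Longrightarrow> \<mu> (\<nu> v) = v"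
      "\<And>v. v \<in> V \<Longrightarrow> \<nu> (\<mu> v) = v" "\<And>v w. (v, w) \<in> E \<Longrightarrow> (\<mu> v, \<mu> w) \<in> E"
      and x: "x \<in> graph_kernel V E" for \<mu> \<nu> x
  proof -
    have gm: "partial_graph_map (\<lambda>v. Some (\<mu> v)) V E V E"
      using \<mu>(1,5) by (auto simp: partial_graph_map_def ran_restrict_subset_iff)
    have ran: "ran ((\<lambda>v. Some (\<mu> v)) |` V) \<subseteq> V" using gm by (simp add: partial_graph_map_def)
    have map: "relabel \<mu> ` y = free_product_map V (\<lambda>v. Some (\<mu> v)) y" if "y \<in> carrier P" for y
    proof -
      obtain u where u: "u \<in> A.words" "y = word_class V (\<lambda>_. G) u"
        using \<open>y \<in> carrier P\<close> by (auto simp: P_def A.free_product_carrier)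
      show ?thesis
        unfolding u(2) free_product_map_class[OF ran u(1)] relabel_eq[symmetric]
        by (rule relabel_class[OF \<mu>(1-4) u(1)])
    qed
    have xP: "x \<in> carrier P" using x N.subset by blast
    show "relabel \<mu> ` x \<in> graph_kernel V E"
      unfolding map[OF xP] by (rule free_product_map_graph_kernel[OF gm E E x])
    show "relabel \<mu> ` (x \<otimes>\<^bsub>P\<^esub> y) = relabel \<mu> ` x \<otimes>\<^bsub>P\<^esub> relabel \<mu> ` y" if y: "y \<in> carrier P" for y
      unfolding map[OF xP] map[OF y] map[OF P.m_closed[OF xP y]]
      by (rule hom_mult[OF free_product_map_hom[OF ran, folded P_def] xP y])
    obtain u where u: "u \<in> A.words" "x = word_class V (\<lambda>_. G) u"
      using xP by (auto simp: P_def A.free_product_carrier)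
    have \<nu>u: "relabel \<nu> u \<in> A.words"
      unfolding relabel_eq by (rule partial_relabel_words[OF _ u(1)]) (use \<mu>(2) in \<open>auto simp: ran_restrict_subset_iff\<close>)
    have "relabel \<mu> (relabel \<nu> u) = u"
      using u(1) by (induction u) (auto simp: relabel_def \<mu>(3))
    then show "relabel \<mu> ` relabel \<nu> ` x = x"
      using relabel_class[of V \<nu> \<mu> u, OF \<mu>(2,1,4,3) u(1)]
        relabel_class[of V \<mu> \<nu> "relabel \<nu> u", OF \<mu>(1-4) \<nu>u] u(2) by simp
  qed
  have wP: "word_class V (\<lambda>_. G) w \<in> carrier P" unfolding P_def by (rule A.cl_closed[OF w])
  have cls: "graph_class V E u = (\<lambda>n. n \<otimes>\<^bsub>P\<^esub> word_class V (\<lambda>_. G) u) ` graph_kernel V E" for u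
    by (auto simp: graph_class_def r_coset_def P_def)
  note \<sigma>w = relabel_class[OF \<sigma>(1-4) w]
  show ?thesis
  proof (intro equalityI subsetI)
    fix z assume "z \<in> image (relabel \<sigma>) ` graph_class V E w"
    then obtain n where n: "n \<in> graph_kernel V E" "z = relabel \<sigma> ` (n \<otimes>\<^bsub>P\<^esub> word_class V (\<lambda>_. G) w)"
      by (auto simp: cls)
    then have "z = relabel \<sigma> ` n \<otimes>\<^bsub>P\<^esub> word_class V (\<lambda>_. G) (relabel \<sigma> w)"
      using aut(2)[OF \<sigma>(1-5) n(1) wP] \<sigma>w by simp
    then show "z \<in> graph_class V E (relabel \<sigma> w)" using aut(1)[OF \<sigma>(1-5) n(1)] by (auto simp: cls)
  next
    fix z assume "z \<in> graph_class V E (relabel \<sigma> w)"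
    then obtain m where m: "m \<in> graph_kernel V E" "z = m \<otimes>\<^bsub>P\<^esub> word_class V (\<lambda>_. G) (relabel \<sigma> w)"
      by (auto simp: cls)
    define n where "n = relabel \<tau> ` m"
    have n: "n \<in> graph_kernel V E" unfolding n_def by (rule aut(1)[OF \<sigma>(2,1,4,3,6) m(1)])
    have "relabel \<sigma> ` (n \<otimes>\<^bsub>P\<^esub> word_class V (\<lambda>_. G) w) = z"
      using aut(2)[OF \<sigma>(1-5) n wP] aut(3)[OF \<sigma>(1-5) m(1)] m(2) \<sigma>w by (simp add: n_def)
    then show "z \<in> image (relabel \<sigma>) ` graph_class V E w" using n by (auto simp: cls)
  qed
qed

end

section \<open>Wreath products\<close>

definition universal_graph :: "('v::infinite \<times> 'v) set \<Rightarrow> bool" where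
  "universal_graph U \<longleftrightarrow> simple_graph UNIV U \<and> (\<forall>(B :: nat set) D. finite B \<longrightarrow> simple_graph B D \<longrightarrow>
     (\<exists>\<iota>. inj_on \<iota> B \<and> (\<forall>x\<in>B. \<forall>y\<in>B. (\<iota> x, \<iota> y) \<in> U \<longleftrightarrow> (x, y) \<in> D)))"

text \<open>The disjoint union of all finite graphs on natural numbers, which are countably many.\<close>

lemma universal_graph_exists: "\<exists>U :: ('v::infinite \<times> 'v) set. universal_graph U"
proof -
  obtain e :: "nat \<Rightarrow> 'v" where e: "inj e"
    using infinite_countable_subset[OF infinite_UNIV[where 'a = 'v]] by blast
  \<comment> \<open>A vertex is a natural number \<open>b\<close> tagged with an edge list
    \<open>l\<close>; the tag keeps the copies of different graphs apart. A graph may occur several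
    times, once for each listing of its edges.\<close>
  define vert where "vert l b = e (to_nat (l, b))" for l :: "(nat \<times> nat) list" and b :: nat
  have vert: "vert l b = vert l' b' \<longleftrightarrow> l = l' \<and> b = b'" for l b l' b'
    unfolding vert_def using e by (auto dest: injD)
  \<comment> \<open>Only lists that describe simple graphs contribute edges, which makes the union
    symmetric and irreflexive.\<close>
  define U where "U = {(vert l b, vert l b') |l b b'. (b, b') \<in> set l \<and> sym (set l) \<and> irrefl (set l)}"
  have "simple_graph UNIV U"
    unfolding simple_graph_def U_def by (auto simp: sym_def irrefl_def vert)
  moreover have "\<exists>\<iota>. inj_on \<iota> B \<and> (\<forall>x\<in>B. \<forall>y\<in>B. (\<iota> x, \<iota> y) \<in> U \<longleftrightarrow> (x, y) \<in> D)"
    if B: "finite B" "simple_graph B D" for B :: "nat set" and D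
  proof -
    have D: "D \<subseteq> B \<times> B" "sym D" "irrefl D" using B by (auto simp: simple_graph_def)
    then have "finite D" using B(1) finite_subset by blast
    then obtain l where l: "set l = D" using finite_list by blast
    show ?thesis
      by (rule exI[of _ "vert l"]) (use D in \<open>auto simp: inj_on_def vert U_def l\<close>)
  qed
  ultimately show ?thesis unfolding universal_graph_def by blast
qed

text \<open>A set is regarded as an edgeless graph, with edgeless targets, so that the free wreath
  product falls under the argument for graphs.\<close>

lemma (in group_action) graph_sofic_of_sofic:
  assumes "sofic_action G E \<phi>"
  shows "sofic_graph_action G E {} \<phi>"
  unfolding sofic_graph_action_def
proof (intro conjI allI impI)
  show "graph_action G E {} \<phi>"
    using group_action_axioms by (auto simp: graph_action_def simple_graph_def sym_def irrefl_def)
  fix F D and \<epsilon> :: real assume F: "finite F" "F \<subseteq> carrier G" "finite D" "D \<subseteq> E" "\<epsilon> > 0"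
  from assms[unfolded sofic_action_def, THEN conjunct2, rule_format, OF F] obtain A :: "nat set" and \<psi> where A: "finite A" "\<psi> \<in> carrier G \<rightarrow> carrier (BijGroup A)"
    "unital G A \<psi>" "approx_multiplicative G F \<epsilon> A \<psi>" "orbit_approximation G \<phi> F D \<epsilon> A \<psi>"
    by (elim exE conjE) (rule that)
  from A(5) obtain B :: "nat set" and S \<pi> where B: "finite B" "S \<subseteq> A" "real (card S) > (1 - \<epsilon>) * real (card A)"
    "\<forall>s\<in>S. \<pi> s \<in> D \<rightarrow> B \<and> inj_on (\<pi> s) D"
    "\<forall>g\<in>F. \<forall>x\<in>D. \<forall>s\<in>S. \<psi> g s \<in> S \<longrightarrow> \<phi> (inv\<^bsub>G\<^esub> g) x \<in> D \<longrightarrow> \<pi> (\<psi> g s) x = \<pi> s (\<phi> (inv\<^bsub>G\<^esub> g) x)"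
    unfolding orbit_approximation_def by (elim exE conjE) (rule that)
  have "graph_orbit_approximation G {} \<phi> F D \<epsilon> A \<psi>"
    unfolding graph_orbit_approximation_def
    by (rule exI[of _ B], rule exI[of _ "{}"], rule exI[of _ S], rule exI[of _ \<pi>])
      (use B in \<open>simp add: simple_graph_def sym_def irrefl_def\<close>)
  then show "\<exists>(A :: nat set) \<psi>. finite A \<and> \<psi> \<in> carrier G \<rightarrow> carrier (BijGroup A) \<and> unital G A \<psi> \<and>
      approx_multiplicative G F \<epsilon> A \<psi> \<and> graph_orbit_approximation G {} \<phi> F D \<epsilon> A \<psi>"
    using A by blast
qed

section \<open>The three wreath products\<close>

context field begin

text \<open>Free and graph wreath products are treated together: \<open>N\<close> and \<open>Q\<close> are the products over \<open>Y\<close> and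
  over the universal graph, \<open>\<kappa>\<close> and \<open>\<kappa>'\<close> send words to their classes. Working with one fixed \<open>Q\<close>
  keeps the constant of linear soficity independent of the approximation.\<close>

lemma word_wreath_strongly_sofic:
  fixes \<Gamma> :: "('g, 'n) monoid_scheme" and H :: "('h, 'l) monoid_scheme" and \<beta> :: "'g \<Rightarrow> 'y \<Rightarrow> 'y"
    and N :: "('e, 'o) monoid_scheme" and Q :: "('q, 'p) monoid_scheme" and U :: "('v::infinite \<times> 'v) set"
  assumes \<Gamma>: "strongly_sofic \<Gamma> c" and Q: "strongly_sofic Q d" "d > 0" and sof: "sofic_graph_action \<Gamma> Y E \<beta>"
    and N: "group N" "carrier N = \<kappa> ` free_product_words Y (\<lambda>_. H)" "\<one>\<^bsub>N\<^esub> = \<kappa> []"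
      "\<And>u w. u \<in> free_product_words Y (\<lambda>_. H) \<Longrightarrow> w \<in> free_product_words Y (\<lambda>_. H) \<Longrightarrow>
        \<kappa> u \<otimes>\<^bsub>N\<^esub> \<kappa> w = \<kappa> (u @ w)"
    and \<theta>: "\<And>g w. g \<in> carrier \<Gamma> \<Longrightarrow> w \<in> free_product_words Y (\<lambda>_. H) \<Longrightarrow> \<theta> g (\<kappa> w) = \<kappa> (relabel (\<beta> g) w)"
    and U: "universal_graph U"
    and hom_into: "\<And>f. partial_graph_map f Y E UNIV U \<Longrightarrow>
      \<exists>q \<in> hom N Q. \<forall>w\<in>free_product_words Y (\<lambda>_. H). q (\<kappa> w) = \<kappa>' (partial_relabel f w)"
    and hom_back: "\<And>f. partial_graph_map f UNIV U Y E \<Longrightarrow>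
      \<exists>q \<in> hom Q N. \<forall>w\<in>free_product_words UNIV (\<lambda>_. H). q (\<kappa>' w) = \<kappa> (partial_relabel f w)"
  shows "strongly_sofic (semidirect_product N \<Gamma> \<theta>) (min c (d / 2))"
proof (rule semidirect_strongly_sofic[OF _ \<Gamma> Q(2)])
  let ?W = "free_product_words Y (\<lambda>_. H)"
  have gQ: "group Q" and g\<Gamma>: "group \<Gamma>" using Q \<Gamma> by (auto simp: strongly_sofic_def)
  have ga: "graph_action \<Gamma> Y E \<beta>" using sof by (simp add: sofic_graph_action_def)
  interpret \<Gamma>: group \<Gamma> by (rule g\<Gamma>)
  interpret act: group_action \<Gamma> Y \<beta> using ga by (simp add: graph_action_def)
  have \<beta>Y: "\<beta> g y \<in> Y" if "g \<in> carrier \<Gamma>" "y \<in> Y" for g y using act.element_image that by blast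
  have rW: "relabel (\<beta> g) w \<in> ?W" if "g \<in> carrier \<Gamma>" "w \<in> ?W" for g w
    unfolding relabel_eq using that \<beta>Y
    by (intro partial_relabel_words[where V = Y]) (auto simp: ran_restrict_subset_iff)
  show "group_automorphism_action N \<Gamma> \<theta>"
  proof (rule group_automorphism_action.intro)
    show "group N" "group \<Gamma>" by (rule N(1), rule g\<Gamma>)
  next
    fix g assume g: "g \<in> carrier \<Gamma>"
    show "\<theta> g \<in> hom N N"
      using g rW by (auto simp: hom_def N(2,4) \<theta> relabel_def)
  next
    fix x assume "x \<in> carrier N"
    then obtain w where w: "w \<in> ?W" "x = \<kappa> w" using N(2) by auto
    have "relabel (\<beta> \<one>\<^bsub>\<Gamma>\<^esub>) w = w"
      using w(1) act.id_eq_one[symmetric] by (induction w) (auto simp: relabel_def)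
    then show "\<theta> \<one>\<^bsub>\<Gamma>\<^esub> x = x" using w \<theta> by simp
    fix g h assume gh: "g \<in> carrier \<Gamma>" "h \<in> carrier \<Gamma>"
    have "relabel (\<beta> (g \<otimes>\<^bsub>\<Gamma>\<^esub> h)) w = relabel (\<beta> g) (relabel (\<beta> h) w)"
      using w(1) gh act.composition_rule by (induction w) (auto simp: relabel_def)
    then show "\<theta> (g \<otimes>\<^bsub>\<Gamma>\<^esub> h) x = \<theta> g (\<theta> h x)" using w \<theta> gh rW by simp
  qed
  fix F1 F2 and \<epsilon> :: real
  assume F: "finite F1" "F1 \<subseteq> carrier \<Gamma>" "finite F2" "F2 \<subseteq> carrier N" "\<epsilon> > 0"
  have "F2 \<subseteq> \<kappa> ` ?W" using F(4) unfolding N(2) .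
  then have "\<forall>x\<in>F2. \<exists>w. w \<in> ?W \<and> \<kappa> w = x" by blast
  then obtain wd where wd: "\<And>x. x \<in> F2 \<Longrightarrow> wd x \<in> ?W" "\<And>x. x \<in> F2 \<Longrightarrow> \<kappa> (wd x) = x" by metis
  define E0 where "E0 = (\<Union>x\<in>F2. fst ` set (wd x))"
  \<comment> \<open>Translates of the letter indices are added so that the orbit condition can be
    applied at \<open>\<beta> g v\<close>, whose preimage \<open>v\<close> lies in \<open>E1\<close>
    as well.\<close>
  define E1 where "E1 = E0 \<union> (\<lambda>(g, y). \<beta> g y) ` (F1 \<times> E0)"
  have E0: "finite E0" "E0 \<subseteq> Y"
  proof -
    show "finite E0" using F by (simp add: E0_def)
    show "E0 \<subseteq> Y"
    proof
      fix y assume "y \<in> E0"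
      then obtain x h where "x \<in> F2" "(y, h) \<in> set (wd x)" by (auto simp: E0_def)
      then show "y \<in> Y" using wd(1)[of x] by (auto simp: free_product_words_iff)
    qed
  qed
  have E1: "finite E1" "E1 \<subseteq> Y"
    unfolding E1_def using E0 F \<beta>Y by (auto simp: subset_iff)
  from sof[unfolded sofic_graph_action_def, THEN conjunct2, rule_format, OF F(1,2) E1 F(5)]
  obtain A :: "nat set" and \<phi> where A: "finite A" "\<phi> \<in> carrier \<Gamma> \<rightarrow> carrier (BijGroup A)"
    "unital \<Gamma> A \<phi>" "approx_multiplicative \<Gamma> F1 \<epsilon> A \<phi>" "graph_orbit_approximation \<Gamma> E \<beta> F1 E1 \<epsilon> A \<phi>"
    by (elim exE conjE) (rule that)
  from A(5) obtain B :: "nat set" and D S \<pi> where B: "finite B" "simple_graph B D" "S \<subseteq> A"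
    "real (card S) > (1 - \<epsilon>) * real (card A)"
    and emb: "\<forall>s\<in>S. \<pi> s \<in> E1 \<rightarrow> B \<and> inj_on (\<pi> s) E1 \<and>
        (\<forall>x\<in>E1. \<forall>y\<in>E1. (\<pi> s x, \<pi> s y) \<in> D \<longleftrightarrow> (x, y) \<in> E)"
    and equi: "\<forall>g\<in>F1. \<forall>x\<in>E1. \<forall>s\<in>S. \<phi> g s \<in> S \<longrightarrow> \<beta> (inv\<^bsub>\<Gamma>\<^esub> g) x \<in> E1 \<longrightarrow>
        \<pi> (\<phi> g s) x = \<pi> s (\<beta> (inv\<^bsub>\<Gamma>\<^esub> g) x)"
    unfolding graph_orbit_approximation_def by (elim exE conjE) (rule that)
  from U[unfolded universal_graph_def, THEN conjunct2, rule_format, OF B(1,2)]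
  obtain \<iota> where \<iota>: "inj_on \<iota> B" "\<forall>x\<in>B. \<forall>y\<in>B. (\<iota> x, \<iota> y) \<in> U \<longleftrightarrow> (x, y) \<in> D"
    by (elim exE conjE) (rule that)
  \<comment> \<open>The finite graph \<open>B\<close> varies with the approximation; the embedding
    \<iota> moves everything into the fixed universal graph.\<close>
  define \<rho> where "\<rho> s y = \<iota> (\<pi> s y)" for s y
  have \<rho>: "inj_on (\<rho> s) E1" "\<And>x y. x \<in> E1 \<Longrightarrow> y \<in> E1 \<Longrightarrow> (\<rho> s x, \<rho> s y) \<in> U \<longleftrightarrow> (x, y) \<in> E" if "s \<in> S" for s
  proof -
    have s: "\<pi> s ` E1 \<subseteq> B" "inj_on (\<pi> s) E1" using bspec[OF emb that] by blast+
    have "inj_on (\<iota> \<circ> \<pi> s) E1" by (rule comp_inj_on[OF s(2) inj_on_subset[OF \<iota>(1) s(1)]])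
    then show "inj_on (\<rho> s) E1" by (simp add: \<rho>_def[abs_def] comp_def)
    fix x y assume xy: "x \<in> E1" "y \<in> E1"
    have "(\<pi> s x, \<pi> s y) \<in> D \<longleftrightarrow> (x, y) \<in> E"
      using bspec[OF bspec[OF conjunct2[OF conjunct2[OF bspec[OF emb that]]] xy(1)] xy(2)] .
    moreover have "\<pi> s x \<in> B" "\<pi> s y \<in> B" using s(1) xy by blast+
    ultimately show "(\<rho> s x, \<rho> s y) \<in> U \<longleftrightarrow> (x, y) \<in> E" by (simp add: \<rho>_def \<iota>(2))
  qed
  \<comment> \<open>Letters outside \<open>E1\<close> are deleted: this extends the relabelling to
    all of \<open>N\<close> although \<open>\<pi> s\<close> is controlled on \<open>E1\<close>
    only.\<close>
  define f where "f s y = (if y \<in> E1 then Some (\<rho> s y) else None)" for s y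
  have f: "partial_graph_map (f s) Y E UNIV U" if "s \<in> S" for s
    using \<rho>(2)[OF that] by (auto simp: partial_graph_map_def f_def split: if_splits)
  have "\<forall>s\<in>S. \<exists>q. q \<in> hom N Q \<and> (\<forall>w\<in>?W. q (\<kappa> w) = \<kappa>' (partial_relabel (f s) w))"
    using hom_into[OF f] by blast
  then obtain p where p: "\<And>s. s \<in> S \<Longrightarrow> p s \<in> hom N Q"
    "\<And>s w. s \<in> S \<Longrightarrow> w \<in> ?W \<Longrightarrow> p s (\<kappa> w) = \<kappa>' (partial_relabel (f s) w)" by metis
  have nontriv: "p s x \<noteq> \<one>\<^bsub>Q\<^esub>" if s: "s \<in> S" and x: "x \<in> F2" "x \<noteq> \<one>\<^bsub>N\<^esub>" for s x
  proof
    assume eq: "p s x = \<one>\<^bsub>Q\<^esub>"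
    \<comment> \<open>The partial inverse of \<open>\<rho> s\<close> is a graph map since
      \<open>\<rho> s\<close> reflects edges. It induces a map back to \<open>N\<close> that sends
      \<open>p s x\<close> to \<open>x\<close>, so a nontrivial \<open>x\<close> has nontrivial
      image.\<close>
    define r where "r u = (if u \<in> \<rho> s ` E1 then Some (inv_into E1 (\<rho> s) u) else None)" for u
    have "partial_graph_map r UNIV U Y E"
      using E1(2) \<rho>[OF s] inv_into_into[of _ "\<rho> s" E1]
      by (auto simp: partial_graph_map_def r_def ran_restrict_subset_iff split: if_splits)
    from hom_back[OF this] obtain q where q: "q \<in> hom Q N"
      "\<forall>w\<in>free_product_words UNIV (\<lambda>_. H). q (\<kappa>' w) = \<kappa> (partial_relabel r w)"
      by (elim bexE) (rule that)
    have w: "partial_relabel (f s) (wd x) \<in> free_product_words UNIV (\<lambda>_. H)"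
      by (rule partial_relabel_words[OF _ wd(1)[OF x(1)]]) simp
    have "partial_relabel r (partial_relabel (f s) (wd x)) = partial_relabel Some (wd x)"
      unfolding partial_relabel_comp
    proof (rule partial_relabel_cong)
      fix v h assume "(v, h) \<in> set (wd x)"
      then have "v \<in> E1" using x(1) by (force simp: E1_def E0_def)
      then show "Option.bind (f s v) r = Some v" using \<rho>(1)[OF s] by (simp add: f_def r_def)
    qed
    then have "q (p s x) = x"
      using p(2)[OF s wd(1)[OF x(1)]] bspec[OF q(2) w] wd(2)[OF x(1)] by simp
    then show False using eq x(2) hom_one[OF q(1) gQ N(1)] by simp
  qed
  have equiv: "p (\<phi> g s) (\<theta> g x) = p s x"
    if g: "g \<in> F1" and x: "x \<in> F2" and s: "s \<in> S" "\<phi> g s \<in> S" for g x s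
  proof -
    have gc: "g \<in> carrier \<Gamma>" using g F by auto
    have "partial_relabel (f (\<phi> g s)) (relabel (\<beta> g) (wd x)) = partial_relabel (f s) (wd x)"
      unfolding relabel_eq partial_relabel_comp
    proof (rule partial_relabel_cong)
      fix v h assume "(v, h) \<in> set (wd x)"
      then have v0: "v \<in> E0" using x by (force simp: E0_def)
      then have v: "v \<in> E1" "\<beta> g v \<in> E1" "v \<in> Y" using g E0 by (auto simp: E1_def)
      have inv: "\<beta> (inv\<^bsub>\<Gamma>\<^esub> g) (\<beta> g v) = v" using act.orbit_sym_aux[OF gc v(3) refl] .
      have "\<pi> (\<phi> g s) (\<beta> g v) = \<pi> s v" using equi g v s inv by metis
      then show "Option.bind (Some (\<beta> g v)) (f (\<phi> g s)) = f s v"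
        using v by (simp add: f_def \<rho>_def)
    qed
    then show ?thesis
      using p(2)[OF s(1) wd(1)[OF x]] p(2)[OF s(2) rW[OF gc wd(1)[OF x]]] wd(2)[OF x]
        \<theta>[OF gc wd(1)[OF x]] by simp
  qed
  have "equivariant_model N \<Gamma> \<theta> Q F1 F2 \<epsilon>"
    unfolding equivariant_model_def using A B p(1) nontriv equiv
    by (intro exI[of _ A] exI[of _ \<phi>] exI[of _ S] exI[of _ p] conjI ballI impI) auto
  then show "\<exists>Q :: ('q, 'p) monoid_scheme. strongly_sofic Q d \<and> equivariant_model N \<Gamma> \<theta> Q F1 F2 \<epsilon>"
    using Q(1) by blast
qed

text \<open>In a free product there are no relations between different factors, so every partial map
  of indices induces a homomorphism, in either direction.\<close>

lemma free_wreath_strongly_sofic: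
  fixes \<Gamma> :: "'g monoid" and H :: "'h monoid"
  assumes \<Gamma>: "strongly_sofic \<Gamma> c" and H: "group H" and sof: "sofic_action \<Gamma> X \<alpha>"
    and Q: "strongly_sofic (free_product (UNIV :: 'v::infinite set) (\<lambda>_. H)) d" "d > 0"
  shows "strongly_sofic (free_wreath_product H \<Gamma> X \<alpha>) (min c (d / 2))"
proof -
  interpret H: group H by (rule H)
  interpret A: group_family X "\<lambda>_. H" by unfold_locales
  interpret B: group_family "UNIV :: 'v set" "\<lambda>_. H" by unfold_locales
  interpret act: group_action \<Gamma> X \<alpha> using sof by (simp add: sofic_action_def)
  interpret \<Gamma>: group \<Gamma> using \<Gamma> by (simp add: strongly_sofic_def)
  obtain U :: "('v \<times> 'v) set" where U: "universal_graph U" using universal_graph_exists by blast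
  show ?thesis
    unfolding free_wreath_product_def
  proof (rule word_wreath_strongly_sofic[OF \<Gamma> Q act.graph_sofic_of_sofic[OF sof], where \<kappa> = "A.cl" and \<kappa>' = "B.cl"])
    show "group (free_product X (\<lambda>_. H))" by (rule A.group_free_product)
    show "carrier (free_product X (\<lambda>_. H)) = A.cl ` A.words" by (rule A.free_product_carrier)
    show "\<one>\<^bsub>free_product X (\<lambda>_. H)\<^esub> = A.cl []" by (rule A.free_product_one)
    show "universal_graph U" by (rule U)
    show "relabel (\<alpha> g) ` A.cl w = A.cl (relabel (\<alpha> g) w)" if "g \<in> carrier \<Gamma>" "w \<in> A.words" for g w
    proof (rule H.relabel_class[where \<tau> = "\<alpha> (inv\<^bsub>\<Gamma>\<^esub> g)"])
      show "\<alpha> (inv\<^bsub>\<Gamma>\<^esub> g) (\<alpha> g v) = v" if "v \<in> X" for v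
        using act.orbit_sym_aux[OF \<open>g \<in> carrier \<Gamma>\<close> that refl] .
      show "\<alpha> g (\<alpha> (inv\<^bsub>\<Gamma>\<^esub> g) v) = v" if "v \<in> X" for v
        using act.orbit_sym_aux[OF \<Gamma>.inv_closed[OF \<open>g \<in> carrier \<Gamma>\<close>] that refl] \<open>g \<in> carrier \<Gamma>\<close> by simp
    qed (use that act.element_image[OF _ _ refl] \<Gamma>.inv_closed in auto)
  next
    fix f assume "partial_graph_map f X {} (UNIV :: 'v set) U"
    then have ran: "ran (f |` X) \<subseteq> (UNIV :: 'v set)" by simp
    show "\<exists>q\<in>hom (free_product X (\<lambda>_. H)) (free_product UNIV (\<lambda>_. H)).
        \<forall>w\<in>A.words. q (A.cl w) = B.cl (partial_relabel f w)"
      by (intro bexI[OF _ H.free_product_map_hom[OF ran]] ballI H.free_product_map_class[OF ran])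
  next
    fix f assume "partial_graph_map f (UNIV :: 'v set) U X {}"
    then have ran: "ran (f |` (UNIV :: 'v set)) \<subseteq> X" by (simp add: partial_graph_map_def)
    show "\<exists>q\<in>hom (free_product UNIV (\<lambda>_. H)) (free_product X (\<lambda>_. H)).
        \<forall>w\<in>B.words. q (B.cl w) = A.cl (partial_relabel f w)"
      by (intro bexI[OF _ H.free_product_map_hom[OF ran]] ballI H.free_product_map_class[OF ran])
  qed (rule A.free_product_mult)
qed

text \<open>Both families of homomorphisms come from \<open>graph_product_map\<close>. The constant
  \<open>d\<close> of the graph product over the universal graph is fixed before any approximation
  is chosen.\<close>

lemma graph_wreath_strongly_sofic:
  fixes \<Gamma> :: "'g monoid" and H :: "'h monoid" and U :: "('v::infinite \<times> 'v) set"
  assumes \<Gamma>: "strongly_sofic \<Gamma> c" and H: "group H" and sof: "sofic_graph_action \<Gamma> Y E \<beta>"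
    and U: "universal_graph U" and Q: "strongly_sofic (graph_product UNIV U (\<lambda>_. H)) d" "d > 0"
  shows "strongly_sofic (graph_wreath_product \<Gamma> H Y E \<beta>) (min c (d / 2))"
proof -
  interpret H: group H by (rule H)
  have ga: "graph_action \<Gamma> Y E \<beta>" using sof by (simp add: sofic_graph_action_def)
  interpret act: group_action \<Gamma> Y \<beta> using ga by (simp add: graph_action_def)
  interpret \<Gamma>: group \<Gamma> using \<Gamma> by (simp add: strongly_sofic_def)
  have E: "E \<subseteq> Y \<times> Y" using ga by (simp add: graph_action_def simple_graph_def)
  have UU: "U \<subseteq> UNIV \<times> UNIV" by simp
  have edge: "(\<beta> g v, \<beta> g w) \<in> E" if "g \<in> carrier \<Gamma>" "(v, w) \<in> E" for g v w
    using ga E that by (auto simp: graph_action_def)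
  show ?thesis
    unfolding graph_wreath_product_def
  proof (rule word_wreath_strongly_sofic[OF \<Gamma> Q sof, where \<kappa> = "H.graph_class Y E" and \<kappa>' = "H.graph_class UNIV U"])
    show "group (graph_product Y E (\<lambda>_. H))" by (rule H.group_graph_product[OF E])
    show "carrier (graph_product Y E (\<lambda>_. H)) = H.graph_class Y E ` free_product_words Y (\<lambda>_. H)"
      by (rule H.graph_product_carrier)
    show "\<one>\<^bsub>graph_product Y E (\<lambda>_. H)\<^esub> = H.graph_class Y E []" by (rule H.graph_product_one[OF E])
    show "universal_graph U" by (rule U)
    show "image (relabel (\<beta> g)) ` H.graph_class Y E w = H.graph_class Y E (relabel (\<beta> g) w)"
      if "g \<in> carrier \<Gamma>" "w \<in> free_product_words Y (\<lambda>_. H)" for g w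
    proof (rule H.relabel_graph_class[OF E, where \<tau> = "\<beta> (inv\<^bsub>\<Gamma>\<^esub> g)"])
      show "\<beta> (inv\<^bsub>\<Gamma>\<^esub> g) (\<beta> g v) = v" if "v \<in> Y" for v
        using act.orbit_sym_aux[OF \<open>g \<in> carrier \<Gamma>\<close> that refl] .
      show "\<beta> g (\<beta> (inv\<^bsub>\<Gamma>\<^esub> g) v) = v" if "v \<in> Y" for v
        using act.orbit_sym_aux[OF \<Gamma>.inv_closed[OF \<open>g \<in> carrier \<Gamma>\<close>] that refl] \<open>g \<in> carrier \<Gamma>\<close> by simp
    qed (use that act.element_image[OF _ _ refl] \<Gamma>.inv_closed edge in auto)
  next
    fix f assume "partial_graph_map f Y E (UNIV :: 'v set) U"
    then show "\<exists>q\<in>hom (graph_product Y E (\<lambda>_. H)) (graph_product UNIV U (\<lambda>_. H)).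
        \<forall>w\<in>free_product_words Y (\<lambda>_. H). q (H.graph_class Y E w) = H.graph_class UNIV U (partial_relabel f w)"
      by (rule H.graph_product_map[OF _ E UU])
  next
    fix f assume "partial_graph_map f (UNIV :: 'v set) U Y E"
    then show "\<exists>q\<in>hom (graph_product UNIV U (\<lambda>_. H)) (graph_product Y E (\<lambda>_. H)).
        \<forall>w\<in>free_product_words UNIV (\<lambda>_. H). q (H.graph_class UNIV U w) = H.graph_class Y E (partial_relabel f w)"
      by (rule H.graph_product_map[OF _ UU E])
  qed (rule H.graph_product_mult[OF E])
qed

text \<open>Here the auxiliary group is the power of \<open>H\<close> over the set \<open>B\<close>
  of the approximation. It varies, but all these powers share the constant \<open>d\<close> by
  \<open>strongly_sofic_power\<close>.\<close>

lemma wreath_strongly_sofic: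
  fixes \<Gamma> :: "'g monoid" and H :: "'h monoid" and X :: "'x set"
  assumes \<Gamma>: "strongly_sofic \<Gamma> c" and H: "strongly_sofic H d" "d > 0" and sof: "sofic_action \<Gamma> X \<alpha>"
  shows "strongly_sofic (wreath_product H \<Gamma> X \<alpha>) (min c (d / 2))"
  unfolding wreath_product_def
proof (rule semidirect_strongly_sofic[OF _ \<Gamma> H(2)])
  interpret H: group H using H by (simp add: strongly_sofic_def)
  interpret \<Gamma>: group \<Gamma> using \<Gamma> by (simp add: strongly_sofic_def)
  interpret act: group_action \<Gamma> X \<alpha> using sof by (simp add: sofic_action_def)
  define \<theta> where "\<theta> g f = (\<lambda>x\<in>X. f (\<alpha> (inv\<^bsub>\<Gamma>\<^esub> g) x))" for g and f :: "'x \<Rightarrow> 'h"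
  have \<alpha>X: "\<alpha> g x \<in> X" if "g \<in> carrier \<Gamma>" "x \<in> X" for g x using act.element_image that by blast
  let ?N = "sum_group X (\<lambda>_. H)"
  have N: "carrier ?N = {f \<in> X \<rightarrow>\<^sub>E carrier H. finite {x \<in> X. f x \<noteq> \<one>\<^bsub>H\<^esub>}}"
    by (simp add: carrier_sum_group)
  have inv\<alpha>: "\<alpha> (inv\<^bsub>\<Gamma>\<^esub> g) (\<alpha> g x) = x" if "g \<in> carrier \<Gamma>" "x \<in> X" for g x
    using act.orbit_sym_aux[OF that refl] .
  have inv\<alpha>': "\<alpha> g (\<alpha> (inv\<^bsub>\<Gamma>\<^esub> g) x) = x" if "g \<in> carrier \<Gamma>" "x \<in> X" for g x
    using act.orbit_sym_aux[OF \<Gamma>.inv_closed[OF that(1)] that(2) refl] that by simp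
  have \<theta>N: "\<theta> g f \<in> carrier ?N" if g: "g \<in> carrier \<Gamma>" and f: "f \<in> carrier ?N" for g f
  proof -
    have "{x \<in> X. \<theta> g f x \<noteq> \<one>\<^bsub>H\<^esub>} \<subseteq> \<alpha> g ` {x \<in> X. f x \<noteq> \<one>\<^bsub>H\<^esub>}"
    proof
      fix x assume x: "x \<in> {x \<in> X. \<theta> g f x \<noteq> \<one>\<^bsub>H\<^esub>}"
      then have "\<alpha> (inv\<^bsub>\<Gamma>\<^esub> g) x \<in> {x \<in> X. f x \<noteq> \<one>\<^bsub>H\<^esub>}" using g \<alpha>X by (auto simp: \<theta>_def split: if_splits)
      then show "x \<in> \<alpha> g ` {x \<in> X. f x \<noteq> \<one>\<^bsub>H\<^esub>}" using inv\<alpha>'[of g x] g x by (metis (no_types, lifting) imageI mem_Collect_eq)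
    qed
    then have "finite {x \<in> X. \<theta> g f x \<noteq> \<one>\<^bsub>H\<^esub>}" using f N finite_subset by (metis (no_types, lifting) finite_imageI mem_Collect_eq)
    moreover have "\<theta> g f \<in> X \<rightarrow>\<^sub>E carrier H" using f g \<alpha>X by (auto simp: \<theta>_def N PiE_iff)
    ultimately show ?thesis by (simp add: N)
  qed
  have "group_automorphism_action ?N \<Gamma> \<theta>"
  proof (rule group_automorphism_action.intro)
    show "group ?N" by simp
    show "group \<Gamma>" by (rule \<Gamma>.is_group)
  next
    fix g assume "g \<in> carrier \<Gamma>"
    then show "\<theta> g \<in> hom ?N ?N"
      using \<theta>N \<alpha>X by (auto simp: hom_def) (auto simp: \<theta>_def fun_eq_iff restrict_def)
  next
    fix f assume f: "f \<in> carrier ?N"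
    have "f x = undefined" if "x \<notin> X" for x using f that by (auto simp: N PiE_iff extensional_def)
    then show "\<theta> \<one>\<^bsub>\<Gamma>\<^esub> f = f" using act.id_eq_one[symmetric] by (auto simp: \<theta>_def fun_eq_iff restrict_def)
    fix g h assume gh: "g \<in> carrier \<Gamma>" "h \<in> carrier \<Gamma>"
    have "\<alpha> (inv\<^bsub>\<Gamma>\<^esub> (g \<otimes>\<^bsub>\<Gamma>\<^esub> h)) x = \<alpha> (inv\<^bsub>\<Gamma>\<^esub> h) (\<alpha> (inv\<^bsub>\<Gamma>\<^esub> g) x)" if "x \<in> X" for x
      using act.composition_rule[OF that, of "inv\<^bsub>\<Gamma>\<^esub> h" "inv\<^bsub>\<Gamma>\<^esub> g"] gh by (simp add: \<Gamma>.inv_mult_group)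
    then show "\<theta> (g \<otimes>\<^bsub>\<Gamma>\<^esub> h) f = \<theta> g (\<theta> h f)"
      using gh \<alpha>X by (auto simp: \<theta>_def fun_eq_iff restrict_def)
  qed
  then show "group_automorphism_action ?N \<Gamma> (\<lambda>g f. \<lambda>x\<in>X. f (\<alpha> (inv\<^bsub>\<Gamma>\<^esub> g) x))"
    by (simp add: \<theta>_def[abs_def])
  fix F1 F2 and \<epsilon> :: real
  assume F: "finite F1" "F1 \<subseteq> carrier \<Gamma>" "finite F2" "F2 \<subseteq> carrier ?N" "\<epsilon> > 0"
  define E0 where "E0 = (\<Union>f\<in>F2. {x \<in> X. f x \<noteq> \<one>\<^bsub>H\<^esub>})"
  \<comment> \<open>The translates make room for the supports of the functions
    \<open>\<theta> g f\<close>.\<close>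
  define E1 where "E1 = E0 \<union> (\<lambda>(g, y). \<alpha> g y) ` (F1 \<times> E0)"
  have E0: "finite E0" "E0 \<subseteq> X" unfolding E0_def using F by (auto simp: N)
  have E1: "finite E1" "E1 \<subseteq> X" unfolding E1_def using E0 F \<alpha>X by (auto simp: subset_iff)
  from sof[unfolded sofic_action_def, THEN conjunct2, rule_format, OF F(1,2) E1 F(5)]
  obtain A :: "nat set" and \<phi> where A: "finite A" "\<phi> \<in> carrier \<Gamma> \<rightarrow> carrier (BijGroup A)"
    "unital \<Gamma> A \<phi>" "approx_multiplicative \<Gamma> F1 \<epsilon> A \<phi>" "orbit_approximation \<Gamma> \<alpha> F1 E1 \<epsilon> A \<phi>"
    by (elim exE conjE) (rule that)
  from A(5) obtain B :: "nat set" and S \<pi> where B: "finite B" "S \<subseteq> A"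
    "real (card S) > (1 - \<epsilon>) * real (card A)"
    and emb: "\<forall>s\<in>S. \<pi> s \<in> E1 \<rightarrow> B \<and> inj_on (\<pi> s) E1"
    and equi: "\<forall>g\<in>F1. \<forall>x\<in>E1. \<forall>s\<in>S. \<phi> g s \<in> S \<longrightarrow> \<alpha> (inv\<^bsub>\<Gamma>\<^esub> g) x \<in> E1 \<longrightarrow>
        \<pi> (\<phi> g s) x = \<pi> s (\<alpha> (inv\<^bsub>\<Gamma>\<^esub> g) x)"
    unfolding orbit_approximation_def by (elim exE conjE) (rule that)
  \<comment> \<open>The restriction of \<open>f\<close> to \<open>E1\<close> is pushed forward along
    the injection \<open>\<pi> s\<close> and filled up with 1; this is multiplicative in each
    coordinate.\<close>
  define p where "p s f = (\<lambda>b\<in>B. if b \<in> \<pi> s ` E1 then f (inv_into E1 (\<pi> s) b) else \<one>\<^bsub>H\<^esub>)" for s and f :: "'x \<Rightarrow> 'h"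
  have pval: "p s f (\<pi> s y) = f y" if "s \<in> S" "y \<in> E1" for s f y
    using emb that by (auto simp: p_def inv_into_f_f)
  have pone: "p s f b = \<one>\<^bsub>H\<^esub>" if "b \<in> B" "s \<in> S" "\<And>y. y \<in> E1 \<Longrightarrow> \<pi> s y = b \<Longrightarrow> f y = \<one>\<^bsub>H\<^esub>" for s f b
  proof (cases "b \<in> \<pi> s ` E1")
    case True
    then obtain y where "y \<in> E1" "b = \<pi> s y" by blast
    then show ?thesis using pval[OF that(2)] that(3) by simp
  qed (use that in \<open>simp add: p_def\<close>)
  have phom: "p s \<in> hom ?N (product_group B (\<lambda>_. H))" if s: "s \<in> S" for s
  proof -
    have "inv_into E1 (\<pi> s) b \<in> X" if "b \<in> \<pi> s ` E1" for b using inv_into_into[OF that] E1 by blast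
    then show ?thesis by (auto simp: hom_def p_def N PiE_iff fun_eq_iff restrict_def)
  qed
  have nontriv: "p s f \<noteq> \<one>\<^bsub>product_group B (\<lambda>_. H)\<^esub>" if s: "s \<in> S" and f: "f \<in> F2" "f \<noteq> \<one>\<^bsub>?N\<^esub>" for s f
  proof -
    have "f \<in> carrier ?N" using f F by blast
    then have "f x = undefined" if "x \<notin> X" for x using that by (auto simp: N PiE_iff extensional_def)
    then obtain x where x: "x \<in> X" "f x \<noteq> \<one>\<^bsub>H\<^esub>" using f(2) by (auto simp: fun_eq_iff restrict_def split: if_splits)
    then have xE: "x \<in> E1" using f(1) by (auto simp: E1_def E0_def)
    have xB: "\<pi> s x \<in> B" using emb s xE by blast
    show ?thesis
    proof
      assume "p s f = \<one>\<^bsub>product_group B (\<lambda>_. H)\<^esub>"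
      then have "p s f (\<pi> s x) = \<one>\<^bsub>H\<^esub>" using xB by simp
      then show False using pval[OF s xE, of f] x(2) by simp
    qed
  qed
  have equiv: "p (\<phi> g s) (\<theta> g f) = p s f"
    if g: "g \<in> F1" and f: "f \<in> F2" and s: "s \<in> S" "\<phi> g s \<in> S" for g f s
  proof
    fix b
    have gc: "g \<in> carrier \<Gamma>" using g F by blast
    have shift: "\<alpha> g y \<in> E1" "\<pi> (\<phi> g s) (\<alpha> g y) = \<pi> s y" "\<theta> g f (\<alpha> g y) = f y"
      if y: "y \<in> X" "f y \<noteq> \<one>\<^bsub>H\<^esub>" for y
    proof -
      have yE: "y \<in> E0" using y f by (auto simp: E0_def)
      then show gE: "\<alpha> g y \<in> E1" using g by (auto simp: E1_def)
      have "\<pi> (\<phi> g s) (\<alpha> g y) = \<pi> s (\<alpha> (inv\<^bsub>\<Gamma>\<^esub> g) (\<alpha> g y))"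
        using bspec[OF bspec[OF bspec[OF equi g] gE] s(1)] s(2) inv\<alpha>[OF gc y(1)] yE by (simp add: E1_def)
      then show "\<pi> (\<phi> g s) (\<alpha> g y) = \<pi> s y" using inv\<alpha>[OF gc y(1)] by simp
      show "\<theta> g f (\<alpha> g y) = f y" using inv\<alpha>[OF gc y(1)] \<alpha>X[OF gc y(1)] by (simp add: \<theta>_def)
    qed
    show "p (\<phi> g s) (\<theta> g f) b = p s f b"
    proof (cases "b \<in> B")
      case False
      then show ?thesis by (simp add: p_def)
    next
      case b: True
      show ?thesis
      \<comment> \<open>\<open>E1\<close> need not be invariant under \<open>g\<close>, so
        \<open>b\<close> may be hit by only one of the two embeddings. Splitting by nontrivial
        values reduces the claim to supports, which stay inside \<open>E1\<close> when translated by
        \<open>g\<close>.\<close>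
      proof (cases "\<exists>y\<in>E1. \<pi> s y = b \<and> f y \<noteq> \<one>\<^bsub>H\<^esub>")
        case True
        then obtain y where y: "y \<in> E1" "\<pi> s y = b" "f y \<noteq> \<one>\<^bsub>H\<^esub>" by blast
        have yX: "y \<in> X" using y E1 by blast
        have "p (\<phi> g s) (\<theta> g f) (\<pi> (\<phi> g s) (\<alpha> g y)) = f y"
          using pval[OF s(2) shift(1)[OF yX y(3)]] shift(3)[OF yX y(3)] by simp
        then show ?thesis using shift(2)[OF yX y(3)] pval[OF s(1) y(1)] y(2) by simp
      next
        case False
        then have "p s f b = \<one>\<^bsub>H\<^esub>" by (intro pone[OF b s(1)]) blast
        moreover have "p (\<phi> g s) (\<theta> g f) b = \<one>\<^bsub>H\<^esub>"
        proof (rule pone[OF b s(2)], rule ccontr)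
          fix x assume x: "x \<in> E1" "\<pi> (\<phi> g s) x = b" "\<theta> g f x \<noteq> \<one>\<^bsub>H\<^esub>"
          have xX: "x \<in> X" using x E1 by blast
          define y where "y = \<alpha> (inv\<^bsub>\<Gamma>\<^esub> g) x"
          have y: "y \<in> X" "f y \<noteq> \<one>\<^bsub>H\<^esub>" using x xX gc \<alpha>X by (auto simp: y_def \<theta>_def)
          have "y \<in> E1" using y f by (auto simp: E1_def E0_def)
          moreover have "\<pi> s y = b" using shift(2)[OF y] inv\<alpha>'[OF gc xX] x(2) by (simp add: y_def)
          ultimately show False using False y(2) by blast
        qed
        ultimately show ?thesis by simp
      qed
    qed
  qed
  have "equivariant_model ?N \<Gamma> \<theta> (product_group B (\<lambda>_. H)) F1 F2 \<epsilon>"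
    unfolding equivariant_model_def using A B phom nontriv equiv
    by (intro exI[of _ A] exI[of _ \<phi>] exI[of _ S] exI[of _ p] conjI ballI impI) auto
  then show "\<exists>Q :: (nat \<Rightarrow> 'h) monoid. strongly_sofic Q d \<and>
      equivariant_model ?N \<Gamma> (\<lambda>g f. \<lambda>x\<in>X. f (\<alpha> (inv\<^bsub>\<Gamma>\<^esub> g) x)) Q F1 F2 \<epsilon>"
    using strongly_sofic_power[OF H(1) B(1)] unfolding \<theta>_def[abs_def] by blast
qed

end

text \<open>The assumptions on free and graph products are each applied once, to the constant family
  \<open>H\<close> over the whole type \<open>'v\<close>. As this type is infinite, it has room for
  a universal graph, and so for every finite graph that an approximation may produce.\<close>

theorem theorem6p15:
  fixes K :: "'k ring" and \<Gamma> :: "'g monoid" and H :: "'h monoid"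
    and X :: "'x set" and \<alpha> :: "'g \<Rightarrow> 'x \<Rightarrow> 'x"
    and Y :: "'y set" and E\<^sub>Y :: "('y \<times> 'y) set" and \<beta> :: "'g \<Rightarrow> 'y \<Rightarrow> 'y"
  assumes "field K"
    and "linear_sofic K \<Gamma>" and "linear_sofic K H"
    and "sofic_action \<Gamma> X \<alpha>" and "sofic_graph_action \<Gamma> Y E\<^sub>Y \<beta>"
  shows "linear_sofic K (wreath_product H \<Gamma> X \<alpha>) \<and>
    ((\<forall>(L :: 'k ring) (V :: ('v::infinite) set) (G :: 'v \<Rightarrow> 'h monoid).
        field L \<longrightarrow> (\<forall>v\<in>V. linear_sofic L (G v)) \<longrightarrow> linear_sofic L (free_product V G))
      \<longrightarrow> linear_sofic K (free_wreath_product H \<Gamma> X \<alpha>)) \<and>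
    ((\<forall>(L :: 'k ring) (V :: 'v set) (E :: ('v \<times> 'v) set) (G :: 'v \<Rightarrow> 'h monoid).
        field L \<longrightarrow> simple_graph V E \<longrightarrow> (\<forall>v\<in>V. linear_sofic L (G v)) \<longrightarrow>
        linear_sofic L (graph_product V E G))
      \<longrightarrow> linear_sofic K (graph_wreath_product \<Gamma> H Y E\<^sub>Y \<beta>))"
proof -
  interpret field K by (rule assms(1))
  obtain c where c: "c > 0" "strongly_sofic \<Gamma> c" using linear_sofic_imp_strongly_sofic[OF assms(2)] .
  obtain d where d: "d > 0" "strongly_sofic H d" using linear_sofic_imp_strongly_sofic[OF assms(3)] .
  have H: "group H" using d by (simp add: strongly_sofic_def)
  show ?thesis
  proof (intro conjI impI)
    show "linear_sofic K (wreath_product H \<Gamma> X \<alpha>)"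
      by (rule strongly_sofic_imp_linear_sofic[OF wreath_strongly_sofic[OF c(2) d(2,1) assms(4)]])
        (use c d in simp)
  next
    assume free: "\<forall>(L :: 'k ring) (V :: 'v set) (G :: 'v \<Rightarrow> 'h monoid).
        field L \<longrightarrow> (\<forall>v\<in>V. linear_sofic L (G v)) \<longrightarrow> linear_sofic L (free_product V G)"
    have "linear_sofic K (free_product (UNIV :: 'v set) (\<lambda>_. H))" by (rule free[rule_format]) (use assms(1,3) in simp_all)
    then obtain e where e: "e > 0" "strongly_sofic (free_product (UNIV :: 'v set) (\<lambda>_. H)) e"
      by (rule linear_sofic_imp_strongly_sofic)
    show "linear_sofic K (free_wreath_product H \<Gamma> X \<alpha>)"
      by (rule strongly_sofic_imp_linear_sofic[OF free_wreath_strongly_sofic[OF c(2) H assms(4) e(2,1)]])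
        (use c e in simp)
  next
    assume graph: "\<forall>(L :: 'k ring) (V :: 'v set) (E :: ('v \<times> 'v) set) (G :: 'v \<Rightarrow> 'h monoid).
        field L \<longrightarrow> simple_graph V E \<longrightarrow> (\<forall>v\<in>V. linear_sofic L (G v)) \<longrightarrow>
        linear_sofic L (graph_product V E G)"
    obtain U :: "('v \<times> 'v) set" where U: "universal_graph U" using universal_graph_exists by blast
    then have "simple_graph UNIV U" by (simp add: universal_graph_def)
    then have "linear_sofic K (graph_product UNIV U (\<lambda>_. H))"
      by (intro graph[rule_format]) (use assms(1,3) in simp_all)
    then obtain e where e: "e > 0" "strongly_sofic (graph_product UNIV U (\<lambda>_. H)) e"
      by (rule linear_sofic_imp_strongly_sofic)
    show "linear_sofic K (graph_wreath_product \<Gamma> H Y E\<^sub>Y \<beta>)"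
      by (rule strongly_sofic_imp_linear_sofic[OF graph_wreath_strongly_sofic[OF c(2) H assms(5) U e(2,1)]])
        (use c e in simp)
  qed
qed

end
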